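(* Let $n\ge2$, let $f(\mathbf z)$ be a convenient non-degenerate holomorphic function near the origin of $\mathbb C^n$ with $f(0)=0$, let $a>b>0$ be integers, and let $g(\mathbf w,\bar{\mathbf w})=f(w_1^a\bar w_1^b,\dots,w_n^a\bar w_n^b)$ (a convenient non-degenerate mixed function of strongly polar weighted homogeneous face type). For $r>0$ let $K_r=g^{-1}(0)\cap\mathbb S_r$. Then there exists $r_0>0$ such that for every $0<r\le r_0$ the Milnor open book $g/|g|:\mathbb S_r\setminus K_r\to S^1$ carries a contact structure. If further $f$ is a weighted homogeneous polynomial, this holds for every $r>0$.
   Context: $\mathbb S_r=\{\sum|w_j|^2=r^2\}$. Convenient/non-degenerate: the Newton boundary of $f$ meets every coordinate axis and for every positive integer weight vector $P$ the face function $f_P$ has no critical point on $f_P^{-1}(0)\cap(\mathbb C^* )^n$. Weighted homogeneous: $f(t^{p_1}z_1,\dots,t^{p_n}z_n)=t^df(\mathbf z)$ for positive integers $p_j,d$. For small $r$ (all $r$ in the weighted homogeneous case), $(K_r,g/|g|)$ is an open book: $K_r$ a codimension-two submanifold with trivial normal bundle and $\theta=g/|g|$ a locally trivial fibration agreeing with the angular coordinate near $K_r$. A contact structure $\xi=\ker\beta$ ($\beta$ a contact 1-form) is carried by the open book $(N,\theta)$ if for some such contact form $\beta$: (1) $\beta|_N$ is a contact form on $N$; (2) $d\beta$ is symplectic on each fiber $\theta^{-1}(\eta)$ (equivalently $d\theta(R_\beta)>0$ for the Reeb field $R_\beta$); (3) the orientation of $N$ induced by $\beta$ agrees with its orientation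 as the boundary of the fibers. *)

theory Defs
  imports "HOL-Analysis.Analysis" "HOL-Combinatorics.Permutations"
begin

definition monom :: "('n::finite \<Rightarrow> nat) \<Rightarrow> complex^'n \<Rightarrow> complex" where
  "monom \<alpha> z = (\<Prod>j\<in>UNIV. (z$j) ^ (\<alpha> j))"

definition power_series_near0 ::
  "(('n::finite \<Rightarrow> nat) \<Rightarrow> complex) \<Rightarrow> (complex^'n \<Rightarrow> complex) \<Rightarrow> real \<Rightarrow> bool" where
  "power_series_near0 c f \<epsilon> \<longleftrightarrow> \<epsilon> > 0 \<and>
     (\<forall>z\<in>ball 0 \<epsilon>. ((\<lambda>\<alpha>. c \<alpha> * monom \<alpha> z) has_sum f z) UNIV)"

text \<open>Convenient: the Newton boundary meets every coordinate axis, i.e. for every j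
  some pure power z_j^m (m>0) occurs in f.\<close>
definition convenient :: "(('n::finite \<Rightarrow> nat) \<Rightarrow> complex) \<Rightarrow> bool" where
  "convenient c \<longleftrightarrow> (\<forall>j. \<exists>m>0. c (\<lambda>i. if i = j then m else 0) \<noteq> 0)"

definition wdeg :: "('n::finite \<Rightarrow> nat) \<Rightarrow> ('n \<Rightarrow> nat) \<Rightarrow> nat" where
  "wdeg P \<alpha> = (\<Sum>j\<in>UNIV. P j * \<alpha> j)"

text \<open>d(P) = minimum of P on the Newton polyhedron (attained on the support).\<close>
definition min_deg :: "(('n::finite \<Rightarrow> nat) \<Rightarrow> complex) \<Rightarrow> ('n \<Rightarrow> nat) \<Rightarrow> nat" where
  "min_deg c P = Inf {wdeg P \<alpha> | \<alpha>. c \<alpha> \<noteq> 0}"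

definition face_fun :: "(('n::finite \<Rightarrow> nat) \<Rightarrow> complex) \<Rightarrow> ('n \<Rightarrow> nat) \<Rightarrow> complex^'n \<Rightarrow> complex" where
  "face_fun c P z = (\<Sum>\<alpha>\<in>{\<alpha>. c \<alpha> \<noteq> 0 \<and> wdeg P \<alpha> = min_deg c P}. c \<alpha> * monom \<alpha> z)"

definition nondegenerate :: "(('n::finite \<Rightarrow> nat) \<Rightarrow> complex) \<Rightarrow> bool" where
  "nondegenerate c \<longleftrightarrow> (\<forall>P. (\<forall>j. P j > 0) \<longrightarrow>
     (\<forall>z::complex^'n. (\<forall>j. z$j \<noteq> 0) \<longrightarrow> face_fun c P z = 0 \<longrightarrow>
        \<not> (face_fun c P has_derivative (\<lambda>h. 0)) (at z)))"

definition weighted_homog_poly :: "(complex^'n::finite \<Rightarrow> complex) \<Rightarrow> bool" where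
  "weighted_homog_poly f \<longleftrightarrow>
     (\<exists>c. finite {\<alpha>. c \<alpha> \<noteq> 0} \<and> (\<forall>z. f z = (\<Sum>\<alpha>\<in>{\<alpha>. c \<alpha> \<noteq> 0}. c \<alpha> * monom \<alpha> z))) \<and>
     (\<exists>p::'n \<Rightarrow> nat. \<exists>d::nat. (\<forall>j. p j > 0) \<and> d > 0 \<and>
        (\<forall>(t::complex) z. f (\<chi> j. t ^ (p j) * z$j) = t ^ d * f z))"

definition mixed_fun :: "nat \<Rightarrow> nat \<Rightarrow> (complex^'n::finite \<Rightarrow> complex) \<Rightarrow> complex^'n \<Rightarrow> complex" where
  "mixed_fun a b f w = f (\<chi> j. (w$j) ^ a * (cnj (w$j)) ^ b)"

fun diter :: "'a::real_normed_vector list \<Rightarrow> ('a \<Rightarrow> 'b::real_normed_vector) \<Rightarrow> 'a \<Rightarrow> 'b" where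
  "diter [] F = F"
| "diter (v # vs) F = (\<lambda>x. frechet_derivative (diter vs F) (at x) v)"

definition smooth_on :: "'a::real_normed_vector set \<Rightarrow> ('a \<Rightarrow> 'b::real_normed_vector) \<Rightarrow> bool" where
  "smooth_on U F \<longleftrightarrow> (\<forall>vs. \<forall>x\<in>U. diter vs F differentiable (at x))"

text \<open>A smooth 1-form beta on an open set is represented by a smooth vector field B via
  beta_x(v) = <B x, v> (real inner product of C^n = R^{2n}).\<close>
definition beta :: "(complex^'n::finite \<Rightarrow> complex^'n) \<Rightarrow> complex^'n \<Rightarrow> complex^'n \<Rightarrow> real" where
  "beta B x v = inner (B x) v"

definition dbeta :: "(complex^'n::finite \<Rightarrow> complex^'n) \<Rightarrow> complex^'n \<Rightarrow> complex^'n \<Rightarrow> complex^'n \<Rightarrow> real" where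
  "dbeta B x u v = inner (frechet_derivative B (at x) u) v - inner (frechet_derivative B (at x) v) u"

text \<open>(beta \<and> (d beta)^m)_x evaluated on vectors vs 0, ..., vs (2m), up to the positive
  constant factor m! 2^m (irrelevant for non-vanishing and signs).\<close>
definition wedge :: "nat \<Rightarrow> (complex^'n::finite \<Rightarrow> complex^'n) \<Rightarrow> complex^'n \<Rightarrow> (nat \<Rightarrow> complex^'n) \<Rightarrow> real" where
  "wedge m B x vs = (\<Sum>\<sigma>\<in>{\<sigma>. \<sigma> permutes {0..2*m}}.
      of_int (sign \<sigma>) * beta B x (vs (\<sigma> 0)) *
      (\<Prod>i\<in>{1..m}. dbeta B x (vs (\<sigma> (2*i - 1))) (vs (\<sigma> (2*i)))))"

definition contact_at :: "(complex^'n) set \<Rightarrow> nat \<Rightarrow> (complex^'n::finite \<Rightarrow> complex^'n) \<Rightarrow> complex^'n \<Rightarrow> bool" where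
  "contact_at T m B x \<longleftrightarrow> (\<exists>vs. (\<forall>i\<le>2*m. vs i \<in> T) \<and> wedge m B x vs \<noteq> 0)"

text \<open>Tangent space of the sphere S_r at x, of the binding K_r = g^{-1}(0) \<inter> S_r at x, and of the
  page theta^{-1}(theta(x)) through x, theta = g/|g| (tangent spaces of K_r and of the pages are
  kernels; the regularity making this legitimate is part of the conclusion below).\<close>
definition TS :: "complex^'n::finite \<Rightarrow> (complex^'n) set" where
  "TS x = {v. inner x v = 0}"

definition TK :: "(complex^'n::finite \<Rightarrow> complex) \<Rightarrow> complex^'n \<Rightarrow> (complex^'n) set" where
  "TK g x = {v. inner x v = 0 \<and> frechet_derivative g (at x) v = 0}"

text \<open>d theta_x(v) for theta = g/|g| (as angular derivative): Im(Dg_x(v) / g(x)).\<close>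
definition dtheta :: "(complex^'n::finite \<Rightarrow> complex) \<Rightarrow> complex^'n \<Rightarrow> complex^'n \<Rightarrow> real" where
  "dtheta g x v = Im (frechet_derivative g (at x) v / g x)"

definition TP :: "(complex^'n::finite \<Rightarrow> complex) \<Rightarrow> complex^'n \<Rightarrow> (complex^'n) set" where
  "TP g x = {v. inner x v = 0 \<and> dtheta g x v = 0}"

text \<open>The Milnor open book (K_r, g/|g|) on S_r carries a contact structure ker beta.
  Includes the regularity of K_r and of theta making (K_r, theta) an open book with the
  stated tangent spaces; then (0) beta contact on S_r, (1) beta|K_r contact,
  (2) d beta symplectic on the pages, and d theta(R_beta) > 0,
  (3) orientation of K_r induced by beta = boundary orientation of the pages
      (pages oriented by d beta, i.e. (coorientation u, page) positive for
       beta \<and> (d beta)^(n-1); outward normal of a page at K_r is -w with Dg(w) = 1 for the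
       page theta = 1, u with Dg(u) = i the coorientation).\<close>
definition carries_contact :: "(complex^'n::finite \<Rightarrow> complex) \<Rightarrow> real \<Rightarrow> bool" where
  "carries_contact g r \<longleftrightarrow>
     (let S = sphere (0::complex^'n) r; K = {x\<in>S. g x = 0}; n = CARD('n) in
       (\<forall>x\<in>S. g differentiable (at x)) \<and>
       (\<forall>x\<in>K. frechet_derivative g (at x) ` TS x = UNIV) \<and>
       (\<forall>x\<in>S - K. \<exists>v\<in>TS x. dtheta g x v \<noteq> 0) \<and>
       (\<exists>B U. open U \<and> S \<subseteq> U \<and> smooth_on U B \<and>
          (\<forall>x\<in>S. contact_at (TS x) (n - 1) B x) \<and>
          (\<forall>x\<in>K. contact_at (TK g x) (n - 2) B x) \<and>
          (\<forall>x\<in>S - K. \<forall>u\<in>TP g x. (\<forall>v\<in>TP g x. dbeta B x u v = 0) \<longrightarrow> u = 0) \<and>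
          (\<forall>x\<in>S - K. \<forall>R. R \<in> TS x \<and> beta B x R = 1 \<and> (\<forall>v\<in>TS x. dbeta B x R v = 0)
               \<longrightarrow> dtheta g x R > 0) \<and>
          (\<forall>x\<in>K. \<forall>u w e. u \<in> TS x \<and> w \<in> TS x \<and>
               frechet_derivative g (at x) w = 1 \<and> frechet_derivative g (at x) u = \<i> \<and>
               (\<forall>i. e i \<in> TK g x) \<longrightarrow>
               wedge (n - 1) B x (\<lambda>i. if i = 0 then u else if i = 1 then - w else e (i - 2))
                 * wedge (n - 2) B x e \<ge> 0)))"

end

theory Submission
  imports Defs
begin

text \<open>
  Write \<open>g\<close> for the mixed function, \<open>s = a + b\<close>, \<open>m = a - b\<close>. Then
  \<open>dg(v) = \<Sum>\<^sub>j h\<^sub>j (s Re (cnj w\<^sub>j v\<^sub>j) + i m Im (cnj w\<^sub>j v\<^sub>j))\<close> with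
  \<open>h\<^sub>j = (\<partial>\<^sub>j f)(w\<^sup>a cnj w\<^sup>b) w\<^sub>j\<^bsup>a-1\<^esup> cnj w\<^sub>j\<^bsup>b-1\<^esup>\<close>. Away from the coordinate hyperplanes \<open>dg\<close> is complex linear
  for a complex structure that stretches angles against radii by \<open>s/m\<close>; it preserves the standard
  contact hyperplane \<open>\<xi>\<close> and is tamed by \<open>d\<alpha>\<close>, so the binding is a contact submanifold as soon as it is regular.

  Everything else rests on one condition on \<open>w \<in> S\<^sub>r\<close>: if \<open>dg\<close> vanishes on \<open>\<xi>\<close>, i.e. if all \<open>h\<^sub>j\<close> with
  \<open>w\<^sub>j \<noteq> 0\<close> equal one \<open>\<nu>\<close>, then \<open>g w \<noteq> 0\<close> and \<open>Re (\<nu> / g w) > 0\<close>. Near the origin it follows from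
  non-degeneracy: along a sequence of counterexamples tending to \<open>0\<close> the leading part of \<open>f\<close> is a face function
  \<open>f\<^sub>P\<close>, and Euler's relation for \<open>f\<^sub>P\<close> gives a contradiction. In the weighted homogeneous case Euler's
  relation is exact and scaling transports the condition to all radii.

  Given the condition, the contact form is \<open>exp (- \<psi>) \<alpha>\<close> with \<open>\<psi> = Re (\<kappa> cnj g) + C |g|\<^sup>2\<close>: the first term makes
  the Reeb field tangent to the binding, and for large \<open>C\<close> the second one makes it positively transverse to the pages.
\<close>

section \<open>Derivatives of power series in several variables\<close>

text \<open>The obstacle: off the binding all the \<open>h_j\<close> may coincide. Then dg vanishes
  on the contact hyperplane, and since a change of \<psi> moves the Reeb direction only within that
  hyperplane, it cannot influence dg there. The measure for this is \<open>N\<close>, a multiple of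
  the variance of the \<open>h_j\<close> for the weights |w_j|^2. The Reeb direction is Y = iw + r^2
  (Hamiltonian vector of d\<psi>). Here dg(iw) = i m r^2 hmean, while dg sends the Hamiltonian
  vector of Re (cnj \<mu> dg) to i \<mu> N. On g = 0 the condition forces N > 0, so - m hmean / N is
  the value of \<kappa> that gives dg(Y) = 0; the denominator N + |g|^2 extends it smoothly over the
  sphere. Off the binding, Im (dg(Y) / g) / r^2 equals q + 2 C N up to an error K sqrt N caused by
  d\<kappa>, with q = m Re (hmean cnj g) / (N + |g|^2). Where N = 0 only q is left, and its
  positivity is exactly the condition for \<nu> = hmean; compactness of the sphere then yields
  C.\<close>

definition monom_diff :: "'n \<Rightarrow> ('n::finite \<Rightarrow> nat) \<Rightarrow> complex^'n \<Rightarrow> complex" where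
  "monom_diff j \<alpha> z = of_nat (\<alpha> j) * monom (\<alpha>(j := \<alpha> j - 1)) z"

definition diff_coeff :: "(('n::finite \<Rightarrow> nat) \<Rightarrow> complex) \<Rightarrow> 'n \<Rightarrow> ('n \<Rightarrow> nat) \<Rightarrow> complex" where
  "diff_coeff c j \<alpha> = of_nat (\<alpha> j + 1) * c (\<alpha>(j := \<alpha> j + 1))"

text \<open>Given by coefficients rather than as the derivative of a function, so that a partial
  derivative is again a power series and can be differentiated in turn.\<close>

definition series_diff :: "(('n::finite \<Rightarrow> nat) \<Rightarrow> complex) \<Rightarrow> 'n \<Rightarrow> complex^'n \<Rightarrow> complex" where
  "series_diff c j z = (\<Sum>\<^sub>\<infinity>\<alpha>. diff_coeff c j \<alpha> * monom \<alpha> z)"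

lemma norm_monom: "norm (monom \<alpha> z) = (\<Prod>j\<in>UNIV. norm (z$j) ^ \<alpha> j)"
  by (simp add: monom_def prod_norm[symmetric] norm_power)

lemma monom_remove: "monom \<alpha> z = (z$j) ^ \<alpha> j * (\<Prod>i\<in>UNIV - {j}. (z$i) ^ \<alpha> i)"
  unfolding monom_def by (rule prod.remove) auto

lemma monom_upd: "monom (\<alpha>(j := k)) z = (z$j) ^ k * (\<Prod>i\<in>UNIV - {j}. (z$i) ^ \<alpha> i)"
  by (subst monom_remove[of _ _ j]) (auto intro!: prod.cong)

lemma monom_diff_mult: "z$j * monom_diff j \<alpha> z = of_nat (\<alpha> j) * monom \<alpha> z"
  by (cases "\<alpha> j") (simp_all add: monom_diff_def monom_upd monom_remove[of \<alpha> z j])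

lemma monom_0: "monom \<alpha> 0 = (if \<alpha> = (\<lambda>_. 0) then 1 else 0)"
proof -
  have "(\<Prod>j\<in>UNIV. (0::complex) ^ \<alpha> j) = 0" if "\<alpha> \<noteq> (\<lambda>_. 0)"
    using that by (intro prod_zero) (auto simp: fun_eq_iff)
  then show ?thesis by (auto simp: monom_def)
qed

lemma monom_has_derivative:
  "(monom \<alpha> has_derivative (\<lambda>v. \<Sum>j\<in>UNIV. monom_diff j \<alpha> z * v$j)) (at z within S)"
proof -
  have "((\<lambda>z. \<Prod>j\<in>UNIV. (z$j) ^ \<alpha> j) has_derivative
     (\<lambda>v. \<Sum>j\<in>UNIV. (of_nat (\<alpha> j) * v$j * (z$j) ^ (\<alpha> j - 1)) * (\<Prod>i\<in>UNIV - {j}. (z$i) ^ \<alpha> i))) (at z within S)"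
    by (intro has_derivative_prod has_derivative_power bounded_linear_imp_has_derivative
          bounded_linear_vec_nth)
  moreover have "(\<lambda>z. \<Prod>j\<in>UNIV. (z$j) ^ \<alpha> j) = monom \<alpha>"
    by (simp add: monom_def fun_eq_iff)
  moreover have "(\<lambda>v. \<Sum>j\<in>UNIV. (of_nat (\<alpha> j) * v$j * (z$j) ^ (\<alpha> j - 1)) * (\<Prod>i\<in>UNIV - {j}. (z$i) ^ \<alpha> i)) =
      (\<lambda>v. \<Sum>j\<in>UNIV. monom_diff j \<alpha> z * v$j)"
    by (intro ext sum.cong) (simp_all add: monom_diff_def monom_upd)
  ultimately show ?thesis by (simp only:)
qed

lemma power_series_abs_summable:
  assumes "power_series_near0 c f \<epsilon>" "z \<in> ball 0 \<epsilon>"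
  shows "(\<lambda>\<alpha>. norm (c \<alpha> * monom \<alpha> z)) summable_on UNIV"
proof -
  have "(\<lambda>\<alpha>. c \<alpha> * monom \<alpha> z) summable_on UNIV"
    using assms has_sum_imp_summable unfolding power_series_near0_def by blast
  then show ?thesis by (subst (asm) summable_on_iff_abs_summable_on_complex)
qed

text \<open>An elementary Cauchy estimate: the induction keeps the first two terms of the binomial
  expansion of \<open>(t + d) ^ n\<close>, and \<open>t ^ n\<close> is dropped afterwards.\<close>

lemma of_nat_power_le_shift:
  fixes t d :: real
  assumes "t \<ge> 0" "d > 0"
  shows "of_nat n * t ^ (n - 1) \<le> (t + d) ^ n / d"
proof -
  have "of_nat n * t ^ (n - 1) * d + t ^ n \<le> (t + d) ^ n"
  proof (induction n)
    case (Suc n)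
    have "of_nat (Suc n) * t ^ n * d + t ^ Suc n \<le> (of_nat n * t ^ (n - 1) * d + t ^ n) * (t + d)"
    proof (cases n)
      case (Suc k)
      have "0 \<le> of_nat n * t ^ (n - 1) * d * d" using assms by simp
      then show ?thesis using Suc by (simp add: algebra_simps)
    qed (use assms in simp)
    also have "\<dots> \<le> (t + d) ^ n * (t + d)"
      using Suc assms by (intro mult_right_mono) auto
    finally show ?case by (simp add: algebra_simps)
  qed simp
  moreover have "0 \<le> t ^ n" using assms by simp
  ultimately have "of_nat n * t ^ (n - 1) * d \<le> (t + d) ^ n" by linarith
  then show ?thesis using assms by (simp add: pos_le_divide_eq)
qed

text \<open>A single summable majorant for the differentiated terms, uniform near \<open>z0\<close>;
  it serves both for summability and for the M-test.\<close>

lemma power_series_dominated: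
  fixes c :: "('n::finite \<Rightarrow> nat) \<Rightarrow> complex"
  assumes ps: "power_series_near0 c f \<epsilon>" and z0: "z0 \<in> ball 0 \<epsilon>"
  obtains \<delta> M where "\<delta> > 0" "M summable_on UNIV" "ball z0 \<delta> \<subseteq> ball 0 \<epsilon>"
    "\<And>j \<alpha> z. z \<in> ball z0 \<delta> \<Longrightarrow> norm (c \<alpha> * monom_diff j \<alpha> z) \<le> M \<alpha>"
proof -
  \<comment> \<open>Radii |z0_j| + 2d: one d covers the ball around \<open>z0\<close>, the other
    pays for the Cauchy estimate.\<close>
  define y where "y d = (\<chi> j. complex_of_real (norm (z0$j) + 2 * d))" for d
  have ny: "norm (y 0) = norm z0"
    by (simp add: y_def norm_vec_def)
  have "(y \<longlongrightarrow> y 0) (at_right 0)"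
    unfolding y_def by (intro vec_tendstoI) (auto intro!: tendsto_eq_intros)
  then have "((\<lambda>d. norm (y d)) \<longlongrightarrow> norm (y 0)) (at_right 0)"
    by (rule tendsto_norm)
  then have "\<forall>\<^sub>F d in at_right 0. norm (y d) < \<epsilon>"
    using z0 ny by (intro order_tendstoD) auto
  moreover have "\<forall>\<^sub>F d in at_right 0. d < \<epsilon> - norm z0"
    using z0 by (intro order_tendstoD(2)[OF tendsto_ident_at]) auto
  moreover have "\<forall>\<^sub>F d in at_right (0::real). 0 < d" by (rule eventually_at_right_less)
  ultimately have "\<forall>\<^sub>F d in at_right 0. norm (y d) < \<epsilon> \<and> d < \<epsilon> - norm z0 \<and> 0 < d"
    by eventually_elim auto
  then obtain d where d: "norm (y d) < \<epsilon>" "d < \<epsilon> - norm z0" "0 < d"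
    using eventually_happens'[of "at_right (0::real)"] by auto
  define M where "M \<alpha> = norm (c \<alpha> * monom \<alpha> (y d)) * (1/d)" for \<alpha>
  have "(\<lambda>\<alpha>. norm (c \<alpha> * monom \<alpha> (y d))) summable_on UNIV"
    by (rule power_series_abs_summable[OF ps]) (use d in simp)
  then have M: "M summable_on UNIV"
    unfolding M_def by (rule summable_on_cmult_left)
  have "ball z0 d \<subseteq> ball 0 \<epsilon>"
  proof
    fix z assume "z \<in> ball z0 d"
    then show "z \<in> ball 0 \<epsilon>"
      using d(2) norm_triangle_sub[of z z0] by (simp add: dist_norm norm_minus_commute)
  qed
  moreover have "norm (c \<alpha> * monom_diff j \<alpha> z) \<le> M \<alpha>" if z: "z \<in> ball z0 d" for j \<alpha> z
  proof -
    have zj: "norm (z$i) \<le> norm (z0$i) + d" for i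
    proof -
      have "norm ((z - z0)$i) \<le> norm (z - z0)" by (rule Finite_Cartesian_Product.norm_nth_le)
      then show ?thesis
        using z norm_triangle_sub[of "z$i" "z0$i"] by (simp add: dist_norm norm_minus_commute)
    qed
    have yj: "norm (y d $ i) = norm (z0$i) + d + d" for i
      using d by (simp add: y_def flip: of_real_add)
    have "norm (monom_diff j \<alpha> z) = of_nat (\<alpha> j) * norm (z$j) ^ (\<alpha> j - 1) * (\<Prod>i\<in>UNIV - {j}. norm (z$i) ^ \<alpha> i)"
      by (simp add: monom_diff_def monom_upd norm_mult norm_power prod_norm[symmetric])
    also have "\<dots> \<le> (norm (y d $ j) ^ \<alpha> j / d) * (\<Prod>i\<in>UNIV - {j}. norm (y d $ i) ^ \<alpha> i)"
    proof (rule mult_mono)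
      have "of_nat (\<alpha> j) * norm (z$j) ^ (\<alpha> j - 1) \<le> of_nat (\<alpha> j) * (norm (z0$j) + d) ^ (\<alpha> j - 1)"
        by (intro mult_left_mono power_mono zj) auto
      also have "\<dots> \<le> norm (y d $ j) ^ \<alpha> j / d"
        unfolding yj using d by (intro of_nat_power_le_shift) auto
      finally show "of_nat (\<alpha> j) * norm (z$j) ^ (\<alpha> j - 1) \<le> norm (y d $ j) ^ \<alpha> j / d" .
      show "(\<Prod>i\<in>UNIV - {j}. norm (z$i) ^ \<alpha> i) \<le> (\<Prod>i\<in>UNIV - {j}. norm (y d $ i) ^ \<alpha> i)"
      proof (intro prod_mono conjI power_mono)
        fix i show "norm (z$i) \<le> norm (y d $ i)" using zj[of i] d unfolding yj by simp
      qed auto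
    qed (use d in \<open>auto intro!: prod_nonneg\<close>)
    also have "\<dots> = norm (monom \<alpha> (y d)) / d"
      unfolding norm_monom using prod.remove[of UNIV j "\<lambda>i. norm (y d $ i) ^ \<alpha> i"] by simp
    finally have "norm (c \<alpha>) * norm (monom_diff j \<alpha> z) \<le> norm (c \<alpha>) * (norm (monom \<alpha> (y d)) / d)"
      by (rule mult_left_mono) simp
    then show ?thesis unfolding M_def by (simp add: norm_mult)
  qed
  ultimately show thesis using that d M by blast
qed

lemma series_diff_has_sum:
  fixes c :: "('n::finite \<Rightarrow> nat) \<Rightarrow> complex"
  assumes ps: "power_series_near0 c f \<epsilon>" and z: "z \<in> ball 0 \<epsilon>"
  shows "((\<lambda>\<alpha>. diff_coeff c j \<alpha> * monom \<alpha> z) has_sum series_diff c j z) UNIV"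
    and "((\<lambda>\<alpha>. c \<alpha> * monom_diff j \<alpha> z) has_sum series_diff c j z) UNIV"
proof -
  obtain \<delta> M where \<delta>: "\<delta> > 0" and M: "M summable_on UNIV"
    and le: "\<And>j \<alpha> y. y \<in> ball z \<delta> \<Longrightarrow> norm (c \<alpha> * monom_diff j \<alpha> y) \<le> M \<alpha>"
    using power_series_dominated[OF ps z] by metis
  have sm: "(\<lambda>\<alpha>. c \<alpha> * monom_diff j \<alpha> z) summable_on UNIV"
    by (rule abs_summable_summable, rule summable_on_comparison_test[OF M])
      (use le[of z] \<delta> in auto)
  let ?s = "\<lambda>\<alpha>::'n \<Rightarrow> nat. \<alpha>(j := \<alpha> j + 1)"
  have inj: "inj ?s"
  proof (rule injI)
    fix \<alpha> \<beta> assume eq: "?s \<alpha> = ?s \<beta>"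
    show "\<alpha> = \<beta>"
    proof
      fix i show "\<alpha> i = \<beta> i" using fun_cong[OF eq, of i] by (cases "i = j") auto
    qed
  qed
  \<comment> \<open>The shift misses only exponents with \<open>\<alpha> j = 0\<close>, whose
    \<open>monom_diff\<close> is zero, so both series have the same sum.\<close>
  have rng: "range ?s = {\<alpha>. \<alpha> j > 0}"
  proof safe
    fix \<alpha> :: "'n \<Rightarrow> nat" assume "\<alpha> j > 0"
    then have "\<alpha> = ?s (\<alpha>(j := \<alpha> j - 1))" by auto
    then show "\<alpha> \<in> range ?s" by blast
  qed auto
  have comp: "(\<lambda>\<alpha>. c \<alpha> * monom_diff j \<alpha> z) \<circ> ?s = (\<lambda>\<alpha>. diff_coeff c j \<alpha> * monom \<alpha> z)"
    by (simp add: fun_eq_iff diff_coeff_def monom_diff_def)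
  have eq: "((\<lambda>\<alpha>. c \<alpha> * monom_diff j \<alpha> z) has_sum x) UNIV \<longleftrightarrow>
     ((\<lambda>\<alpha>. diff_coeff c j \<alpha> * monom \<alpha> z) has_sum x) UNIV" for x
  proof -
    have "((\<lambda>\<alpha>. c \<alpha> * monom_diff j \<alpha> z) has_sum x) UNIV \<longleftrightarrow>
        ((\<lambda>\<alpha>. c \<alpha> * monom_diff j \<alpha> z) has_sum x) (range ?s)"
      unfolding rng by (rule has_sum_cong_neutral) (auto simp: monom_diff_def)
    also have "\<dots> \<longleftrightarrow> ((\<lambda>\<alpha>. diff_coeff c j \<alpha> * monom \<alpha> z) has_sum x) UNIV"
      unfolding has_sum_reindex[OF inj] comp ..
    finally show ?thesis .
  qed
  obtain x where x: "((\<lambda>\<alpha>. c \<alpha> * monom_diff j \<alpha> z) has_sum x) UNIV"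
    using sm unfolding summable_on_def by blast
  then have x': "((\<lambda>\<alpha>. diff_coeff c j \<alpha> * monom \<alpha> z) has_sum x) UNIV" using eq by simp
  then have "x = series_diff c j z" unfolding series_diff_def by (simp add: infsumI)
  then show "((\<lambda>\<alpha>. diff_coeff c j \<alpha> * monom \<alpha> z) has_sum series_diff c j z) UNIV"
    "((\<lambda>\<alpha>. c \<alpha> * monom_diff j \<alpha> z) has_sum series_diff c j z) UNIV"
    using x x' by simp_all
qed

lemma power_series_diff:
  "power_series_near0 c f \<epsilon> \<Longrightarrow> power_series_near0 (diff_coeff c j) (series_diff c j) \<epsilon>"
  using series_diff_has_sum(1) unfolding power_series_near0_def by blast

lemma power_series_euler_sum:
  assumes "power_series_near0 c f \<epsilon>" "z \<in> ball 0 \<epsilon>"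
  shows "((\<lambda>\<alpha>. of_nat (\<alpha> j) * c \<alpha> * monom \<alpha> z) has_sum (z$j * series_diff c j z)) UNIV"
proof -
  have "z$j * (c \<alpha> * monom_diff j \<alpha> z) = of_nat (\<alpha> j) * c \<alpha> * monom \<alpha> z" for \<alpha>
    using monom_diff_mult[of z j \<alpha>] by (simp add: algebra_simps)
  then show ?thesis
    using has_sum_cmult_right[OF series_diff_has_sum(2)[OF assms], of "z$j" j] by (simp only:)
qed

lemma power_series_has_derivative:
  fixes c :: "('n::finite \<Rightarrow> nat) \<Rightarrow> complex"
  assumes ps: "power_series_near0 c f \<epsilon>" and z0: "z0 \<in> ball 0 \<epsilon>"
  shows "(f has_derivative (\<lambda>v. \<Sum>j\<in>UNIV. series_diff c j z0 * v$j)) (at z0)"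
proof -
  obtain \<delta> M where \<delta>: "\<delta> > 0" "ball z0 \<delta> \<subseteq> ball 0 \<epsilon>" and M: "M summable_on UNIV"
    "\<And>j \<alpha> z. z \<in> ball z0 \<delta> \<Longrightarrow> norm (c \<alpha> * monom_diff j \<alpha> z) \<le> M \<alpha>"
    using power_series_dominated[OF ps z0] by metis
  \<comment> \<open>Enumerating the exponents by the naturals turns the unordered sum into a series
    to which \<open>has_derivative_series\<close> applies.\<close>
  have "infinite (UNIV :: ('n \<Rightarrow> nat) set)"
  proof -
    have "inj (\<lambda>k::nat. (\<lambda>_::'n. k))" by (auto intro!: injI dest: fun_cong)
    then have "infinite (range (\<lambda>k::nat. (\<lambda>_::'n. k)))" by (rule range_inj_infinite)
    then show ?thesis by (rule infinite_super[rotated]) simp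
  qed
  then have e: "bij (from_nat_into (UNIV :: ('n \<Rightarrow> nat) set))" (is "bij ?e")
    by (intro bij_betw_from_nat_into countableI_type)
  define e where "e = ?e"
  note e = e[folded e_def]
  have sums: "(\<lambda>n. F (e n)) sums x" if "(F has_sum x) UNIV"
    for F :: "('n \<Rightarrow> nat) \<Rightarrow> complex" and x
  proof -
    have "((\<lambda>n. F (e n)) has_sum x) UNIV"
      using has_sum_reindex_bij_betw[OF e, of F x] that by simp
    then show ?thesis by (rule has_sum_imp_sums)
  qed
  have "(\<lambda>n. M (e n)) summable_on UNIV"
    using summable_on_reindex_bij_betw[OF e, of M] M by simp
  then have Ms: "summable (\<lambda>n. M (e n))" by (rule summable_on_imp_summable)
  have ul: "\<forall>\<^sub>F n in sequentially. \<forall>z\<in>ball z0 \<delta>. \<forall>j\<in>UNIV.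
      dist (\<Sum>i<n. c (e i) * monom_diff j (e i) z) (series_diff c j z) < d" if d: "d > 0" for d
  proof -
    have "\<forall>\<^sub>F n in sequentially. \<forall>z\<in>ball z0 \<delta>.
      dist (\<Sum>i<n. c (e i) * monom_diff j (e i) z) (series_diff c j z) < d" for j
    proof -
      have "uniform_limit (ball z0 \<delta>) (\<lambda>n z. \<Sum>i<n. c (e i) * monom_diff j (e i) z)
          (\<lambda>z. \<Sum>i. c (e i) * monom_diff j (e i) z) sequentially"
        by (rule Weierstrass_m_test[OF _ Ms]) (use M in auto)
      from uniform_limitD[OF this d]
      show ?thesis
      proof (rule eventually_mono, intro ballI)
        fix n z assume *: "\<forall>z\<in>ball z0 \<delta>. dist (\<Sum>i<n. c (e i) * monom_diff j (e i) z)
            (\<Sum>i. c (e i) * monom_diff j (e i) z) < d" and z: "z \<in> ball z0 \<delta>"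
        have "(\<Sum>i. c (e i) * monom_diff j (e i) z) = series_diff c j z"
          by (rule sums_unique[symmetric], rule sums, rule series_diff_has_sum(2)[OF ps])
            (use z \<delta> in blast)
        then show "dist (\<Sum>i<n. c (e i) * monom_diff j (e i) z) (series_diff c j z) < d"
          using bspec[OF * z] by simp
      qed
    qed
    then have "\<forall>j\<in>UNIV. \<forall>\<^sub>F n in sequentially. \<forall>z\<in>ball z0 \<delta>.
      dist (\<Sum>i<n. c (e i) * monom_diff j (e i) z) (series_diff c j z) < d" by blast
    from eventually_ball_finite[OF finite this] show ?thesis
      by (rule eventually_mono) blast
  qed
  have "\<exists>g. \<forall>z\<in>ball z0 \<delta>. (\<lambda>n. c (e n) * monom (e n) z) sums g z \<and>
     (g has_derivative (\<lambda>v. \<Sum>j\<in>UNIV. series_diff c j z * v$j)) (at z within ball z0 \<delta>)"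
  proof (rule has_derivative_series[where f' = "\<lambda>n z v. c (e n) * (\<Sum>j\<in>UNIV. monom_diff j (e n) z * v$j)"])
    show "convex (ball z0 \<delta>)" by (rule convex_ball)
    show "((\<lambda>z. c (e n) * monom (e n) z) has_derivative
        (\<lambda>v. c (e n) * (\<Sum>j\<in>UNIV. monom_diff j (e n) z * v$j))) (at z within ball z0 \<delta>)" for n z
      by (intro has_derivative_mult_right monom_has_derivative)
    show "z0 \<in> ball z0 \<delta>" using \<delta> by simp
    show "(\<lambda>n. c (e n) * monom (e n) z0) sums f z0"
      using ps z0 unfolding power_series_near0_def by (intro sums) blast
    fix d :: real assume d: "d > 0"
    define d' where "d' = d / real CARD('n)"
    have d': "d' > 0" using d by (simp add: d'_def)
    show "\<forall>\<^sub>F n in sequentially. \<forall>z\<in>ball z0 \<delta>. \<forall>v.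
       norm ((\<Sum>i<n. c (e i) * (\<Sum>j\<in>UNIV. monom_diff j (e i) z * v$j)) - (\<Sum>j\<in>UNIV. series_diff c j z * v$j)) \<le> d * norm v"
    proof (rule eventually_mono[OF ul[OF d']], intro ballI allI)
      fix n z and v :: "complex^'n"
      assume *: "\<forall>z\<in>ball z0 \<delta>. \<forall>j\<in>UNIV. dist (\<Sum>i<n. c (e i) * monom_diff j (e i) z) (series_diff c j z) < d'"
        and z: "z \<in> ball z0 \<delta>"
      have "(\<Sum>i<n. c (e i) * (\<Sum>j\<in>UNIV. monom_diff j (e i) z * v$j)) =
          (\<Sum>j\<in>UNIV. (\<Sum>i<n. c (e i) * monom_diff j (e i) z) * v$j)"
        by (simp add: sum_distrib_left sum_distrib_right mult.assoc) (rule sum.swap)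
      then have "norm ((\<Sum>i<n. c (e i) * (\<Sum>j\<in>UNIV. monom_diff j (e i) z * v$j)) - (\<Sum>j\<in>UNIV. series_diff c j z * v$j))
        = norm (\<Sum>j\<in>UNIV. ((\<Sum>i<n. c (e i) * monom_diff j (e i) z) - series_diff c j z) * v$j)"
        by (simp add: sum_subtractf left_diff_distrib)
      also have "\<dots> \<le> (\<Sum>j\<in>(UNIV::'n set). d' * norm v)"
      proof (rule sum_norm_le)
        fix j
        show "norm (((\<Sum>i<n. c (e i) * monom_diff j (e i) z) - series_diff c j z) * v$j) \<le> d' * norm v"
          unfolding norm_mult using * z d' Finite_Cartesian_Product.norm_nth_le[of v j]
          by (intro mult_mono) (auto simp: dist_norm less_imp_le)
      qed
      also have "\<dots> = d * norm v" by (simp add: d'_def)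
      finally show "norm ((\<Sum>i<n. c (e i) * (\<Sum>j\<in>UNIV. monom_diff j (e i) z * v$j)) -
        (\<Sum>j\<in>UNIV. series_diff c j z * v$j)) \<le> d * norm v" .
    qed
  qed
  then obtain g where g: "\<And>z. z \<in> ball z0 \<delta> \<Longrightarrow> (\<lambda>n. c (e n) * monom (e n) z) sums g z"
    "\<And>z. z \<in> ball z0 \<delta> \<Longrightarrow> (g has_derivative (\<lambda>v. \<Sum>j\<in>UNIV. series_diff c j z * v$j)) (at z within ball z0 \<delta>)"
    by blast
  have gf: "g z = f z" if "z \<in> ball z0 \<delta>" for z
    using sums_unique2[OF g(1)[OF that] sums, of "f z"] ps that \<delta> unfolding power_series_near0_def
    by blast
  have "(g has_derivative (\<lambda>v. \<Sum>j\<in>UNIV. series_diff c j z0 * v$j)) (at z0)"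
    using g(2)[of z0] \<delta> at_within_open[of z0 "ball z0 \<delta>"] by simp
  then show ?thesis
    by (rule has_derivative_transform_within_open[of _ _ _ _ "ball z0 \<delta>"]) (use gf \<delta> in auto)
qed

section \<open>A class of smooth functions closed under differentiation\<close>

text \<open>\<open>smooth_on\<close> asks for all iterated derivatives. A class of expressions that
  is closed under directional derivatives reduces this to an induction; its generators are those
  occurring in the contact form, with \<open>cnj\<close> because mixed functions are not holomorphic
  and \<open>series\<close> because f is only a power series.\<close>

inductive smooth_class :: "(complex^'n::finite) set \<Rightarrow> (complex^'n \<Rightarrow> complex) \<Rightarrow> bool" for U where
  const: "smooth_class U (\<lambda>_. k)"
| nth: "smooth_class U (\<lambda>w. w$j)"
| cnj: "smooth_class U F \<Longrightarrow> smooth_class U (\<lambda>w. cnj (F w))"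
| add: "smooth_class U F \<Longrightarrow> smooth_class U G \<Longrightarrow> smooth_class U (\<lambda>w. F w + G w)"
| mult: "smooth_class U F \<Longrightarrow> smooth_class U G \<Longrightarrow> smooth_class U (\<lambda>w. F w * G w)"
| inverse: "smooth_class U F \<Longrightarrow> (\<And>w. w \<in> U \<Longrightarrow> F w \<noteq> 0) \<Longrightarrow> smooth_class U (\<lambda>w. inverse (F w))"
| exp: "smooth_class U F \<Longrightarrow> smooth_class U (\<lambda>w. exp (F w))"
| series: "power_series_near0 c (h :: complex^'n \<Rightarrow> complex) \<epsilon> \<Longrightarrow> (\<And>j. smooth_class U (\<Phi> j)) \<Longrightarrow>
     (\<And>w. w \<in> U \<Longrightarrow> (\<chi> j. \<Phi> j w) \<in> ball 0 \<epsilon>) \<Longrightarrow> smooth_class U (\<lambda>w. h (\<chi> j. \<Phi> j w))"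

lemma smooth_class_uminus: "smooth_class U F \<Longrightarrow> smooth_class U (\<lambda>w. - F w)"
  using smooth_class.mult[OF smooth_class.const[of U "-1"], of F] by simp

lemma smooth_class_diff:
  "smooth_class U F \<Longrightarrow> smooth_class U G \<Longrightarrow> smooth_class U (\<lambda>w. F w - G w)"
  using smooth_class.add[OF _ smooth_class_uminus, of U F G] by simp

lemma smooth_class_power: "smooth_class U F \<Longrightarrow> smooth_class U (\<lambda>w. F w ^ k)"
  by (induction k) (auto intro: smooth_class.const smooth_class.mult)

lemma smooth_class_sum:
  "(\<And>i. i \<in> I \<Longrightarrow> smooth_class U (F i)) \<Longrightarrow> smooth_class U (\<lambda>w. \<Sum>i\<in>I. F i w)"
  by (induction I rule: infinite_finite_induct) (auto intro: smooth_class.const smooth_class.add)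

lemmas smooth_class_intros = smooth_class.const smooth_class.nth smooth_class.cnj smooth_class.add
  smooth_class.mult smooth_class.inverse smooth_class.exp smooth_class_uminus smooth_class_diff
  smooth_class_power smooth_class_sum

lemma has_derivative_vec_lambda:
  fixes f :: "'n::finite \<Rightarrow> 'a::real_normed_vector \<Rightarrow> complex"
  assumes "\<And>j. (f j has_derivative f' j) (at x)"
  shows "((\<lambda>x. \<chi> j. f j x) has_derivative (\<lambda>v. \<chi> j. f' j v)) (at x)"
proof -
  have eq: "(\<chi> j. F j) = (\<Sum>j\<in>UNIV. axis j (F j))" for F :: "'n \<Rightarrow> complex"
    by (simp add: vec_eq_iff axis_def)
  have "bounded_linear (axis j :: complex \<Rightarrow> complex^'n)" for j
    by (rule linear_conv_bounded_linear[THEN iffD1])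
       (auto intro!: linearI simp: axis_def vec_eq_iff)
  then show ?thesis unfolding eq
    by (intro has_derivative_sum bounded_linear.has_derivative[of "axis _"] assms)
qed

lemma smooth_class_has_derivative:
  assumes "smooth_class U F"
  shows "\<exists>F'. (\<forall>w\<in>U. (F has_derivative F' w) (at w)) \<and> (\<forall>v. smooth_class U (\<lambda>w. F' w v))"
  using assms
proof induction
  case (const k)
  show ?case by (intro exI[of _ "\<lambda>w v. 0"]) (auto intro: smooth_class_intros)
next
  case (nth j)
  show ?case
    by (intro exI[of _ "\<lambda>w v. v$j"]) (auto intro: smooth_class_intros bounded_linear_imp_has_derivative bounded_linear_vec_nth)
next
  case (cnj F)
  then obtain F' where F: "\<And>w. w \<in> U \<Longrightarrow> (F has_derivative F' w) (at w)" "\<And>v. smooth_class U (\<lambda>w. F' w v)"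
    by blast
  show ?case
    by (intro exI[of _ "\<lambda>w v. cnj (F' w v)"] conjI ballI allI smooth_class_intros F
        bounded_linear.has_derivative[OF bounded_linear_cnj])
next
  case (add F G)
  then obtain F' G' where F: "\<And>w. w \<in> U \<Longrightarrow> (F has_derivative F' w) (at w)" "\<And>v. smooth_class U (\<lambda>w. F' w v)"
    and G: "\<And>w. w \<in> U \<Longrightarrow> (G has_derivative G' w) (at w)" "\<And>v. smooth_class U (\<lambda>w. G' w v)"
    by blast
  show ?case
    by (intro exI[of _ "\<lambda>w v. F' w v + G' w v"] conjI ballI allI smooth_class_intros F G has_derivative_add)
next
  case (mult F G)
  then obtain F' G' where F: "\<And>w. w \<in> U \<Longrightarrow> (F has_derivative F' w) (at w)" "\<And>v. smooth_class U (\<lambda>w. F' w v)"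
    and G: "\<And>w. w \<in> U \<Longrightarrow> (G has_derivative G' w) (at w)" "\<And>v. smooth_class U (\<lambda>w. G' w v)"
    by blast
  show ?case
    by (intro exI[of _ "\<lambda>w v. F w * G' w v + F' w v * G w"] conjI ballI allI smooth_class_intros F G mult.hyps has_derivative_mult)
next
  case (inverse F)
  then obtain F' where F: "\<And>w. w \<in> U \<Longrightarrow> (F has_derivative F' w) (at w)" "\<And>v. smooth_class U (\<lambda>w. F' w v)"
    by blast
  show ?case
    by (intro exI[of _ "\<lambda>w v. - (inverse (F w) * F' w v * inverse (F w))"] conjI ballI allI
        smooth_class_intros F inverse.hyps Deriv.has_derivative_inverse)
next
  case (exp F)
  then obtain F' where F: "\<And>w. w \<in> U \<Longrightarrow> (F has_derivative F' w) (at w)" "\<And>v. smooth_class U (\<lambda>w. F' w v)"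
    by blast
  have "((\<lambda>w. exp (F w)) has_derivative (\<lambda>v. exp (F w) * F' w v)) (at w)" if w: "w \<in> U" for w
    by (rule has_derivative_compose[OF F(1)[OF w], of exp "\<lambda>v. exp (F w) * v"])
       (use DERIV_exp[of "F w"] in \<open>simp add: has_field_derivative_def\<close>)
  then show ?case
    by (intro exI[of _ "\<lambda>w v. exp (F w) * F' w v"] conjI ballI allI smooth_class_intros F exp.hyps) auto
next
  case (series c h \<epsilon> \<Phi>)
  then obtain \<Phi>' where \<Phi>: "\<And>j w. w \<in> U \<Longrightarrow> (\<Phi> j has_derivative \<Phi>' j w) (at w)"
      "\<And>j v. smooth_class U (\<lambda>w. \<Phi>' j w v)"
    by metis
  let ?D = "\<lambda>w v. \<Sum>j\<in>UNIV. series_diff c j (\<chi> j. \<Phi> j w) * \<Phi>' j w v"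
  have "((\<lambda>w. h (\<chi> j. \<Phi> j w)) has_derivative ?D w) (at w)" if w: "w \<in> U" for w
  proof -
    have "((\<lambda>w. \<chi> j. \<Phi> j w) has_derivative (\<lambda>v. \<chi> j. \<Phi>' j w v)) (at w)"
      by (intro has_derivative_vec_lambda \<Phi> w)
    from has_derivative_compose[OF this power_series_has_derivative[OF series.hyps(1) series.hyps(3)[OF w]]]
    show ?thesis by simp
  qed
  moreover have "smooth_class U (\<lambda>w. series_diff c j (\<chi> j. \<Phi> j w))" for j
    by (rule smooth_class.series[OF power_series_diff[OF series.hyps(1)] series.hyps(2,3)])
  then have "smooth_class U (\<lambda>w. ?D w v)" for v
    by (intro smooth_class_sum smooth_class.mult \<Phi>)
  ultimately show ?case by (intro exI[of _ ?D]) blast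
qed

lemma smooth_class_continuous_on:
  assumes "smooth_class U F"
  shows "continuous_on U F"
proof -
  obtain F' where "\<forall>w\<in>U. (F has_derivative F' w) (at w)"
    using smooth_class_has_derivative[OF assms] by blast
  then show ?thesis
    by (intro continuous_at_imp_continuous_on ballI) (auto intro: has_derivative_continuous)
qed

lemma smooth_class_smooth_on:
  fixes B :: "complex^'n::finite \<Rightarrow> complex^'n"
  assumes U: "open U" and B: "\<And>j. smooth_class U (\<lambda>w. B w $ j)"
  shows "smooth_on U B"
proof -
  \<comment> \<open>Equality is claimed on \<open>U\<close> only; openness of \<open>U\<close> is
    what lets the derivative be computed from the class member.\<close>
  have diter: "\<exists>G. (\<forall>j. smooth_class U (G j)) \<and> (\<forall>w\<in>U. diter vs B w = (\<chi> j. G j w))" for vs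
  proof (induction vs)
    case Nil
    show ?case using B by (intro exI[of _ "\<lambda>j w. B w $ j"]) auto
  next
    case (Cons v vs)
    then obtain G where G: "\<And>j. smooth_class U (G j)" "\<And>w. w \<in> U \<Longrightarrow> diter vs B w = (\<chi> j. G j w)"
      by blast
    obtain G' where G': "\<And>j w. w \<in> U \<Longrightarrow> (G j has_derivative G' j w) (at w)"
      "\<And>j v. smooth_class U (\<lambda>w. G' j w v)"
      using smooth_class_has_derivative[OF G(1)] by metis
    have "(diter vs B has_derivative (\<lambda>v. \<chi> j. G' j w v)) (at w)" if w: "w \<in> U" for w
      by (rule has_derivative_transform_within_open[OF has_derivative_vec_lambda[OF G'(1)[OF w]] U w])
         (simp add: G)
    then have "diter (v # vs) B w = (\<chi> j. G' j w v)" if w: "w \<in> U" for w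
      using w frechet_derivative_at by (metis diter.simps(2))
    then show ?case using G' by (intro exI[of _ "\<lambda>j w. G' j w v"]) auto
  qed
  have differentiable: "F differentiable (at w)"
    if G: "\<And>j. smooth_class U (G j)" and w: "w \<in> U" and F: "\<And>w. w \<in> U \<Longrightarrow> F w = (\<chi> j. G j w)"
    for G :: "'n \<Rightarrow> complex^'n \<Rightarrow> complex" and F w
  proof -
    obtain G' where "\<And>j w. w \<in> U \<Longrightarrow> (G j has_derivative G' j w) (at w)"
      using smooth_class_has_derivative[OF G] by metis
    then have "((\<lambda>w. \<chi> j. G j w) has_derivative (\<lambda>v. \<chi> j. G' j w v)) (at w)"
      using w by (intro has_derivative_vec_lambda) auto
    then have "(F has_derivative (\<lambda>v. \<chi> j. G' j w v)) (at w)"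
      by (rule has_derivative_transform_within_open[OF _ U w]) (simp add: F)
    then show ?thesis unfolding differentiable_def by blast
  qed
  show ?thesis unfolding smooth_on_def
  proof (intro allI ballI)
    fix vs :: "(complex^'n) list" and w assume w: "w \<in> U"
    obtain G where "\<forall>j. smooth_class U (G j)" "\<forall>w\<in>U. diter vs B w = (\<chi> j. G j w)"
      using diter by blast
    then show "diter vs B differentiable (at w)" using w by (intro differentiable[of G]) auto
  qed
qed

section \<open>Alternating forms \<open>\<beta> \<and> (d\<beta>)\<^sup>m\<close>\<close>

text \<open>\<open>wedge\<close> with the values of the form and of its differential at one point as
  parameters, so that the linear algebra can be done without a vector field.\<close>

definition wdg :: "nat \<Rightarrow> ('a \<Rightarrow> real) \<Rightarrow> ('a \<Rightarrow> 'a \<Rightarrow> real) \<Rightarrow> (nat \<Rightarrow> 'a) \<Rightarrow> real" where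
  "wdg m bt Om vs = (\<Sum>\<sigma>\<in>{\<sigma>. \<sigma> permutes {0..2*m}}.
      of_int (sign \<sigma>) * bt (vs (\<sigma> 0)) *
      (\<Prod>i\<in>{1..m}. Om (vs (\<sigma> (2*i - 1))) (vs (\<sigma> (2*i)))))"

lemma wedge_eq_wdg: "wedge m B x vs = wdg m (beta B x) (dbeta B x) vs"
  unfolding wedge_def wdg_def ..

lemma wdg_0: "wdg 0 bt Om vs = bt (vs 0)"
  by (simp add: wdg_def)

text \<open>Composing each permutation with the transposition of the two equal slots changes only
  the sign, so the sum is its own negative.\<close>

lemma wdg_repeated:
  assumes ij: "i \<noteq> j" "i \<le> 2*m" "j \<le> 2*m" and eq: "vs i = vs j"
  shows "wdg m bt Om vs = 0"
proof -
  let ?P = "{\<sigma>. \<sigma> permutes {0..2*m}}" and ?t = "Transposition.transpose i j"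
  let ?T = "\<lambda>\<sigma>. of_int (sign \<sigma>) * bt (vs (\<sigma> 0)) *
      (\<Prod>k\<in>{1..m}. Om (vs (\<sigma> (2*k - 1))) (vs (\<sigma> (2*k))))"
  have tp: "?t permutes {0..2*m}"
    using ij by (auto intro: permutes_swap_id)
  have inv: "vs (?t k) = vs k" for k
    using eq by (auto simp: Transposition.transpose_def)
  have sg: "sign (?t \<circ> \<sigma>) = - sign \<sigma>" if "\<sigma> \<in> ?P" for \<sigma>
  proof -
    have "permutation \<sigma>" "permutation ?t"
      using that permutes_imp_permutation[of "{0..2*m}"] tp by auto
    then have "sign (?t \<circ> \<sigma>) = sign ?t * sign \<sigma>"
      by (rule sign_compose[rotated])
    then show ?thesis
      using ij by (simp add: sign_swap_id)
  qed
  have "sum ?T ?P = sum (\<lambda>\<sigma>. ?T (?t \<circ> \<sigma>)) ?P"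
    by (rule setum_permutations_compose_left[OF tp])
  also have "\<dots> = sum (\<lambda>\<sigma>. - ?T \<sigma>) ?P"
    by (intro sum.cong refl) (simp add: inv sg)
  also have "\<dots> = - sum ?T ?P"
    by (rule sum_negf)
  finally show ?thesis
    unfolding wdg_def by simp
qed

text \<open>In the term of each permutation the slot \<open>i0\<close> is used exactly once: in
  \<open>bt\<close>, or in a single factor \<open>Om\<close>.\<close>

lemma wdg_slot_linear:
  fixes vs :: "nat \<Rightarrow> 'a::real_vector"
  assumes bt: "linear bt" and Om: "\<And>u. linear (Om u)" "\<And>v. linear (\<lambda>u. Om u v)"
    and i0: "i0 \<le> 2*m"
  shows "linear (\<lambda>y. wdg m bt Om (vs(i0 := y)))"
  unfolding wdg_def
proof (rule linear_compose_sum, safe)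
  fix \<sigma> assume \<sigma>: "\<sigma> permutes {0..2*m}"
  let ?v = "\<lambda>y. vs(i0 := y)"
  obtain k where k: "\<sigma> k = i0"
    using permutes_surj[OF \<sigma>] by (metis surjD)
  have k_le: "k \<le> 2*m"
    using permutes_in_image[OF \<sigma>, of k] k i0 by simp
  have other: "?v y (\<sigma> l) = vs (\<sigma> l)" if "l \<noteq> k" for l y
    using that k permutes_inj[OF \<sigma>] by (auto dest: injD)
  have at_k: "?v y (\<sigma> k) = y" for y
    using k by simp
  show "linear (\<lambda>y. of_int (sign \<sigma>) * bt (?v y (\<sigma> 0)) *
      (\<Prod>i\<in>{1..m}. Om (?v y (\<sigma> (2*i - 1))) (?v y (\<sigma> (2*i)))))" (is "linear ?F")
  proof (cases "k = 0")
    case True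
    have "?F = (\<lambda>y. (of_int (sign \<sigma>) * (\<Prod>i\<in>{1..m}. Om (vs (\<sigma> (2*i - 1))) (vs (\<sigma> (2*i))))) *\<^sub>R bt y)"
    proof (rule ext)
      fix y
      have "(\<Prod>i\<in>{1..m}. Om (?v y (\<sigma> (2*i - 1))) (?v y (\<sigma> (2*i))))
          = (\<Prod>i\<in>{1..m}. Om (vs (\<sigma> (2*i - 1))) (vs (\<sigma> (2*i))))"
      proof (intro prod.cong refl)
        fix l assume "l \<in> {1..m}"
        then have "2*l - 1 \<noteq> k" "2*l \<noteq> k" using True by auto
        then show "Om (?v y (\<sigma> (2*l - 1))) (?v y (\<sigma> (2*l))) = Om (vs (\<sigma> (2*l - 1))) (vs (\<sigma> (2*l)))"
          using other by metis
      qed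
      then show "?F y = (of_int (sign \<sigma>) * (\<Prod>i\<in>{1..m}. Om (vs (\<sigma> (2*i - 1))) (vs (\<sigma> (2*i))))) *\<^sub>R bt y"
        using at_k[of y] True by simp
    qed
    then show ?thesis
      using linear_compose_scale_right[OF bt] by simp
  next
    case False
    \<comment> \<open>The index of the pair of positions 2i - 1, 2i that contains k.\<close>
    define i where "i = (k + 1) div 2"
    have i: "i \<in> {1..m}" and ki: "k = 2*i - 1 \<or> k = 2*i"
      using False k_le unfolding i_def by auto
    define G where "G y = Om (?v y (\<sigma> (2*i - 1))) (?v y (\<sigma> (2*i)))" for y
    have linG: "linear G"
    proof (cases "k = 2*i")
      case True
      then have "2*i - 1 \<noteq> k" using False by linarith
      have "G = Om (vs (\<sigma> (2*i - 1)))"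
        unfolding G_def using other[OF \<open>2*i - 1 \<noteq> k\<close>] at_k True by auto
      then show ?thesis using Om by simp
    next
      case False2: False
      then have kk: "k = 2*i - 1" "2*i \<noteq> k" using ki by auto
      have "G = (\<lambda>y. Om y (vs (\<sigma> (2*i))))"
        unfolding G_def using other[OF kk(2)] at_k kk(1) by auto
      then show ?thesis using Om by simp
    qed
    let ?c = "of_int (sign \<sigma>) * bt (vs (\<sigma> 0)) *
        (\<Prod>i\<in>{1..m} - {i}. Om (vs (\<sigma> (2*i - 1))) (vs (\<sigma> (2*i))))"
    have "?F = (\<lambda>y. ?c *\<^sub>R G y)"
    proof (rule ext)
      fix y
      have "(\<Prod>i\<in>{1..m}. Om (?v y (\<sigma> (2*i - 1))) (?v y (\<sigma> (2*i))))
          = G y * (\<Prod>i\<in>{1..m} - {i}. Om (?v y (\<sigma> (2*i - 1))) (?v y (\<sigma> (2*i))))"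
        unfolding G_def using i by (simp add: prod.remove)
      also have "(\<Prod>i\<in>{1..m} - {i}. Om (?v y (\<sigma> (2*i - 1))) (?v y (\<sigma> (2*i))))
          = (\<Prod>i\<in>{1..m} - {i}. Om (vs (\<sigma> (2*i - 1))) (vs (\<sigma> (2*i))))"
      proof (intro prod.cong refl)
        fix l assume l: "l \<in> {1..m} - {i}"
        then have "2*l - 1 \<noteq> k" "2*l \<noteq> k" using ki i by auto
        then show "Om (?v y (\<sigma> (2*l - 1))) (?v y (\<sigma> (2*l))) = Om (vs (\<sigma> (2*l - 1))) (vs (\<sigma> (2*l)))"
          using other by metis
      qed
      finally show "?F y = ?c *\<^sub>R G y"
        using other[of 0 y] False by simp
    qed
    then show ?thesis
      using linear_compose_scale_right[OF linG] by simp
  qed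
qed

text \<open>A vector \<open>p\<close> killed by \<open>bt\<close> and by every pairing except the one with \<open>q\<close> must be paired with \<open>q\<close>;
  there are \<open>m + 1\<close> places for this pair and two orders, all contributing equally.\<close>
lemma wdg_extract_pair:
  assumes skew: "\<And>u v. Om u v = - Om v u"
    and p: "bt p = 0" "\<And>i. i \<le> 2*m \<Longrightarrow> Om p (e i) = 0"
  shows "wdg (Suc m) bt Om (\<lambda>i. if i = 0 then p else if i = 1 then q else e (i - 2))
     = 2 * real (Suc m) * Om p q * wdg m bt Om e"
proof -
  define v where "v = (\<lambda>i::nat. if i = 0 then p else if i = 1 then q else e (i - 2))"
  define S where "S = {\<sigma>. \<sigma> permutes {0..2 * Suc m}}"
  define T where "T \<sigma> = of_int (sign \<sigma>) * bt (v (\<sigma> 0)) *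
      (\<Prod>k\<in>{1..Suc m}. Om (v (\<sigma> (2*k - 1))) (v (\<sigma> (2*k))))" for \<sigma>
  \<comment> \<open>The permutations for which p and q fill the i-th factor \<open>Om\<close>, in
    this order for \<open>A i\<close> and in the reverse order for \<open>A' i\<close>.\<close>
  define A where "A i = {\<sigma>\<in>S. \<sigma> (2*i - 1) = 0 \<and> \<sigma> (2*i) = 1}" for i
  define A' where "A' i = {\<sigma>\<in>S. \<sigma> (2*i - 1) = 1 \<and> \<sigma> (2*i) = 0}" for i
  have finS: "finite S" unfolding S_def by (rule finite_permutations) simp
  have Opp: "Om p p = 0" using skew[of p p] by simp
  have sgn_comp: "sign (\<sigma> \<circ> \<pi>) = sign \<sigma> * sign \<pi>" "\<sigma> \<circ> \<pi> \<in> S" if "\<sigma> \<in> S" "\<pi> \<in> S" for \<sigma> \<pi>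
    using that permutes_imp_permutation[of "{0..2* Suc m}"] permutes_compose
    unfolding S_def by (auto intro!: sign_compose)

  \<comment> \<open>Permutations that separate p from q contribute nothing\<close>
  have zero: "T \<sigma> = 0" if \<sigma>: "\<sigma> \<in> S" and no: "\<sigma> \<notin> (\<Union>i\<in>{1..Suc m}. A i \<union> A' i)" for \<sigma>
  proof -
    have \<sigma>p: "\<sigma> permutes {0..2 * Suc m}" using \<sigma> S_def by simp
    obtain k where k: "\<sigma> k = 0" using permutes_surj[OF \<sigma>p] by (metis surjD)
    have k_le: "k \<le> 2 * Suc m" using permutes_in_image[OF \<sigma>p, of k] k by simp
    show ?thesis
    proof (cases "k = 0")
      case True
      then show ?thesis unfolding T_def using k p(1) by (simp add: v_def)
    next
      case False
      define i where "i = (k + 1) div 2"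
      have i: "i \<in> {1..Suc m}" and ki: "k = 2*i - 1 \<or> k = 2*i"
        using False k_le unfolding i_def by auto
      have z: "Om p (v l) = 0" if "l \<noteq> 1" "l \<le> 2 * Suc m" for l
        using that p(2)[of "l - 2"] Opp unfolding v_def by auto
      have le: "\<sigma> l \<le> 2 * Suc m" if "l \<le> 2 * Suc m" for l
        using permutes_in_image[OF \<sigma>p, of l] that by simp
      have "Om (v (\<sigma> (2*i - 1))) (v (\<sigma> (2*i))) = 0"
      proof (cases "k = 2*i")
        case True
        have "\<sigma> \<notin> A' i" using no i by blast
        then have "\<sigma> (2*i - 1) \<noteq> 1" using k True \<sigma> unfolding A'_def by simp
        moreover have "\<sigma> (2*i - 1) \<le> 2 * Suc m" using i by (intro le) auto
        ultimately have "Om p (v (\<sigma> (2*i - 1))) = 0" by (rule z)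
        then show ?thesis using True k skew[of "v (\<sigma> (2*i - 1))" p] by (simp add: v_def)
      next
        case F: False
        then have kk: "k = 2*i - 1" using ki by simp
        have "\<sigma> \<notin> A i" using no i by blast
        then have "\<sigma> (2*i) \<noteq> 1" using k kk \<sigma> unfolding A_def by simp
        moreover have "\<sigma> (2*i) \<le> 2 * Suc m" using i by (intro le) auto
        ultimately have "Om p (v (\<sigma> (2*i))) = 0" by (rule z)
        then show ?thesis using kk k by (simp add: v_def)
      qed
      then have "(\<Prod>k\<in>{1..Suc m}. Om (v (\<sigma> (2*k - 1))) (v (\<sigma> (2*k)))) = 0"
        using i by (intro prod_zero) blast+
      then show ?thesis unfolding T_def by (simp only: mult_zero_right)
    qed
  qed

  \<comment> \<open>Exchanging p and q within a factor\<close>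
  have sum_A': "sum T (A' i) = sum T (A i)" if i: "i \<in> {1..Suc m}" for i
  proof -
    let ?t = "Transposition.transpose (2*i - 1) (2*i)"
    have tS: "?t \<in> S" unfolding S_def using i by (auto intro!: permutes_swap_id)
    have Tt: "T (\<sigma> \<circ> ?t) = T \<sigma>" if \<sigma>: "\<sigma> \<in> S" for \<sigma>
    proof -
      have "sign ?t = -1" using i by (auto simp: sign_swap_id)
      then have sg: "sign (\<sigma> \<circ> ?t) = - sign \<sigma>" using sgn_comp(1)[OF \<sigma> tS] by simp
      have "(\<Prod>k\<in>{1..Suc m}. Om (v ((\<sigma> \<circ> ?t) (2*k - 1))) (v ((\<sigma> \<circ> ?t) (2*k))))
        = Om (v (\<sigma> (2*i))) (v (\<sigma> (2*i - 1))) *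
          (\<Prod>k\<in>{1..Suc m} - {i}. Om (v ((\<sigma> \<circ> ?t) (2*k - 1))) (v ((\<sigma> \<circ> ?t) (2*k))))"
        using i by (subst prod.remove[of _ i]) auto
      also have "(\<Prod>k\<in>{1..Suc m} - {i}. Om (v ((\<sigma> \<circ> ?t) (2*k - 1))) (v ((\<sigma> \<circ> ?t) (2*k))))
          = (\<Prod>k\<in>{1..Suc m} - {i}. Om (v (\<sigma> (2*k - 1))) (v (\<sigma> (2*k))))"
      proof (intro prod.cong refl)
        fix k assume "k \<in> {1..Suc m} - {i}"
        then have "?t (2*k - 1) = 2*k - 1" "?t (2*k) = 2*k"
          using i by (auto simp: Transposition.transpose_def)
        then show "Om (v ((\<sigma> \<circ> ?t) (2*k - 1))) (v ((\<sigma> \<circ> ?t) (2*k))) = Om (v (\<sigma> (2*k - 1))) (v (\<sigma> (2*k)))"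
          by simp
      qed
      also have "Om (v (\<sigma> (2*i))) (v (\<sigma> (2*i - 1))) * \<dots> = - (\<Prod>k\<in>{1..Suc m}. Om (v (\<sigma> (2*k - 1))) (v (\<sigma> (2*k))))"
        using i skew[of "v (\<sigma> (2*i))"] by (subst prod.remove[of _ i]) auto
      finally have pr: "(\<Prod>k\<in>{1..Suc m}. Om (v ((\<sigma> \<circ> ?t) (2*k - 1))) (v ((\<sigma> \<circ> ?t) (2*k))))
        = - (\<Prod>k\<in>{1..Suc m}. Om (v (\<sigma> (2*k - 1))) (v (\<sigma> (2*k))))" .
      have t0: "?t 0 = 0" using i by (auto simp: Transposition.transpose_def)
      have "T (\<sigma> \<circ> ?t) = of_int (- sign \<sigma>) * bt (v (\<sigma> 0)) * - (\<Prod>k\<in>{1..Suc m}. Om (v (\<sigma> (2*k - 1))) (v (\<sigma> (2*k))))"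
        unfolding T_def pr sg by (simp only: o_apply t0)
      then show ?thesis unfolding T_def by simp
    qed
    have inv: "\<sigma> \<circ> ?t \<circ> ?t = \<sigma>" for \<sigma> :: "nat \<Rightarrow> nat" by (simp add: o_assoc[symmetric])
    show ?thesis
      by (rule sum.reindex_bij_witness[where i = "\<lambda>\<sigma>. \<sigma> \<circ> ?t" and j = "\<lambda>\<sigma>. \<sigma> \<circ> ?t"])
        (use inv sgn_comp(2)[OF _ tS] Tt in \<open>simp_all add: A_def A'_def\<close>)
  qed

  \<comment> \<open>Moving the pair to the first factor\<close>
  have sum_A: "sum T (A i) = sum T (A 1)" if i: "i \<in> {1..Suc m}" for i
  proof (cases "i = 1")
    case False
    \<comment> \<open>Exchanges the first pair of positions with the i-th one, keeping the order
      within the pairs; being a product of two transpositions it is even.\<close>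
    let ?t = "Transposition.transpose 1 (2*i - 1) \<circ> Transposition.transpose 2 (2*i)"
    have i2: "i \<ge> 2" "i \<le> Suc m" using i False by auto
    have t12S: "Transposition.transpose 1 (2*i - 1) \<in> S" "Transposition.transpose 2 (2*i) \<in> S"
      unfolding S_def using i by (auto intro!: permutes_swap_id)
    have tS: "?t \<in> S" by (rule sgn_comp(2)[OF t12S])
    have "sign ?t = 1"
      unfolding sgn_comp(1)[OF t12S] using i2 by (auto simp: sign_swap_id)
    then have sg: "sign (\<sigma> \<circ> ?t) = sign \<sigma>" if "\<sigma> \<in> S" for \<sigma>
      using sgn_comp(1)[OF that tS] by simp
    have odd_t: "?t (2*k - 1) = 2 * Transposition.transpose 1 i k - 1" and even_t: "?t (2*k) = 2 * Transposition.transpose 1 i k"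
      if "k \<in> {1..Suc m}" for k
    proof -
      have "2*k - 1 \<noteq> 2" "2*k - 1 \<noteq> 2*i" "2*k \<noteq> 1" "2*k \<noteq> 2*i - 1"
        "2*k - 1 = 1 \<longleftrightarrow> k = 1" "2*k - 1 = 2*i - 1 \<longleftrightarrow> k = i" "2*k = 2 \<longleftrightarrow> k = 1"
        "2*i \<noteq> 1" "2*i \<noteq> 2*i - 1" "2 \<noteq> 2*i - 1"
        using that i2 by (presburger | auto)+
      then show "?t (2*k - 1) = 2 * Transposition.transpose 1 i k - 1" "?t (2*k) = 2 * Transposition.transpose 1 i k"
        unfolding o_apply Transposition.transpose_def by (simp_all split: if_splits)
    qed
    have inv: "?t (?t k) = k" for k
    proof -
      have "2*i - 1 \<noteq> 2" "2*i \<noteq> 2*i - 1" "2*i \<noteq> 1" "2*i - 1 \<noteq> 1" "2*i \<noteq> 2"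
        using i2 by (presburger | auto)+
      then show ?thesis unfolding o_apply Transposition.transpose_def by (simp split: if_splits)
    qed
    have inv': "\<sigma> \<circ> ?t \<circ> ?t = \<sigma>" for \<sigma> :: "nat \<Rightarrow> nat"
      using inv by (auto simp: fun_eq_iff)
    have Tt: "T (\<sigma> \<circ> ?t) = T \<sigma>" if \<sigma>: "\<sigma> \<in> S" for \<sigma>
    proof -
      have perm: "Transposition.transpose 1 i permutes {1..Suc m}"
        using i by (intro permutes_swap_id) auto
      have "(\<Prod>k\<in>{1..Suc m}. Om (v ((\<sigma> \<circ> ?t) (2*k - 1))) (v ((\<sigma> \<circ> ?t) (2*k))))
        = (\<Prod>k\<in>{1..Suc m}. ((\<lambda>k. Om (v (\<sigma> (2*k - 1))) (v (\<sigma> (2*k)))) \<circ> Transposition.transpose 1 i) k)"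
      proof (intro prod.cong refl)
        fix k assume "k \<in> {1..Suc m}"
        from odd_t[OF this] even_t[OF this]
        show "Om (v ((\<sigma> \<circ> ?t) (2*k - 1))) (v ((\<sigma> \<circ> ?t) (2*k)))
          = ((\<lambda>k. Om (v (\<sigma> (2*k - 1))) (v (\<sigma> (2*k)))) \<circ> Transposition.transpose 1 i) k"
          by (simp only: o_apply)
      qed
      also have "\<dots> = (\<Prod>k\<in>{1..Suc m}. Om (v (\<sigma> (2*k - 1))) (v (\<sigma> (2*k))))"
        by (rule prod.permute[OF perm, symmetric])
      finally have pr: "(\<Prod>k\<in>{1..Suc m}. Om (v ((\<sigma> \<circ> ?t) (2*k - 1))) (v ((\<sigma> \<circ> ?t) (2*k))))
        = (\<Prod>k\<in>{1..Suc m}. Om (v (\<sigma> (2*k - 1))) (v (\<sigma> (2*k))))" .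
      have t0: "(\<sigma> \<circ> ?t) 0 = \<sigma> 0" using i2 by (auto simp: Transposition.transpose_def)
      show ?thesis unfolding T_def pr sg[OF \<sigma>] t0 ..
    qed
    have t1: "?t 1 = 2*i - 1" "?t 2 = 2*i" "?t (2*i - 1) = 1" "?t (2*i) = 2"
      using i2 by (auto simp: Transposition.transpose_def)
    show ?thesis
    proof (rule sum.reindex_bij_witness[where i = "\<lambda>\<sigma>. \<sigma> \<circ> ?t" and j = "\<lambda>\<sigma>. \<sigma> \<circ> ?t"])
      fix \<sigma> assume \<sigma>: "\<sigma> \<in> A i"
      then have "(\<sigma> \<circ> ?t) 1 = 0" "(\<sigma> \<circ> ?t) 2 = 1" "\<sigma> \<in> S"
        unfolding A_def o_apply[of \<sigma>] t1 by auto
      then show "\<sigma> \<circ> ?t \<in> A 1" "T (\<sigma> \<circ> ?t) = T \<sigma>"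
        using sgn_comp(2)[OF _ tS] Tt unfolding A_def by auto
    next
      fix \<sigma> assume \<sigma>: "\<sigma> \<in> A 1"
      then have "(\<sigma> \<circ> ?t) (2*i - 1) = 0" "(\<sigma> \<circ> ?t) (2*i) = 1" "\<sigma> \<in> S"
        unfolding A_def o_apply[of \<sigma>] t1 by auto
      then show "\<sigma> \<circ> ?t \<in> A i"
        using sgn_comp(2)[OF _ tS] unfolding A_def by auto
    qed (rule inv')+
  qed simp

  \<comment> \<open>Permutations of the remaining slots\<close>
  define sh where "sh \<tau> k = (if k < 2 then k else \<tau> (k - 2) + 2)" for \<tau> :: "nat \<Rightarrow> nat" and k
  \<comment> \<open>An even 3-cycle sending the positions 0, 1, 2 to the slots 2, 0, 1. After it,
    \<open>sh \<tau>\<close> permutes the slots of e, so \<open>sh \<tau> \<circ> \<sigma>0\<close>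
    runs through \<open>A 1\<close> with the sign of \<tau>.\<close>
  define \<sigma>0 where "\<sigma>0 = Transposition.transpose (0::nat) 1 \<circ> Transposition.transpose 0 2"
  have \<sigma>0v: "\<sigma>0 0 = 2" "\<sigma>0 1 = 0" "\<sigma>0 2 = 1" "\<And>k. k > 2 \<Longrightarrow> \<sigma>0 k = k"
    unfolding \<sigma>0_def by (auto simp: Transposition.transpose_def)
  have \<sigma>0S: "\<sigma>0 \<in> S" unfolding \<sigma>0_def
    by (intro sgn_comp(2)) (auto simp: S_def intro!: permutes_swap_id)
  have \<sigma>0sg: "sign \<sigma>0 = 1" unfolding \<sigma>0_def
    by (subst sgn_comp) (auto simp: S_def sign_swap_id intro!: permutes_swap_id)
  have sh: "sh \<tau> \<in> S \<and> sign (sh \<tau>) = sign \<tau>" if "\<tau> permutes {0..2*m}" for \<tau>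
    using that finite_atLeastAtMost
  proof (induction rule: permutes_induct)
    case id
    have eq: "sh id = id" by (auto simp: sh_def fun_eq_iff)
    show ?case unfolding S_def eq mem_Collect_eq by (intro conjI permutes_id refl)
  next
    case (swap i j \<tau>)
    have eq: "sh (Transposition.transpose i j \<circ> \<tau>) = Transposition.transpose (i+2) (j+2) \<circ> sh \<tau>"
      by (auto simp: sh_def fun_eq_iff Transposition.transpose_def)
    have tS: "Transposition.transpose (i+2) (j+2) \<in> S" using swap unfolding S_def
      by (auto intro!: permutes_swap_id)
    have "permutation \<tau>" using swap permutes_imp_permutation by blast
    then have s: "sign (Transposition.transpose i j \<circ> \<tau>) = sign (Transposition.transpose i j) * sign \<tau>"
      by (intro sign_compose permutation_swap_id)
    have "sign (Transposition.transpose (i+2) (j+2)) = sign (Transposition.transpose i j)"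
      by (simp add: sign_swap_id)
    then show ?case unfolding eq s sgn_comp(1)[OF tS conjunct1[OF swap.IH]]
      by (intro conjI sgn_comp(2)[OF tS conjunct1[OF swap.IH]])
        (simp only: conjunct2[OF swap.IH])
  qed
  have sum_A1: "sum T (A 1) = Om p q * wdg m bt Om e"
  proof -
    define g where "g \<tau> = of_int (sign \<tau>) * bt (e (\<tau> 0)) *
      (\<Prod>i\<in>{1..m}. Om (e (\<tau> (2*i - 1))) (e (\<tau> (2*i))))" for \<tau>
    \<comment> \<open>The inverse of \<open>\<tau> \<mapsto> sh \<tau> \<circ> \<sigma>0\<close>:
      positions 1 and 2, occupied by p and q, are skipped, and the slots of e are renumbered from
      0.\<close>
    define un where "un \<sigma> k = (if k \<le> 2*m then \<sigma> (if k = 0 then 0 else k + 2) - 2 else k)"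
      for \<sigma> :: "nat \<Rightarrow> nat" and k
    have "sum T (A 1) = (\<Sum>\<tau>\<in>{\<tau>. \<tau> permutes {0..2*m}}. Om p q * g \<tau>)"
    proof (rule sum.reindex_bij_witness[symmetric, where j = "\<lambda>\<tau>. sh \<tau> \<circ> \<sigma>0" and i = un])
      fix \<tau> assume "\<tau> \<in> {\<tau>. \<tau> permutes {0..2*m}}"
      then have \<tau>: "\<tau> permutes {0..2*m}" by simp
      show "un (sh \<tau> \<circ> \<sigma>0) = \<tau>"
      proof (rule ext)
        fix k
        show "un (sh \<tau> \<circ> \<sigma>0) k = \<tau> k"
          using \<sigma>0v(1) \<sigma>0v(4)[of "k+2"] permutes_not_in[OF \<tau>, of k]
          by (auto simp: un_def sh_def)
      qed
      show "sh \<tau> \<circ> \<sigma>0 \<in> A 1"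
        unfolding A_def using sgn_comp(2)[OF conjunct1[OF sh[OF \<tau>]] \<sigma>0S] \<sigma>0v
        by (auto simp: sh_def)
      have sg: "sign (sh \<tau> \<circ> \<sigma>0) = sign \<tau>"
        using sgn_comp(1)[OF conjunct1[OF sh[OF \<tau>]] \<sigma>0S] sh[OF \<tau>] \<sigma>0sg by simp
      have v0: "v ((sh \<tau> \<circ> \<sigma>0) 0) = e (\<tau> 0)"
        using \<sigma>0v by (simp add: sh_def v_def)
      have "(\<Prod>k\<in>{1..Suc m}. Om (v ((sh \<tau> \<circ> \<sigma>0) (2*k - 1))) (v ((sh \<tau> \<circ> \<sigma>0) (2*k))))
        = Om (v ((sh \<tau> \<circ> \<sigma>0) 1)) (v ((sh \<tau> \<circ> \<sigma>0) 2)) *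
          (\<Prod>k\<in>{Suc 1..Suc m}. Om (v ((sh \<tau> \<circ> \<sigma>0) (2*k - 1))) (v ((sh \<tau> \<circ> \<sigma>0) (2*k))))"
        by (subst prod.atLeast_Suc_atMost) auto
      also have "Om (v ((sh \<tau> \<circ> \<sigma>0) 1)) (v ((sh \<tau> \<circ> \<sigma>0) 2)) = Om p q"
        using \<sigma>0v by (simp add: sh_def v_def)
      also have "(\<Prod>k\<in>{Suc 1..Suc m}. Om (v ((sh \<tau> \<circ> \<sigma>0) (2*k - 1))) (v ((sh \<tau> \<circ> \<sigma>0) (2*k))))
        = (\<Prod>k\<in>{1..m}. Om (v ((sh \<tau> \<circ> \<sigma>0) (2*Suc k - 1))) (v ((sh \<tau> \<circ> \<sigma>0) (2*Suc k))))"
        by (rule prod.shift_bounds_cl_Suc_ivl)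
      also have "\<dots> = (\<Prod>k\<in>{1..m}. Om (e (\<tau> (2*k - 1))) (e (\<tau> (2*k))))"
      proof (intro prod.cong refl)
        fix k assume "k \<in> {1..m}"
        then have "2*Suc k - 1 > 2" "2*Suc k > 2" "2*Suc k - 1 - 2 = 2*k - 1" by auto
        then have "v ((sh \<tau> \<circ> \<sigma>0) (2*Suc k - 1)) = e (\<tau> (2*k - 1))"
            "v ((sh \<tau> \<circ> \<sigma>0) (2*Suc k)) = e (\<tau> (2*k))"
          unfolding o_apply by (simp_all only: \<sigma>0v(4)) (auto simp: sh_def v_def)
        then show "Om (v ((sh \<tau> \<circ> \<sigma>0) (2*Suc k - 1))) (v ((sh \<tau> \<circ> \<sigma>0) (2*Suc k)))
          = Om (e (\<tau> (2*k - 1))) (e (\<tau> (2*k)))" by simp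
      qed
      finally show "T (sh \<tau> \<circ> \<sigma>0) = Om p q * g \<tau>"
        unfolding T_def g_def sg v0 by simp
    next
      fix \<sigma> assume "\<sigma> \<in> A 1"
      then have \<sigma>: "\<sigma> permutes {0..2 * Suc m}" "\<sigma> 1 = 0" "\<sigma> 2 = 1"
        unfolding A_def S_def by auto
      have ge2: "\<sigma> l \<ge> 2" if "l \<noteq> 1" "l \<noteq> 2" for l
      proof -
        have "\<sigma> l \<noteq> \<sigma> 1" "\<sigma> l \<noteq> \<sigma> 2"
          using that permutes_inj[OF \<sigma>(1)] by (auto dest: injD)
        then show ?thesis using \<sigma> by simp
      qed
      show "sh (un \<sigma>) \<circ> \<sigma>0 = \<sigma>"
      proof (rule ext)
        fix k :: nat
        consider "k = 0" | "k = 1" | "k = 2" | "k > 2" by linarith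
        then show "(sh (un \<sigma>) \<circ> \<sigma>0) k = \<sigma> k"
        proof cases
          case 1 then show ?thesis using \<sigma>0v(1) ge2[of 0] by (simp add: sh_def un_def)
        next
          case 2 then show ?thesis using \<sigma>0v(2) \<sigma> by (simp add: sh_def)
        next
          case 3 then show ?thesis using \<sigma>0v(3) \<sigma> by (simp add: sh_def)
        next
          case 4
          then have "Suc (Suc (k - 2)) = k" by simp
          then show ?thesis using 4 \<sigma>0v(4)[OF 4] ge2[of k] permutes_not_in[OF \<sigma>(1), of k]
            by (auto simp: sh_def un_def)
        qed
      qed
      let ?pos = "\<lambda>k::nat. if k = 0 then 0 else k + 2"
      have pos: "?pos k \<noteq> 1" "?pos k \<noteq> 2" for k by auto
      have inj: "inj_on (un \<sigma>) {0..2*m}"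
      proof (rule inj_onI)
        fix k l assume kl: "k \<in> {0..2*m}" "l \<in> {0..2*m}" and eq: "un \<sigma> k = un \<sigma> l"
        then have "\<sigma> (?pos k) - 2 = \<sigma> (?pos l) - 2" by (simp add: un_def)
        then have "\<sigma> (?pos k) = \<sigma> (?pos l)"
          using ge2[OF pos, of k] ge2[OF pos, of l] by linarith
        then have "?pos k = ?pos l" using permutes_inj[OF \<sigma>(1)] by (rule injD[rotated])
        then show "k = l" by (auto split: if_splits)
      qed
      have "un \<sigma> ` {0..2*m} \<subseteq> {0..2*m}"
      proof safe
        fix k assume k: "k \<in> {0..2*m}"
        have "\<sigma> (?pos k) \<in> {0..2* Suc m}"
          using permutes_in_image[OF \<sigma>(1), of "?pos k"] k by auto
        then show "un \<sigma> k \<in> {0..2*m}" using k by (auto simp: un_def)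
      qed
      then have "un \<sigma> ` {0..2*m} = {0..2*m}"
        by (intro endo_inj_surj inj) auto
      then have "bij_betw (un \<sigma>) {0..2*m} {0..2*m}" using inj unfolding bij_betw_def by simp
      then have "un \<sigma> permutes {0..2*m}"
        by (intro bij_imp_permutes) (auto simp: un_def)
      then show "un \<sigma> \<in> {\<tau>. \<tau> permutes {0..2*m}}" by simp
    qed
    then show ?thesis unfolding wdg_def g_def[symmetric] by (simp add: sum_distrib_left)
  qed

  \<comment> \<open>Counting the contributions\<close>
  have disj1: "A i \<inter> A' j = {}" for i j
  proof -
    have False if "\<sigma> \<in> A i" "\<sigma> \<in> A' j" for \<sigma>
    proof -
      have "\<sigma> (2*i - 1) = \<sigma> (2*j)" "\<sigma> (2*i) = \<sigma> (2*j - 1)" "inj \<sigma>"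
        using that permutes_inj unfolding A_def A'_def S_def by auto
      then have "2*i - 1 = 2*j" "2*i = 2*j - 1" by (auto dest: injD)
      moreover have "\<sigma> (2*i - 1) \<noteq> \<sigma> (2*i)" using that unfolding A_def by auto
      ultimately show False by (cases i) auto
    qed
    then show ?thesis by auto
  qed
  have disjA: "A i \<inter> A j = {} \<and> A' i \<inter> A' j = {}" if "i \<noteq> j" for i j
  proof -
    have ne: "\<sigma> (2*i) \<noteq> \<sigma> (2*j)" if "\<sigma> \<in> S" for \<sigma>
    proof -
      have "inj \<sigma>" using that permutes_inj unfolding S_def by auto
      then show ?thesis using \<open>i \<noteq> j\<close> by (simp add: inj_eq)
    qed
    show ?thesis unfolding A_def A'_def by (intro conjI equals0I; clarsimp; metis ne)
  qed
  have finA: "finite (A i)" "finite (A' i)" for i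
    using finS unfolding A_def A'_def by auto
  have "wdg (Suc m) bt Om v = sum T S" unfolding wdg_def T_def S_def ..
  also have "\<dots> = sum T (\<Union>i\<in>{1..Suc m}. A i \<union> A' i)"
    by (rule sum.mono_neutral_right) (use finS zero A_def A'_def in blast)+
  also have "\<dots> = (\<Sum>i\<in>{1..Suc m}. sum T (A i \<union> A' i))"
  proof (rule sum.UNION_disjoint)
    show "\<forall>i\<in>{1..Suc m}. \<forall>j\<in>{1..Suc m}. i \<noteq> j \<longrightarrow> (A i \<union> A' i) \<inter> (A j \<union> A' j) = {}"
      using disj1 disjA by blast
  qed (use finA in auto)
  also have "\<dots> = (\<Sum>i\<in>{1..Suc m}. 2 * sum T (A 1))"
  proof (rule sum.cong[OF refl])
    fix i assume i: "i \<in> {1..Suc m}"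
    have "sum T (A i \<union> A' i) = sum T (A i) + sum T (A' i)"
      by (rule sum.union_disjoint) (use finA disj1 in auto)
    then show "sum T (A i \<union> A' i) = 2 * sum T (A 1)"
      using sum_A'[OF i] sum_A[OF i] by simp
  qed
  also have "\<dots> = 2 * real (Suc m) * Om p q * wdg m bt Om e"
    unfolding sum_A1 by simp
  finally show ?thesis unfolding v_def .
qed

text \<open>Linearity in the slot \<open>i0\<close> reduces dependence to repeated
  arguments.\<close>

lemma wdg_dependent:
  fixes vs :: "nat \<Rightarrow> 'a::real_vector"
  assumes bt: "linear bt" and Om: "\<And>u. linear (Om u)" "\<And>v. linear (\<lambda>u. Om u v)"
    and i0: "i0 \<le> 2*m" and J: "J \<subseteq> {0..2*m} - {i0}" and sp: "vs i0 \<in> span (vs ` J)"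
  shows "wdg m bt Om vs = 0"
proof -
  let ?F = "\<lambda>y. wdg m bt Om (vs(i0 := y))"
  have lin: "linear ?F" by (rule wdg_slot_linear[OF bt Om i0])
  have "?F y = 0" if y: "y \<in> vs ` J" for y
  proof -
    obtain j where j: "j \<in> J" "y = vs j" using y by auto
    then have "j \<noteq> i0" "j \<le> 2*m" using J by auto
    then show ?thesis using j i0 by (intro wdg_repeated[of i0 j]) auto
  qed
  then have "?F (vs i0) = 0"
    using linear_eq_0_on_span[OF lin _ sp] by blast
  then show ?thesis by simp
qed

lemma dim_le_dim_kernel:
  fixes V :: "'a::euclidean_space set" and h :: "'a \<Rightarrow> real"
  assumes V: "subspace V" and h: "linear h"
  shows "dim V \<le> dim (V \<inter> {v. h v = 0}) + 1"
proof (cases "\<exists>z\<in>V. h z \<noteq> 0")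
  case True
  then obtain z where z: "z \<in> V" "h z \<noteq> 0" by blast
  have "V \<subseteq> span (insert z (V \<inter> {v. h v = 0}))"
  proof
    fix v assume v: "v \<in> V"
    let ?u = "v - (h v / h z) *\<^sub>R z"
    have "?u \<in> V \<inter> {v. h v = 0}"
      using v z V h by (auto simp: subspace_diff subspace_scale linear_diff linear_scale)
    then have "?u \<in> span (insert z (V \<inter> {v. h v = 0}))"
      "(h v / h z) *\<^sub>R z \<in> span (insert z (V \<inter> {v. h v = 0}))"
      by (auto intro: span_base span_scale)
    from span_add[OF this] show "v \<in> span (insert z (V \<inter> {v. h v = 0}))" by simp
  qed
  then have "dim V \<le> dim (insert z (V \<inter> {v. h v = 0}))" by (rule dim_mono)
  also have "\<dots> \<le> dim (V \<inter> {v. h v = 0}) + 1" by (simp add: dim_insert)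
  finally show ?thesis .
next
  case False
  then have "V \<inter> {v. h v = 0} = V" by auto
  then show ?thesis by simp
qed

text \<open>Symplectic Gram--Schmidt, one hyperbolic pair at a time.\<close>
lemma contact_wdg_nonzero:
  fixes T :: "'a::euclidean_space set"
  assumes bt: "linear bt" and Om: "\<And>u. linear (Om u)" and skew: "\<And>u v. Om u v = - Om v u"
    and T: "subspace T" "dim T \<ge> 2*m + 1"
    and Y: "Y \<in> T" "bt Y \<noteq> 0" "\<And>v. v \<in> T \<Longrightarrow> Om Y v = 0"
    and nd: "\<And>u. u \<in> T \<Longrightarrow> bt u = 0 \<Longrightarrow> u \<noteq> 0 \<Longrightarrow> \<exists>v\<in>T. bt v = 0 \<and> Om u v \<noteq> 0"
  shows "\<exists>vs. (\<forall>i\<le>2*m. vs i \<in> T) \<and> wdg m bt Om vs \<noteq> 0"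
  using T Y nd
proof (induction m arbitrary: T)
  case 0
  then show ?case by (intro exI[of _ "\<lambda>_. Y"]) (auto simp: wdg_0)
next
  case (Suc m)
  have kersub: "subspace (V \<inter> {v. h v = 0})" if "subspace V" "linear h"
    for V :: "'a set" and h :: "'a \<Rightarrow> real"
    using that by (intro subspace_inter linear_subspace_kernel) auto
  have "dim (T \<inter> {v. bt v = 0}) > 0"
    using dim_le_dim_kernel[OF Suc.prems(1) bt] Suc.prems(2) by simp
  then have "\<not> T \<inter> {v. bt v = 0} \<subseteq> {0}" using dim_eq_0 by (metis less_irrefl)
  then obtain p where p: "p \<in> T" "bt p = 0" "p \<noteq> 0" by blast
  obtain q where q: "q \<in> T" "bt q = 0" "Om p q \<noteq> 0"
    using Suc.prems(6)[OF p] by blast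
  \<comment> \<open>The complement of the hyperbolic pair. It costs at most two dimensions and keeps
    Y, which pairs to zero with all of T.\<close>
  define T' where "T' = T \<inter> {v. Om p v = 0} \<inter> {v. Om q v = 0}"
  have sT': "subspace T'" unfolding T'_def using Suc.prems(1) Om by (intro kersub)
  have dT': "dim T' \<ge> 2*m + 1"
    using dim_le_dim_kernel[OF Suc.prems(1) Om, of p] dim_le_dim_kernel[OF kersub[OF Suc.prems(1) Om] Om, of p q]
      Suc.prems(2) unfolding T'_def by simp
  have nd': "\<exists>v\<in>T'. bt v = 0 \<and> Om u v \<noteq> 0" if u: "u \<in> T'" "bt u = 0" "u \<noteq> 0" for u
  proof -
    obtain v where v: "v \<in> T" "bt v = 0" "Om u v \<noteq> 0"
      using Suc.prems(6)[of u] u unfolding T'_def by auto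
    \<comment> \<open>The projection of v to the complement of p and q; u pairs to zero with both,
      so its pairing with v is unchanged.\<close>
    define v' where "v' = v - (Om p v / Om p q) *\<^sub>R q + (Om q v / Om p q) *\<^sub>R p"
    have pp: "Om x x = 0" for x using skew[of x x] by simp
    have "Om u p = 0" "Om u q = 0"
      using u skew[of u p] skew[of u q] unfolding T'_def by simp_all
    then have "Om u v' = Om u v"
      using Om by (simp add: v'_def linear_add linear_diff linear_scale)
    moreover have "Om p v' = 0" "Om q v' = 0"
      using Om q pp skew[of q p] by (simp_all add: v'_def linear_add linear_diff linear_scale)
    moreover have "v' \<in> T" unfolding v'_def
      using v q p Suc.prems(1) by (intro subspace_add subspace_diff subspace_scale)
    moreover have "bt v' = 0"
      using bt v q p by (simp add: v'_def linear_add linear_diff linear_scale)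
    ultimately show ?thesis using v unfolding T'_def by auto
  qed
  have "Om p Y = 0" "Om q Y = 0"
    using skew[of p Y] skew[of q Y] Suc.prems(5)[OF p(1)] Suc.prems(5)[OF q(1)] by simp_all
  then have YT': "Y \<in> T'" using Suc.prems(3) unfolding T'_def by simp
  have YT'0: "\<And>v. v \<in> T' \<Longrightarrow> Om Y v = 0" using Suc.prems(5) unfolding T'_def by simp
  obtain e where e: "\<forall>i\<le>2*m. e i \<in> T'" "wdg m bt Om e \<noteq> 0"
    using Suc.IH[OF sT' dT' YT' Suc.prems(4) YT'0 nd'] by blast
  let ?v = "\<lambda>i. if i = 0 then p else if i = 1 then q else e (i - 2)"
  have "wdg (Suc m) bt Om ?v = 2 * real (Suc m) * Om p q * wdg m bt Om e"
    using e(1) p unfolding T'_def by (intro wdg_extract_pair[OF skew]) auto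
  then have "wdg (Suc m) bt Om ?v \<noteq> 0" using e q by simp
  moreover have "\<forall>i\<le>2 * Suc m. ?v i \<in> T"
    using e(1) p q unfolding T'_def by auto
  ultimately show ?case by (intro exI[of _ ?v] conjI)
qed

section \<open>Contact geometry at a point of the sphere\<close>

text \<open>Multiplication by i. In the encoding of 1-forms by vector fields it is the standard
  contact form: \<alpha>(v) = \<open>ivec w \<bullet> v\<close> at w, and d\<alpha>(u, v) =
  \<open>2 * (ivec u \<bullet> v)\<close>.\<close>

definition ivec :: "complex^'n::finite \<Rightarrow> complex^'n" where
  "ivec v = (\<chi> j. \<i> * v$j)"

lemma linear_ivec: "linear ivec"
  by (rule linearI) (simp_all add: ivec_def vec_eq_iff algebra_simps)

lemma ivec_ivec: "ivec (ivec v) = - v"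
  by (simp add: ivec_def vec_eq_iff)

lemma inner_cvec: "v \<bullet> w = (\<Sum>j\<in>UNIV. Re (cnj (v$j) * w$j))" for v w :: "complex^'n::finite"
  by (simp add: inner_vec_def inner_complex_def)

lemma inner_ivec_left: "ivec v \<bullet> w = (\<Sum>j\<in>UNIV. Im (cnj (v$j) * w$j))"
  by (simp add: inner_vec_def inner_complex_def ivec_def)

lemma inner_ivec_skew: "ivec v \<bullet> w = - (v \<bullet> ivec w)"
  unfolding inner_vec_def inner_complex_def ivec_def by (simp add: algebra_simps flip: sum_negf)

lemma inner_ivec_ivec: "ivec v \<bullet> ivec w = v \<bullet> w"
  unfolding inner_vec_def inner_complex_def ivec_def by (simp add: algebra_simps)

lemma inner_ivec_self: "ivec v \<bullet> v = 0"
  using inner_ivec_skew[of v v] inner_commute[of v "ivec v"] by linarith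

lemma norm_ivec: "norm (ivec v) = norm v"
  by (simp add: norm_eq_sqrt_inner inner_ivec_ivec)

lemma cnj_mult_self: "cnj z * z = (complex_of_real (cmod z))\<^sup>2"
  by (metis complex_norm_square mult.commute of_real_power)

text \<open>Here h is an arbitrary family of numbers; \<open>L\<close> becomes dg at w when h is
  \<open>mixed_grad\<close> and s, m are a + b, a - b.\<close>

locale milnor_point =
  fixes w :: "complex^'n::finite" and h :: "'n \<Rightarrow> complex" and r s m :: real
  assumes norm_w: "norm w = r" and r_pos: "r > 0" and m_pos: "0 < m" and m_le_s: "m \<le> s"
begin

definition L :: "complex^'n \<Rightarrow> complex" where
  "L v = (\<Sum>j\<in>UNIV. h j * Complex (s * Re (cnj (w$j) * v$j)) (m * Im (cnj (w$j) * v$j)))"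

text \<open>The mean of the \<open>h j\<close> for the weights |w_j|^2 / r^2, of total mass 1; by
  \<open>L_iw\<close> it is all that \<open>L\<close> sees of h on the vector iw.\<close>

definition hmean :: complex where
  "hmean = (\<Sum>j\<in>UNIV. h j * of_real ((cmod (w$j))\<^sup>2)) / of_real (r\<^sup>2)"

definition dev :: "'n \<Rightarrow> complex" where "dev j = h j - hmean"

definition var :: real where
  "var = (\<Sum>j\<in>UNIV. (cmod (dev j))\<^sup>2 * (cmod (w$j))\<^sup>2)"

text \<open>Normalised so that \<open>L (V \<mu>) = \<i> * \<mu> * N\<close>. It vanishes exactly
  when \<open>L\<close> vanishes on \<open>\<xi>\<close>, by this identity in one direction and
  \<open>L_bound\<close> in the other.\<close>

definition N :: real where "N = s * m / 2 * var"

text \<open>The standard contact hyperplane.\<close>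
definition \<xi> :: "(complex^'n) set" where "\<xi> = {v. w \<bullet> v = 0 \<and> ivec w \<bullet> v = 0}"

text \<open>The Hamiltonian vector in \<open>\<xi>\<close> of the functional \<open>v \<mapsto> Re (cnj \<mu> * L v)\<close>.\<close>
definition V :: "complex \<Rightarrow> complex^'n" where
  "V \<mu> = (\<chi> j. w$j * Complex (m * Im (cnj \<mu> * dev j) / 2) (s * Re (cnj \<mu> * dev j) / 2))"

lemma s_pos: "s > 0" using m_pos m_le_s by simp

lemma sum_norm_w: "(\<Sum>j\<in>UNIV. (cmod (w$j))\<^sup>2) = r\<^sup>2"
proof -
  have "(norm w)\<^sup>2 = (\<Sum>j\<in>UNIV. (cmod (w$j))\<^sup>2)"
    by (simp add: norm_vec_def L2_set_def sum_nonneg)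
  then show ?thesis using norm_w by simp
qed

lemma inner_ww: "w \<bullet> w = r\<^sup>2" "ivec w \<bullet> ivec w = r\<^sup>2"
  using norm_w by (simp_all add: norm_ivec dot_square_norm)

lemma linear_L: "linear L"
proof (rule linearI)
  fix x y show "L (x + y) = L x + L y"
    unfolding L_def sum.distrib[symmetric]
    by (intro sum.cong refl) (simp add: complex_eq_iff algebra_simps)
next
  fix t x show "L (t *\<^sub>R x) = t *\<^sub>R L x"
    unfolding L_def scaleR_sum_right
    by (intro sum.cong refl) (simp add: complex_eq_iff algebra_simps)
qed

lemma sum_dev: "(\<Sum>j\<in>UNIV. dev j * of_real ((cmod (w$j))\<^sup>2)) = 0"
proof -
  have "(\<Sum>j\<in>UNIV. dev j * of_real ((cmod (w$j))\<^sup>2)) =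
      (\<Sum>j\<in>UNIV. h j * of_real ((cmod (w$j))\<^sup>2)) - hmean * of_real (\<Sum>j\<in>UNIV. (cmod (w$j))\<^sup>2)"
    by (simp add: dev_def left_diff_distrib sum_subtractf sum_distrib_left)
  also have "\<dots> = 0" unfolding sum_norm_w hmean_def using r_pos by simp
  finally show ?thesis .
qed

text \<open>Mean square minus squared mean. This form is polynomial in h, w and their conjugates,
  which makes \<open>N\<close> smooth in w; the second identity is the covariance of h with its own
  deviation, as needed for \<open>L_V\<close>.\<close>

lemma var_eq: "var = (\<Sum>j\<in>UNIV. (cmod (h j))\<^sup>2 * (cmod (w$j))\<^sup>2) - (cmod (\<Sum>j\<in>UNIV. h j * of_real ((cmod (w$j))\<^sup>2)))\<^sup>2 / r\<^sup>2"
  and var_eq': "(\<Sum>j\<in>UNIV. of_real ((cmod (w$j))\<^sup>2) * h j * cnj (dev j)) = of_real var"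
proof -
  let ?S = "\<Sum>j\<in>UNIV. h j * of_real ((cmod (w$j))\<^sup>2)"
  have sc: "(\<Sum>j\<in>UNIV. cnj (dev j) * of_real ((cmod (w$j))\<^sup>2)) = 0"
    using arg_cong[OF sum_dev, of cnj] by simp
  have "complex_of_real var = (\<Sum>j\<in>UNIV. dev j * cnj (dev j) * of_real ((cmod (w$j))\<^sup>2))"
    unfolding var_def by (simp only: complex_norm_square of_real_sum of_real_mult)
  also have "\<dots> = (\<Sum>j\<in>UNIV. of_real ((cmod (w$j))\<^sup>2) * h j * cnj (dev j)) - hmean * (\<Sum>j\<in>UNIV. cnj (dev j) * of_real ((cmod (w$j))\<^sup>2))"
    by (simp add: dev_def sum_distrib_left flip: sum_subtractf) (simp add: algebra_simps)
  finally show 1: "(\<Sum>j\<in>UNIV. of_real ((cmod (w$j))\<^sup>2) * h j * cnj (dev j)) = of_real var"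
    using sc by simp
  have "(\<Sum>j\<in>UNIV. of_real ((cmod (w$j))\<^sup>2) * h j * cnj (dev j)) =
     (\<Sum>j\<in>UNIV. h j * cnj (h j) * of_real ((cmod (w$j))\<^sup>2)) - ?S * cnj hmean"
    by (simp add: dev_def sum_distrib_right flip: sum_subtractf) (simp add: algebra_simps)
  also have "?S * cnj hmean = of_real ((cmod ?S)\<^sup>2 / r\<^sup>2)"
    by (simp only: hmean_def complex_cnj_divide complex_cnj_complex_of_real of_real_divide
        complex_norm_square times_divide_eq_right)
  also have "(\<Sum>j\<in>UNIV. h j * cnj (h j) * of_real ((cmod (w$j))\<^sup>2)) = of_real (\<Sum>j\<in>UNIV. (cmod (h j))\<^sup>2 * (cmod (w$j))\<^sup>2)"
    by (simp only: complex_norm_square of_real_sum of_real_mult)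
  finally have "complex_of_real var = of_real ((\<Sum>j\<in>UNIV. (cmod (h j))\<^sup>2 * (cmod (w$j))\<^sup>2) - (cmod ?S)\<^sup>2 / r\<^sup>2)"
    unfolding 1 by (simp only: of_real_diff)
  then show "var = (\<Sum>j\<in>UNIV. (cmod (h j))\<^sup>2 * (cmod (w$j))\<^sup>2) - (cmod ?S)\<^sup>2 / r\<^sup>2"
    by (simp only: of_real_eq_iff)
qed

lemma var_nonneg: "var \<ge> 0" unfolding var_def by (simp add: sum_nonneg)

lemma N_nonneg: "N \<ge> 0" unfolding N_def using var_nonneg m_pos s_pos by simp

lemma N_eq_0D: assumes "N = 0" "w$j \<noteq> 0" shows "h j = hmean"
proof -
  have "var = 0" using assms(1) m_pos s_pos unfolding N_def by simp
  then have "(cmod (dev j))\<^sup>2 * (cmod (w$j))\<^sup>2 = 0"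
    unfolding var_def by (subst (asm) sum_nonneg_eq_0_iff) auto
  then show ?thesis using assms(2) by (simp add: dev_def)
qed

lemma L_iw: "L (ivec w) = \<i> * of_real (m * r\<^sup>2) * hmean"
proof -
  have "L (ivec w) = (\<Sum>j\<in>UNIV. \<i> * of_real m * (h j * of_real ((cmod (w$j))\<^sup>2)))"
    unfolding L_def
  proof (intro sum.cong refl)
    fix j
    have "cnj (w$j) * ivec w $ j = \<i> * of_real ((cmod (w$j))\<^sup>2)"
      by (simp add: ivec_def cnj_mult_self)
    then show "h j * Complex (s * Re (cnj (w$j) * ivec w $ j)) (m * Im (cnj (w$j) * ivec w $ j))
      = \<i> * of_real m * (h j * of_real ((cmod (w$j))\<^sup>2))"
      by (simp only:) (simp add: complex_eq_iff)
  qed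
  then have "L (ivec w) = \<i> * of_real m * (\<Sum>j\<in>UNIV. h j * of_real ((cmod (w$j))\<^sup>2))"
    by (simp only: sum_distrib_left)
  then show ?thesis using r_pos by (simp add: hmean_def)
qed

lemma cnj_w_V: "cnj (w$j) * V \<mu> $ j = of_real ((cmod (w$j))\<^sup>2) * Complex (m * Im (cnj \<mu> * dev j) / 2) (s * Re (cnj \<mu> * dev j) / 2)"
  by (simp only: V_def vec_lambda_beta mult.assoc[symmetric] cnj_mult_self of_real_power)

lemma V_in_\<xi>: "V \<mu> \<in> \<xi>"
proof -
  have z: "(\<Sum>j\<in>UNIV. cnj \<mu> * dev j * of_real ((cmod (w$j))\<^sup>2)) = 0"
    using arg_cong[OF sum_dev, of "\<lambda>x. cnj \<mu> * x"] by (simp add: sum_distrib_left mult.assoc)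
  have "(\<Sum>j\<in>UNIV. Re (cnj \<mu> * dev j) * (cmod (w$j))\<^sup>2) = 0" "(\<Sum>j\<in>UNIV. Im (cnj \<mu> * dev j) * (cmod (w$j))\<^sup>2) = 0"
    using arg_cong[OF z, of Re] arg_cong[OF z, of Im] by (simp_all only: Re_sum Im_sum) simp_all
  moreover have "w \<bullet> V \<mu> = m/2 * (\<Sum>j\<in>UNIV. Im (cnj \<mu> * dev j) * (cmod (w$j))\<^sup>2)"
    unfolding inner_cvec cnj_w_V sum_distrib_left by (intro sum.cong refl) (simp add: field_simps)
  moreover have "ivec w \<bullet> V \<mu> = s/2 * (\<Sum>j\<in>UNIV. Re (cnj \<mu> * dev j) * (cmod (w$j))\<^sup>2)"
    unfolding inner_ivec_left cnj_w_V sum_distrib_left by (intro sum.cong refl) (simp add: field_simps)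
  ultimately show ?thesis unfolding \<xi>_def by (simp only: mem_Collect_eq mult_zero_right) 
qed

lemma L_V: "L (V \<mu>) = \<i> * \<mu> * of_real N"
proof -
  have "L (V \<mu>) = (\<Sum>j\<in>UNIV. (\<i> * \<mu> * of_real (s * m / 2)) * (of_real ((cmod (w$j))\<^sup>2) * h j * cnj (dev j)))"
    unfolding L_def cnj_w_V
  proof (intro sum.cong refl)
    fix j
    let ?q = "cnj \<mu> * dev j" and ?c = "(cmod (w$j))\<^sup>2"
    have "Complex (s * Re (of_real ?c * Complex (m * Im ?q / 2) (s * Re ?q / 2))) (m * Im (of_real ?c * Complex (m * Im ?q / 2) (s * Re ?q / 2)))
      = of_real (s * m / 2) * of_real ?c * (\<i> * cnj ?q)"
      by (simp add: complex_eq_iff)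
    then show "h j * Complex (s * Re (of_real ?c * Complex (m * Im ?q / 2) (s * Re ?q / 2))) (m * Im (of_real ?c * Complex (m * Im ?q / 2) (s * Re ?q / 2)))
      = (\<i> * \<mu> * of_real (s * m / 2)) * (of_real ?c * h j * cnj (dev j))"
      by (simp only:) simp
  qed
  also have "\<dots> = \<i> * \<mu> * of_real (s * m / 2) * of_real var"
    unfolding sum_distrib_left[symmetric] var_eq' ..
  finally show ?thesis by (simp add: N_def mult.assoc)
qed

text \<open>On \<open>\<xi>\<close> the numbers \<open>cnj (w$j) * v$j\<close> sum to zero, so
  shifting all \<open>h j\<close> by a constant leaves \<open>L\<close> unchanged.\<close>

lemma L_\<xi>: assumes "v \<in> \<xi>"
  shows "L v = (\<Sum>j\<in>UNIV. dev j * Complex (s * Re (cnj (w$j) * v$j)) (m * Im (cnj (w$j) * v$j)))"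
proof -
  have "(\<Sum>j\<in>UNIV. Complex (s * Re (cnj (w$j) * v$j)) (m * Im (cnj (w$j) * v$j))) = Complex (s * (w \<bullet> v)) (m * (ivec w \<bullet> v))"
    unfolding inner_cvec[of w v] inner_ivec_left[of w v] by (simp only: complex_eq_iff Re_sum Im_sum complex.sel sum_distrib_left)
  also have "\<dots> = 0" using assms by (simp add: \<xi>_def Complex_eq_0)
  finally show ?thesis
    unfolding L_def dev_def by (simp add: left_diff_distrib sum_subtractf flip: sum_distrib_left)
qed

lemma omega_V: assumes "v \<in> \<xi>" shows "2 * (ivec (V \<mu>) \<bullet> v) = - Re (cnj \<mu> * L v)"
proof -
  have "2 * (ivec (V \<mu>) \<bullet> v) = (\<Sum>j\<in>UNIV. - Re (cnj \<mu> * (dev j * Complex (s * Re (cnj (w$j) * v$j)) (m * Im (cnj (w$j) * v$j)))))"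
    unfolding inner_ivec_left sum_distrib_left
  proof (intro sum.cong refl)
    fix j
    let ?x = "cnj (w$j) * v$j" and ?q = "cnj \<mu> * dev j"
    have "cnj (V \<mu> $ j) * v$j = cnj (Complex (m * Im ?q / 2) (s * Re ?q / 2)) * ?x"
      by (simp add: V_def)
    then have "2 * Im (cnj (V \<mu> $ j) * v$j) = m * Im ?q * Im ?x - s * Re ?q * Re ?x"
      by (simp only:) (simp only: times_complex.sel cnj.sel complex.sel, simp add: field_simps)
    also have "\<dots> = - Re (?q * Complex (s * Re ?x) (m * Im ?x))"
      by (simp only: times_complex.sel complex.sel) (simp add: algebra_simps)
    finally show "2 * Im (cnj (V \<mu> $ j) * v$j) = - Re (cnj \<mu> * (dev j * Complex (s * Re ?x) (m * Im ?x)))"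
      by (simp only: mult.assoc)
  qed
  then show ?thesis unfolding L_\<xi>[OF assms] by (simp only: sum_distrib_left Re_sum sum_negf)
qed

text \<open>Cauchy-Schwarz. The factor \<open>sqrt var\<close>, which is a multiple of
  \<open>sqrt N\<close>, is essential: it makes the uncontrolled part of dg on the Reeb direction
  disappear where \<open>N = 0\<close>.\<close>

lemma L_bound: assumes "v \<in> \<xi>" shows "cmod (L v) \<le> s * sqrt var * norm v"
proof -
  have "cmod (L v) \<le> (\<Sum>j\<in>UNIV. (cmod (dev j) * cmod (w$j)) * (s * cmod (v$j)))"
    unfolding L_\<xi>[OF assms]
  proof (rule sum_norm_le)
    fix j
    let ?x = "cnj (w$j) * v$j"
    have "cmod (Complex (s * Re ?x) (m * Im ?x)) \<le> s * cmod ?x"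
    proof (rule power2_le_imp_le)
      have "(m * Im ?x)\<^sup>2 \<le> (s * Im ?x)\<^sup>2"
        unfolding power_mult_distrib using m_pos m_le_s by (intro mult_right_mono power_mono) auto
      then show "(cmod (Complex (s * Re ?x) (m * Im ?x)))\<^sup>2 \<le> (s * cmod ?x)\<^sup>2"
        unfolding cmod_power2 complex.sel power_mult_distrib[of s "cmod ?x"] by (simp only: distrib_left power_mult_distrib add_left_mono)
    qed (use s_pos in simp)
    then have "cmod (dev j) * cmod (Complex (s * Re ?x) (m * Im ?x)) \<le> cmod (dev j) * (s * cmod ?x)"
      by (rule mult_left_mono) simp
    then show "cmod (dev j * Complex (s * Re ?x) (m * Im ?x)) \<le> (cmod (dev j) * cmod (w$j)) * (s * cmod (v$j))"
      by (simp add: norm_mult mult_ac)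
  qed
  also have "\<dots> \<le> L2_set (\<lambda>j. cmod (dev j) * cmod (w$j)) UNIV * L2_set (\<lambda>j. s * cmod (v$j)) UNIV"
    using L2_set_mult_ineq[of "\<lambda>j. cmod (dev j) * cmod (w$j)" "\<lambda>j. s * cmod (v$j)" UNIV] s_pos by (simp add: abs_mult)
  also have "L2_set (\<lambda>j. s * cmod (v$j)) UNIV = s * norm v"
    using s_pos by (simp add: L2_set_right_distrib norm_vec_def)
  also have "L2_set (\<lambda>j. cmod (dev j) * cmod (w$j)) UNIV = sqrt var"
    by (simp add: L2_set_def var_def power_mult_distrib)
  finally show ?thesis by (simp add: mult_ac)
qed

text \<open>The complex structure for which \<open>L\<close> is complex linear stretches angles against radii by
  \<open>s / m\<close>; it preserves \<open>\<xi>\<close> and is tamed by the standard symplectic form.\<close>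
lemma ker_L_symplectic:
  assumes u: "u \<in> \<xi>" "L u = 0" "u \<noteq> 0"
  obtains v where "v \<in> \<xi>" "L v = 0" "ivec u \<bullet> v \<noteq> 0"
proof -
  define x where "x j = Re (cnj (w$j) * u$j)" for j
  define y where "y j = Im (cnj (w$j) * u$j)" for j
  \<comment> \<open>In the coordinates x + iy of \<open>cnj (w$j) * u$j\<close> this is (x, y)
    \<mapsto> (-(m/s) y, (s/m) x), which \<open>L\<close> turns into multiplication by i.
    Coordinates with \<open>w$j = 0\<close> do not enter \<open>L\<close> and are just multiplied by
    i.\<close>
  define v :: "complex^'n" where "v = (\<chi> j. if w$j = 0 then \<i> * u$j else
     w$j * Complex (- (m/s) * y j) ((s/m) * x j) / of_real ((cmod (w$j))\<^sup>2))"
  have cw: "cnj (w$j) * v$j = Complex (- (m/s) * y j) ((s/m) * x j)" for j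
  proof (cases "w$j = 0")
    case True
    then show ?thesis by (simp add: x_def y_def complex_eq_iff)
  next
    case False
    then have "cnj (w$j) * v$j = (cnj (w$j) * w$j) * Complex (- (m/s) * y j) ((s/m) * x j) / of_real ((cmod (w$j))\<^sup>2)"
      by (simp add: v_def)
    then show ?thesis using False unfolding cnj_mult_self by simp
  qed
  have xy0: "(\<Sum>j\<in>UNIV. x j) = 0" "(\<Sum>j\<in>UNIV. y j) = 0"
    using u(1) unfolding \<xi>_def x_def y_def inner_cvec[of w u, symmetric] inner_ivec_left[of w u, symmetric]
    by simp_all
  have "w \<bullet> v = 0" unfolding inner_cvec cw complex.sel
    unfolding sum_distrib_left[symmetric] using xy0 by simp
  moreover have "ivec w \<bullet> v = 0" unfolding inner_ivec_left cw complex.sel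
    unfolding sum_distrib_left[symmetric] using xy0 by simp
  ultimately have "v \<in> \<xi>" by (simp add: \<xi>_def)
  have "L v = \<i> * L u"
    unfolding L_def cw sum_distrib_left
    by (intro sum.cong refl) (use m_pos s_pos in \<open>simp add: complex_eq_iff x_def y_def field_simps\<close>)
  then have "L v = 0" using u by simp
  have pos: "Im (cnj (u$j) * v$j) \<ge> 0" and pos': "u$j \<noteq> 0 \<Longrightarrow> Im (cnj (u$j) * v$j) > 0" for j
  proof -
    have "Im (cnj (u$j) * v$j) > 0" if uj: "u$j \<noteq> 0"
    proof (cases "w$j = 0")
      case True
      then have "Im (cnj (u$j) * v$j) = (cmod (u$j))\<^sup>2"
        unfolding cmod_power2 by (simp add: v_def power2_eq_square)
      then show ?thesis using uj by simp
    next
      case False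
      have "cnj (w$j) * u$j = Complex (x j) (y j)" by (simp add: x_def y_def complex_eq_iff)
      then have "cnj (u$j) * w$j = Complex (x j) (- y j)"
        by (metis (no_types) complex_cnj complex_cnj_cnj complex_cnj_mult mult.commute)
      then have "cnj (u$j) * v$j = Complex (x j) (- y j) * Complex (- (m/s) * y j) ((s/m) * x j) / of_real ((cmod (w$j))\<^sup>2)"
        using False by (simp add: v_def mult.assoc[symmetric])
      then have eq: "Im (cnj (u$j) * v$j) = ((s/m) * (x j)\<^sup>2 + (m/s) * (y j)\<^sup>2) / (cmod (w$j))\<^sup>2"
        by (simp only: Im_divide_of_real) (simp add: power2_eq_square algebra_simps)
      have "cnj (w$j) * u$j \<noteq> 0" using False uj by simp
      then have "x j \<noteq> 0 \<or> y j \<noteq> 0" by (simp add: x_def y_def complex_eq_iff)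
      then have "(s/m) * (x j)\<^sup>2 + (m/s) * (y j)\<^sup>2 > 0"
        using m_pos s_pos by (auto intro: add_pos_nonneg add_nonneg_pos)
      then show ?thesis unfolding eq using False by simp
    qed
    then show "Im (cnj (u$j) * v$j) \<ge> 0" "u$j \<noteq> 0 \<Longrightarrow> Im (cnj (u$j) * v$j) > 0"
      by (cases "u$j = 0"; simp add: less_imp_le)+
  qed
  obtain j0 where "u$j0 \<noteq> 0" using u(3) by (auto simp: vec_eq_iff)
  then have "(\<Sum>j\<in>UNIV. Im (cnj (u$j) * v$j)) > 0"
    by (intro sum_pos2[of _ j0]) (use pos pos' in auto)
  then have "ivec u \<bullet> v \<noteq> 0" unfolding inner_ivec_left by simp
  then show thesis using that \<open>v \<in> \<xi>\<close> \<open>L v = 0\<close> by blast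
qed

lemma contact_gradient:
  obtains X where "X \<in> \<xi>" "\<And>v. v \<in> \<xi> \<Longrightarrow> 2 * (ivec X \<bullet> v) = - (d \<bullet> v)" "norm X \<le> 2 * norm d"
proof -
  \<comment> \<open>The gradient projected to \<open>\<xi>\<close>; half of its quarter turn is the
    Hamiltonian vector for \<open>2 * (ivec u \<bullet> v)\<close>.\<close>
  define p where "p = d - ((w \<bullet> d) / r\<^sup>2) *\<^sub>R w - ((ivec w \<bullet> d) / r\<^sup>2) *\<^sub>R ivec w"
  have "p \<in> \<xi>"
    using inner_ww r_pos inner_ivec_self[of w] inner_commute[of w "ivec w"]
    by (simp add: \<xi>_def p_def inner_diff_right)
  then have "(1/2) *\<^sub>R ivec p \<in> \<xi>"
    using inner_ivec_skew[of w p] by (simp add: \<xi>_def inner_ivec_ivec)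
  moreover have "2 * (ivec ((1/2) *\<^sub>R ivec p) \<bullet> v) = - (d \<bullet> v)" if "v \<in> \<xi>" for v
    using that by (simp add: linear_scale[OF linear_ivec] ivec_ivec p_def inner_diff_left \<xi>_def)
  moreover have "norm ((1/2) *\<^sub>R ivec p) \<le> 2 * norm d"
  proof -
    have a: "norm (((x \<bullet> d) / r\<^sup>2) *\<^sub>R x) \<le> norm d" if x: "norm x = r" for x
    proof -
      have "norm (((x \<bullet> d) / r\<^sup>2) *\<^sub>R x) = \<bar>x \<bullet> d\<bar> / r"
        using x r_pos by (simp add: power2_eq_square)
      also have "\<dots> \<le> norm d"
        using Cauchy_Schwarz_ineq2[of x d] x r_pos by (simp add: divide_le_eq mult.commute)
      finally show ?thesis .
    qed
    have "norm p \<le> norm d + norm d + norm d"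
      unfolding p_def using a[of w] a[of "ivec w"] norm_w norm_ivec[of w]
      by (intro order_trans[OF norm_triangle_ineq4] add_mono) auto
    then have "norm p \<le> 4 * norm d" using norm_ge_zero[of d] by linarith
    then show ?thesis by (simp add: norm_ivec)
  qed
  ultimately show thesis using that by blast
qed

text \<open>The Reeb direction iw of the standard form is corrected by \<open>r\<^sup>2\<close>
  times the Hamiltonian vector of D. The part of D that factors through \<open>L\<close> has the
  explicit Hamiltonian vector \<open>V \<mu>\<close>; the contribution of d to \<open>L Y\<close> is
  only estimated.\<close>

lemma reeb_direction:
  assumes D: "\<And>v. D v = Re (cnj \<mu> * L v) + d \<bullet> v"
  obtains Y where "w \<bullet> Y = 0" "ivec w \<bullet> Y = r\<^sup>2" "\<And>v. v \<in> \<xi> \<Longrightarrow> 2 * (ivec Y \<bullet> v) = - r\<^sup>2 * D v"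
    "cmod (L Y - \<i> * of_real (r\<^sup>2) * (of_real m * hmean + \<mu> * of_real N)) \<le> r\<^sup>2 * (s * sqrt var * (2 * norm d))"
proof -
  obtain X where X: "X \<in> \<xi>" "\<And>v. v \<in> \<xi> \<Longrightarrow> 2 * (ivec X \<bullet> v) = - (d \<bullet> v)" "norm X \<le> 2 * norm d"
    using contact_gradient[where d = d] by metis
  define Y where "Y = ivec w + r\<^sup>2 *\<^sub>R (V \<mu> + X)"
  have YV: "w \<bullet> V \<mu> = 0" "ivec w \<bullet> V \<mu> = 0" "w \<bullet> X = 0" "ivec w \<bullet> X = 0"
    using V_in_\<xi> X(1) unfolding \<xi>_def by auto
  have "w \<bullet> Y = 0" "ivec w \<bullet> Y = r\<^sup>2"
    using YV inner_ivec_self[of w] inner_commute[of w "ivec w"] inner_ww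
    by (simp_all add: Y_def inner_add_right)
  moreover have "2 * (ivec Y \<bullet> v) = - r\<^sup>2 * D v" if v: "v \<in> \<xi>" for v
  proof -
    have iY: "ivec Y = - w + r\<^sup>2 *\<^sub>R (ivec (V \<mu>) + ivec X)"
      unfolding Y_def by (simp add: linear_add[OF linear_ivec] linear_scale[OF linear_ivec] ivec_ivec)
    have "2 * (ivec Y \<bullet> v) = r\<^sup>2 * (2 * (ivec (V \<mu>) \<bullet> v) + 2 * (ivec X \<bullet> v))"
      unfolding iY using v by (simp add: inner_add_left inner_diff_left \<xi>_def algebra_simps)
    then show ?thesis unfolding omega_V[OF v] X(2)[OF v] D by (simp add: algebra_simps)
  qed
  moreover have "cmod (L Y - \<i> * of_real (r\<^sup>2) * (of_real m * hmean + \<mu> * of_real N)) \<le> r\<^sup>2 * (s * sqrt var * (2 * norm d))"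
  proof -
    have "L Y - \<i> * of_real (r\<^sup>2) * (of_real m * hmean + \<mu> * of_real N) = r\<^sup>2 *\<^sub>R L X"
      unfolding Y_def linear_add[OF linear_L] linear_scale[OF linear_L] L_iw L_V
      by (simp add: scaleR_conv_of_real algebra_simps)
    moreover have "cmod (L X) \<le> s * sqrt var * (2 * norm d)"
      using L_bound[OF X(1)] s_pos var_nonneg X(3)
      by (meson mult_left_mono mult_nonneg_nonneg order_trans real_sqrt_ge_zero less_imp_le)
    ultimately show ?thesis by (simp add: mult_left_mono)
  qed
  ultimately show thesis using that by blast
qed

lemma L_surjective: assumes "N > 0" obtains v where "v \<in> \<xi>" "L v = z"
proof -
  have "L (V (z / (\<i> * of_real N))) = z" unfolding L_V using assms by simp
  then show thesis using that V_in_\<xi> by blast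
qed

end

text \<open>\<open>Y\<close> spans the kernel, on \<open>TS w\<close>, of the differential of \<open>exp (- \<psi>) \<alpha>\<close>, where \<open>D = d\<psi>\<close> and \<open>e = exp (- \<psi>)\<close>.\<close>
locale contact_point = milnor_point w h r s m for w :: "complex^'n::finite" and h r s m +
  fixes D :: "complex^'n \<Rightarrow> real" and Y :: "complex^'n" and e :: real
  assumes D: "linear D" and e_pos: "e > 0"
    and Y: "w \<bullet> Y = 0" "ivec w \<bullet> Y = r\<^sup>2" "\<And>v. v \<in> \<xi> \<Longrightarrow> 2 * (ivec Y \<bullet> v) = - r\<^sup>2 * D v"
begin

definition bt :: "complex^'n \<Rightarrow> real" where "bt v = e * (ivec w \<bullet> v)"

text \<open>The differential of e\<alpha> with de = - e D, that is, e times d\<alpha> minus the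
  wedge of D and \<alpha>. On \<open>\<xi>\<close> the terms with D drop out.\<close>

definition Om :: "complex^'n \<Rightarrow> complex^'n \<Rightarrow> real" where
  "Om u v = e * (2 * (ivec u \<bullet> v) - D u * (ivec w \<bullet> v) + D v * (ivec w \<bullet> u))"

lemma linear_bt: "linear bt"
  by (rule linearI) (simp_all add: bt_def inner_add_right algebra_simps)

lemma Om_skew: "Om u v = - Om v u"
proof -
  have "ivec u \<bullet> v = - (ivec v \<bullet> u)" using inner_ivec_skew[of u v] inner_commute[of u "ivec v"] by linarith
  then show ?thesis unfolding Om_def by (simp add: algebra_simps)
qed

lemma linear_Om: "linear (Om u)"
  by (rule linearI) (simp_all add: Om_def inner_add_right linear_add[OF D] linear_scale[OF D] algebra_simps)

lemma linear_Om_left: "linear (\<lambda>u. Om u v)"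
proof -
  have "(\<lambda>u. Om u v) = (\<lambda>u. - Om v u)" using Om_skew by blast
  then show ?thesis using linear_compose_neg[OF linear_Om[of v]] by simp
qed

lemma subspace_TS: "subspace (TS w)"
  unfolding TS_def by (simp add: subspace_hyperplane)

lemma dim_TS: "dim (TS w) = 2 * CARD('n) - 1"
proof -
  have "w \<noteq> 0" using norm_w r_pos by auto
  then show ?thesis unfolding TS_def using dim_hyperplane[of w] by simp
qed

lemma Y_TS: "Y \<in> TS w" using Y by (simp add: TS_def)

lemma bt_Y: "bt Y > 0" using Y e_pos r_pos by (simp add: bt_def)

lemma TS_split: assumes "v \<in> TS w"
  obtains t v' where "v = t *\<^sub>R Y + v'" "v' \<in> \<xi>" "t = (ivec w \<bullet> v) / r\<^sup>2"
proof -
  define t where "t = (ivec w \<bullet> v) / r\<^sup>2"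
  have "v - t *\<^sub>R Y \<in> \<xi>"
    using assms Y r_pos unfolding \<xi>_def TS_def t_def by (simp add: inner_diff_right)
  then show thesis using that[of t "v - t *\<^sub>R Y"] t_def by simp
qed

lemma Om_\<xi>: "u \<in> \<xi> \<Longrightarrow> v \<in> \<xi> \<Longrightarrow> Om u v = 2 * e * (ivec u \<bullet> v)"
  by (simp add: Om_def \<xi>_def)

lemma \<xi>_TS: "v \<in> \<xi> \<Longrightarrow> v \<in> TS w" by (simp add: \<xi>_def TS_def)

lemma \<xi>_iff: "v \<in> \<xi> \<longleftrightarrow> v \<in> TS w \<and> bt v = 0"
  using e_pos by (auto simp: \<xi>_def TS_def bt_def)

lemma Om_Y: assumes "v \<in> TS w" shows "Om Y v = 0"
proof -
  obtain t v' where v: "v = t *\<^sub>R Y + v'" "v' \<in> \<xi>" using TS_split[OF assms] by metis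
  have "Om Y Y = 0" using Om_skew[of Y Y] by simp
  moreover have "Om Y v' = 0" using Y(3)[OF v(2)] v(2) Y(2) unfolding Om_def \<xi>_def by simp
  ultimately show ?thesis unfolding v(1) by (simp add: linear_add[OF linear_Om] linear_scale[OF linear_Om])
qed

lemma ivec_\<xi>: "v \<in> \<xi> \<Longrightarrow> ivec v \<in> \<xi>"
  using inner_ivec_skew[of w v] by (simp add: \<xi>_def inner_ivec_ivec)

lemma Om_ivec_pos: assumes "u \<in> \<xi>" "u \<noteq> 0" shows "Om u (ivec u) > 0"
  using assms e_pos by (simp add: Om_\<xi> ivec_\<xi> inner_ivec_ivec)

text \<open>After splitting off the component along Y, the rest \<open>u'\<close> pairs positively
  with \<open>ivec u'\<close> unless it is zero.\<close>

lemma Om_kernel: assumes "u \<in> TS w" "\<And>v. v \<in> TS w \<Longrightarrow> Om u v = 0"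
  shows "u = ((ivec w \<bullet> u) / r\<^sup>2) *\<^sub>R Y"
proof -
  obtain t u' where u: "u = t *\<^sub>R Y + u'" "u' \<in> \<xi>" "t = (ivec w \<bullet> u) / r\<^sup>2" using TS_split[OF assms(1)] .
  have iu: "ivec u' \<in> TS w" using u(2) by (intro \<xi>_TS ivec_\<xi>)
  have "Om u (ivec u') = t * Om Y (ivec u') + Om u' (ivec u')"
    unfolding u(1) by (simp add: linear_add[OF linear_Om_left] linear_scale[OF linear_Om_left])
  then have "Om u' (ivec u') = 0" using assms(2)[OF iu] Om_Y[OF iu] by simp
  then have "u' = 0" using Om_ivec_pos[OF u(2)] by force
  then show ?thesis using u by simp
qed

lemma contact_sphere: "\<exists>vs. (\<forall>i\<le>2*(CARD('n) - 1). vs i \<in> TS w) \<and> wdg (CARD('n) - 1) bt Om vs \<noteq> 0"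
proof (rule contact_wdg_nonzero[OF linear_bt linear_Om Om_skew subspace_TS _ Y_TS _ Om_Y])
  show "2 * (CARD('n) - 1) + 1 \<le> dim (TS w)"
    unfolding dim_TS using zero_less_card_finite[where 'a='n] by linarith
  show "bt Y \<noteq> 0" using bt_Y by simp
  fix u assume "u \<in> TS w" "bt u = 0" "u \<noteq> 0"
  then have u: "u \<in> \<xi>" "u \<noteq> 0" using \<xi>_iff by auto
  then show "\<exists>v\<in>TS w. bt v = 0 \<and> Om u v \<noteq> 0"
    using Om_ivec_pos[OF u] ivec_\<xi>[OF u(1)] \<xi>_iff by (intro bexI[of _ "ivec u"]) auto
qed

text \<open>\<open>TK g w\<close>, once \<open>L\<close> is known to be the derivative of g at
  w.\<close>

definition TKL :: "(complex^'n) set" where "TKL = {v. w \<bullet> v = 0 \<and> L v = 0}"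

lemma TKL_TS: "v \<in> TKL \<Longrightarrow> v \<in> TS w" by (simp add: TKL_def TS_def)

lemma linear_ReL: "linear (\<lambda>v. Re (L v))" and linear_ImL: "linear (\<lambda>v. Im (L v))"
  using linear_L by (auto intro!: linearI simp: linear_add linear_scale)

lemma TKL_eq: "TKL = TS w \<inter> {v. Re (L v) = 0} \<inter> {v. Im (L v) = 0}"
  by (auto simp: TKL_def TS_def complex_eq_iff)

lemma subspace_TKL1: "subspace (TS w \<inter> {v. Re (L v) = 0})"
  by (intro subspace_inter subspace_TS linear_subspace_kernel linear_ReL)

lemma subspace_TKL: "subspace TKL"
  unfolding TKL_eq by (intro subspace_inter subspace_TKL1 linear_subspace_kernel linear_ImL)

lemma dim_TKL_ge: "2 * CARD('n) - 3 \<le> dim TKL"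
  using dim_le_dim_kernel[OF subspace_TS linear_ReL] dim_le_dim_kernel[OF subspace_TKL1 linear_ImL]
  unfolding dim_TS TKL_eq by linarith

text \<open>The vectors a and b show that each of the two real equations lowers the dimension. The
  bound is what later forces an independent family of 2n - 3 vectors to span
  \<open>TKL\<close>.\<close>

lemma dim_TKL_le:
  assumes a: "a \<in> TS w" "L a = 1" and b: "b \<in> TS w" "L b = \<i>"
  shows "dim TKL \<le> 2 * CARD('n) - 3"
proof -
  let ?T = "TS w \<inter> {v. Re (L v) = 0}"
  have "dim TKL < dim ?T"
  proof (rule dim_psubset)
    have "b \<in> ?T" "b \<notin> TKL" using b by (auto simp: TKL_def)
    then have "TKL \<subset> ?T" unfolding TKL_eq by blast
    then show "span TKL \<subset> span ?T"
      using subspace_TKL subspace_TKL1 by (simp add: span_eq_iff[THEN iffD2])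
  qed
  moreover have "dim ?T < dim (TS w)"
  proof (rule dim_psubset)
    have "a \<notin> ?T" using a by auto
    then have "?T \<subset> TS w" using a by blast
    then show "span ?T \<subset> span (TS w)"
      using subspace_TS subspace_TKL1 by (simp add: span_eq_iff[THEN iffD2])
  qed
  ultimately show ?thesis unfolding dim_TS by linarith
qed

text \<open>As \<open>L Y = 0\<close>, the vector Y is tangent to the binding and spans the kernel
  there; on \<open>\<xi>\<close> the form is a multiple of the standard one, and
  \<open>ker_L_symplectic\<close> gives non-degeneracy.\<close>

lemma contact_binding:
  assumes n: "CARD('n) \<ge> 2" and LY: "L Y = 0"
  shows "\<exists>vs. (\<forall>i\<le>2*(CARD('n) - 2). vs i \<in> TKL) \<and> wdg (CARD('n) - 2) bt Om vs \<noteq> 0"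
proof (rule contact_wdg_nonzero[OF linear_bt linear_Om Om_skew subspace_TKL])
  show "2 * (CARD('n) - 2) + 1 \<le> dim TKL" using dim_TKL_ge n by linarith
  show "Y \<in> TKL" using Y LY by (simp add: TKL_def)
  show "bt Y \<noteq> 0" using bt_Y by simp
  show "Om Y v = 0" if "v \<in> TKL" for v using that TKL_TS Om_Y by blast
  fix u assume u: "u \<in> TKL" "bt u = 0" "u \<noteq> 0"
  then have "u \<in> \<xi>" "L u = 0" using \<xi>_iff TKL_TS by (auto simp: TKL_def)
  then obtain v where v: "v \<in> \<xi>" "L v = 0" "ivec u \<bullet> v \<noteq> 0" using ker_L_symplectic u(3) by metis
  then have "v \<in> TKL" "bt v = 0" "Om u v \<noteq> 0"
    using \<xi>_iff Om_\<xi>[OF \<open>u \<in> \<xi>\<close> v(1)] e_pos by (auto simp: TKL_def \<xi>_def)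
  then show "\<exists>v\<in>TKL. bt v = 0 \<and> Om u v \<noteq> 0" by blast
qed

text \<open>The kernel of q is a complement of Y, and Y pairs to zero with everything. A null vector
  of the page is thus a null vector of all of \<open>TS w\<close>, hence a multiple of Y, and q
  kills it.\<close>

lemma page_symplectic:
  fixes q :: "complex^'n \<Rightarrow> real"
  assumes q: "linear q" "q Y \<noteq> 0" and u: "u \<in> TS w" "q u = 0"
    and 0: "\<And>v. v \<in> TS w \<Longrightarrow> q v = 0 \<Longrightarrow> Om u v = 0"
  shows "u = 0"
proof -
  have "Om u v = 0" if v: "v \<in> TS w" for v
  proof -
    let ?v = "v - (q v / q Y) *\<^sub>R Y"
    have "?v \<in> TS w" using v Y_TS subspace_TS by (intro subspace_diff subspace_scale)
    moreover have "q ?v = 0" using q by (simp add: linear_diff linear_scale)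
    ultimately have "Om u ?v = 0" by (rule 0)
    moreover have "Om u Y = 0" using Om_skew[of u Y] Om_Y[OF u(1)] by simp
    ultimately show ?thesis by (simp add: linear_diff[OF linear_Om] linear_scale[OF linear_Om])
  qed
  then have *: "u = ((ivec w \<bullet> u) / r\<^sup>2) *\<^sub>R Y" using Om_kernel[OF u(1)] by blast
  then have "(ivec w \<bullet> u) / r\<^sup>2 * q Y = 0" using u(2) linear_scale[OF q(1)] by (metis real_scaleR_def)
  then have "(ivec w \<bullet> u) / r\<^sup>2 = 0" using q(2) by simp
  then show ?thesis using * by (metis scaleR_zero_left)
qed

lemma reeb_positive:
  fixes q :: "complex^'n \<Rightarrow> real"
  assumes q: "linear q" "q Y > 0" and R: "R \<in> TS w" "bt R = 1" "\<And>v. v \<in> TS w \<Longrightarrow> Om R v = 0"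
  shows "q R > 0"
proof -
  have *: "R = ((ivec w \<bullet> R) / r\<^sup>2) *\<^sub>R Y" using Om_kernel[OF R(1,3)] .
  have "ivec w \<bullet> R > 0" using R(2) e_pos unfolding bt_def by (metis zero_less_mult_pos zero_less_one)
  then have "(ivec w \<bullet> R) / r\<^sup>2 * q Y > 0" using q(2) r_pos by simp
  then show ?thesis using * linear_scale[OF q(1)] by (metis real_scaleR_def)
qed

text \<open>The coorientation b may be replaced by the vector p in \<open>\<xi>\<close> with
  \<open>L p = \<i>\<close>: the difference lies in \<open>TKL\<close>, where it is dependent on E.
  This p pairs to zero with \<open>TKL\<close> and to e / N > 0 with - a, so
  \<open>wdg_extract_pair\<close> makes the product a positive multiple of a square.\<close>

lemma binding_orientation:
  assumes n: "CARD('n) \<ge> 2" and LY: "L Y = 0" and N0: "N > 0"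
    and a: "a \<in> TS w" "L a = 1" and b: "b \<in> TS w" "L b = \<i>" and E: "\<And>i. E i \<in> TKL"
  shows "wdg (CARD('n) - 1) bt Om (\<lambda>i. if i = 0 then b else if i = 1 then - a else E (i - 2))
     * wdg (CARD('n) - 2) bt Om E \<ge> 0"
proof (cases "wdg (CARD('n) - 2) bt Om E = 0")
  case False
  define n' where "n' = CARD('n) - 2"
  have n': "CARD('n) - 1 = Suc n'" "CARD('n) - 2 = n'" "CARD('n) = n' + 2" using n by (auto simp: n'_def)
  have wE: "wdg n' bt Om E \<noteq> 0" using False n' by simp
  define p where "p = V (1 / of_real N)"
  have p: "p \<in> \<xi>" "L p = \<i>" using V_in_\<xi> L_V N0 by (simp_all add: p_def)
  have YK: "Y \<in> TKL" using Y LY by (simp add: TKL_def)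
  have pY: "Om p Y = 0" using Om_skew[of p Y] Om_Y[OF \<xi>_TS[OF p(1)]] by simp
  have Omp: "Om p v = - e * Re (L v) / N" if "v \<in> \<xi>" for v
  proof -
    have "2 * (ivec p \<bullet> v) = - Re (L v) / N"
      using omega_V[OF that, of "1 / of_real N"] unfolding p_def by simp
    then have "e * (2 * (ivec p \<bullet> v)) = e * (- Re (L v) / N)" by (simp only:)
    then show ?thesis using Om_\<xi>[OF p(1) that] by simp
  qed
  have OmpT: "Om p v = - e * Re (L v) / N" if v: "v \<in> TS w" for v
  proof -
    obtain t v' where v: "v = t *\<^sub>R Y + v'" "v' \<in> \<xi>" using TS_split[OF v] by metis
    then show ?thesis using Omp[OF v(2)] pY LY
      by (simp add: linear_add[OF linear_Om] linear_scale[OF linear_Om] linear_add[OF linear_L] linear_scale[OF linear_L])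
  qed
  have "\<And>i. Om p (E i) = 0" using OmpT TKL_TS E by (simp add: TKL_def)
  let ?F = "\<lambda>x i. if i = 0 then x else if i = 1 then - a else E (i - 2)"
  have first: "wdg (Suc n') bt Om (?F p) = 2 * real (Suc n') * Om p (- a) * wdg n' bt Om E"
    by (rule wdg_extract_pair[OF Om_skew]) (use p \<xi>_iff \<open>\<And>i. Om p (E i) = 0\<close> in auto)
  \<comment> \<open>E consists of 2n - 3 vectors, independent because the form does not vanish on
    them; by \<open>dim_TKL_le\<close> they span \<open>TKL\<close>, so x is dependent on
    them.\<close>
  have second: "wdg (Suc n') bt Om (?F x) = 0" if x: "x \<in> TKL" for x
  proof -
    have inj: "inj_on E {0..2*n'}"
    proof (rule inj_onI, rule ccontr)
      fix i j assume "i \<in> {0..2*n'}" "j \<in> {0..2*n'}" "E i = E j" "i \<noteq> j"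
      then show False using wdg_repeated[of i j n' E bt Om] wE by simp
    qed
    have indep: "independent (E ` {0..2*n'})"
    proof (rule ccontr)
      assume "\<not> independent (E ` {0..2*n'})"
      then obtain i where i: "i \<in> {0..2*n'}" "E i \<in> span (E ` {0..2*n'} - {E i})"
        unfolding dependent_def by blast
      have "E ` {0..2*n'} - {E i} = E ` ({0..2*n'} - {i})" using inj i(1) by (auto simp: inj_on_def)
      then have "wdg n' bt Om E = 0"
        using i by (intro wdg_dependent[OF linear_bt linear_Om linear_Om_left, of i n' "{0..2*n'} - {i}"]) auto
      then show False using wE by simp
    qed
    have cE: "card (E ` {0..2*n'}) = 2 * n' + 1" using card_image[OF inj] by simp
    have "TKL \<subseteq> span (E ` {0..2*n'})"
      by (rule card_ge_dim_independent) (use E indep dim_TKL_le[OF a b] cE n' in auto)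
    then have "x \<in> span (E ` {0..2*n'})" using x by blast
    moreover have "E ` {0..2*n'} = ?F x ` {2..2 * Suc n'}"
    proof -
      have "{2..2 * Suc n'} = (\<lambda>i. i + 2) ` {0..2*n'}" 
      proof safe
        fix i assume "i \<in> {2..2 * Suc n'}"
        then have "i - 2 \<in> {0..2*n'}" "i = (i - 2) + 2" by auto
        then show "i \<in> (\<lambda>i. i + 2) ` {0..2*n'}" by blast
      qed auto
      then show ?thesis by (simp only: image_image) simp
    qed
    ultimately have "?F x 0 \<in> span (?F x ` {2..2 * Suc n'})" by simp
    then show ?thesis
      by (intro wdg_dependent[OF linear_bt linear_Om linear_Om_left, of 0 "Suc n'" "{2..2 * Suc n'}" "?F x"]) auto
  qed
  have upd: "?F x = (?F p)(0 := x)" for x by auto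
  have lin: "linear (\<lambda>x. wdg (Suc n') bt Om (?F x))"
    using wdg_slot_linear[OF linear_bt linear_Om linear_Om_left, of 0 "Suc n'" "?F p"]
    unfolding upd[symmetric] by simp
  have "b - p \<in> TKL" using b p \<xi>_TS[OF p(1)] by (simp add: TKL_def TS_def inner_diff_right linear_diff[OF linear_L])
  then have "wdg (Suc n') bt Om (?F b) = wdg (Suc n') bt Om (?F p)"
    using second[of "b - p"] linear_diff[OF lin, of b p] by simp
  also have "\<dots> = 2 * real (Suc n') * (e / N) * wdg n' bt Om E"
    unfolding first using OmpT[OF a(1)] a(2) by (simp add: linear_neg[OF linear_Om])
  finally have "wdg (Suc n') bt Om (?F b) * wdg n' bt Om E = 2 * real (Suc n') * (e / N) * (wdg n' bt Om E)\<^sup>2"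
    by (simp add: power2_eq_square)
  also have "\<dots> \<ge> 0" using e_pos N0 by simp
  finally show ?thesis unfolding n'(1,2) .
qed simp

end

section \<open>The contact form on a sphere\<close>

definition mixed_map :: "nat \<Rightarrow> nat \<Rightarrow> complex^'n::finite \<Rightarrow> complex^'n" where
  "mixed_map a b w = (\<chi> j. (w$j) ^ a * cnj (w$j) ^ b)"

text \<open>The coefficient \<open>h_j\<close> of dg. In terms of z = \<open>mixed_map a b w\<close>
  it satisfies z_j (\<partial>_j f)(z) = h_j |w_j|^2.\<close>

definition mixed_grad :: "(('n::finite \<Rightarrow> nat) \<Rightarrow> complex) \<Rightarrow> nat \<Rightarrow> nat \<Rightarrow> complex^'n \<Rightarrow> 'n \<Rightarrow> complex" where
  "mixed_grad c a b w j = series_diff c j (mixed_map a b w) * ((w$j) ^ (a - 1) * cnj (w$j) ^ (b - 1))"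

lemma mixed_fun_eq: "mixed_fun a b f w = f (mixed_map a b w)"
  by (simp add: mixed_fun_def mixed_map_def)

text \<open>With X = \<open>cnj (w$j) * v$j\<close>, the differential of w_j^a cnj w_j^b is
  w_j^(a-1) cnj w_j^(b-1) times a X + b cnj X, whose parts are (a + b) Re X and (a - b) Im
  X.\<close>

lemma mixed_fun_has_derivative:
  assumes ps: "power_series_near0 c f \<epsilon>" and w: "mixed_map a b w \<in> ball 0 \<epsilon>" and ab: "0 < b" "b < a"
  shows "(mixed_fun a b f has_derivative (\<lambda>v. \<Sum>j\<in>UNIV. mixed_grad c a b w j *
     Complex ((real a + real b) * Re (cnj (w$j) * v$j)) ((real a - real b) * Im (cnj (w$j) * v$j)))) (at w)"
proof -
  have "((\<lambda>w. (w$j) ^ a * cnj (w$j) ^ b) has_derivative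
      (\<lambda>v. (w$j) ^ a * (of_nat b * cnj (v$j) * cnj (w$j) ^ (b - 1)) + (of_nat a * v$j * (w$j) ^ (a - 1)) * cnj (w$j) ^ b)) (at w)" for j
    by (intro has_derivative_mult has_derivative_power bounded_linear.has_derivative[OF bounded_linear_cnj]
        bounded_linear_imp_has_derivative bounded_linear_vec_nth)
  then have "(mixed_map a b has_derivative
      (\<lambda>v. \<chi> j. (w$j) ^ a * (of_nat b * cnj (v$j) * cnj (w$j) ^ (b - 1)) + (of_nat a * v$j * (w$j) ^ (a - 1)) * cnj (w$j) ^ b)) (at w)"
    unfolding mixed_map_def[abs_def] by (intro has_derivative_vec_lambda)
  from has_derivative_compose[OF this power_series_has_derivative[OF ps w]]
  have "(mixed_fun a b f has_derivative
      (\<lambda>v. \<Sum>j\<in>UNIV. series_diff c j (mixed_map a b w) *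
        ((w$j) ^ a * (of_nat b * cnj (v$j) * cnj (w$j) ^ (b - 1)) + (of_nat a * v$j * (w$j) ^ (a - 1)) * cnj (w$j) ^ b))) (at w)"
    by (simp add: mixed_fun_eq[abs_def])
  moreover have "series_diff c j (mixed_map a b w) *
        ((w$j) ^ a * (of_nat b * cnj (v$j) * cnj (w$j) ^ (b - 1)) + (of_nat a * v$j * (w$j) ^ (a - 1)) * cnj (w$j) ^ b)
      = mixed_grad c a b w j * Complex ((real a + real b) * Re (cnj (w$j) * v$j)) ((real a - real b) * Im (cnj (w$j) * v$j))" for j v
  proof -
    let ?X = "cnj (w$j) * v$j"
    have C: "Complex ((real a + real b) * Re ?X) ((real a - real b) * Im ?X) = of_nat a * ?X + of_nat b * cnj ?X"
      by (simp add: complex_eq_iff algebra_simps)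
    have pa: "(w$j) ^ a = w$j * (w$j) ^ (a - 1)" using ab by (cases a) auto
    have pb: "cnj (w$j) ^ b = cnj (w$j) * cnj (w$j) ^ (b - 1)" using ab by (cases b) auto
    show ?thesis unfolding mixed_grad_def C pa pb by (simp add: algebra_simps)
  qed
  ultimately show ?thesis by simp
qed

text \<open>The set where \<open>q x - K * sqrt (N x) \<le> 0\<close> is compact and avoids the
  zeros of N, so N has a positive minimum on it and a large C wins there; elsewhere any C \<ge> 0
  does.\<close>

lemma compact_dominating_constant:
  fixes N q :: "'a::metric_space \<Rightarrow> real"
  assumes S: "compact S" and N: "continuous_on S N" "\<And>x. x \<in> S \<Longrightarrow> N x \<ge> 0"
    and q: "continuous_on S q" "\<And>x. x \<in> S \<Longrightarrow> N x = 0 \<Longrightarrow> q x > 0"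
  shows "\<exists>C. \<forall>x\<in>S. 2 * C * N x + q x - K * sqrt (N x) > 0"
proof -
  define p where "p x = q x - K * sqrt (N x)" for x
  have p: "continuous_on S p" unfolding p_def by (intro continuous_intros N q)
  define Z where "Z = {x\<in>S. p x \<le> 0}"
  have "closedin (top_of_set S) (S \<inter> p -` {..0})"
    by (rule continuous_closedin_preimage[OF p]) simp
  moreover have "S \<inter> p -` {..0} = Z" unfolding Z_def by auto
  ultimately have "closedin (top_of_set S) Z" by simp
  then have Z: "compact Z" using S by (rule closedin_compact[rotated])
  show ?thesis
  proof (cases "Z = {}")
    case True
    then show ?thesis by (intro exI[of _ 0]) (auto simp: Z_def p_def not_le)
  next
    case False
    have sub: "Z \<subseteq> S" unfolding Z_def by auto
    obtain x0 where x0: "x0 \<in> Z" "\<And>x. x \<in> Z \<Longrightarrow> N x0 \<le> N x"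
      using continuous_attains_inf[OF Z False continuous_on_subset[OF N(1) sub]] by blast
    obtain x1 where x1: "x1 \<in> Z" "\<And>x. x \<in> Z \<Longrightarrow> p x1 \<le> p x"
      using continuous_attains_inf[OF Z False continuous_on_subset[OF p sub]] by blast
    have "N x0 \<noteq> 0"
    proof
      assume "N x0 = 0"
      then have "p x0 > 0" using q(2)[of x0] x0 sub by (auto simp: p_def)
      then show False using x0 by (simp add: Z_def)
    qed
    then have N0: "N x0 > 0" using N(2)[of x0] x0 sub by fastforce
    define C where "C = (1 + \<bar>p x1\<bar>) / (2 * N x0)"
    have C: "C \<ge> 0" using N0 by (simp add: C_def)
    have "2 * C * N x + p x > 0" if x: "x \<in> S" for x
    proof (cases "x \<in> Z")
      case True
      have "2 * C * N x \<ge> 2 * C * N x0" using x0(2)[OF True] C by (simp add: mult_left_mono)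
      moreover have "2 * C * N x0 = 1 + \<bar>p x1\<bar>" using N0 by (simp add: C_def)
      ultimately show ?thesis using x1(2)[OF True] by linarith
    next
      case False
      then have "p x > 0" using x by (simp add: Z_def not_le)
      moreover have "2 * C * N x \<ge> 0" using C N(2)[OF x] by simp
      ultimately show ?thesis by linarith
    qed
    then show ?thesis by (intro exI[of _ C] ballI) (simp add: p_def add_diff_eq)
  qed
qed

text \<open>\<open>H\<close> is the condition on one fixed sphere, and \<open>inb\<close> says that
  the series converges on its image. No smallness of r enters, so spheres of any size can be
  treated.\<close>

lemma carries_contactI:
  fixes c :: "('n::finite \<Rightarrow> nat) \<Rightarrow> complex"
  assumes n: "CARD('n) \<ge> 2" and ps: "power_series_near0 c f \<epsilon>" and r: "r > 0" and ab: "0 < b" "b < a"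
    and inb: "\<And>w :: complex^'n. norm w = r \<Longrightarrow> mixed_map a b w \<in> ball 0 \<epsilon>"
    and H: "\<And>w \<nu>. norm w = r \<Longrightarrow> (\<And>j. w$j \<noteq> 0 \<Longrightarrow> mixed_grad c a b w j = \<nu>) \<Longrightarrow>
       mixed_fun a b f w \<noteq> 0 \<and> Re (\<nu> / mixed_fun a b f w) > 0"
  shows "carries_contact (mixed_fun a b f) r"
proof -
  define s where "s = real a + real b"
  define m where "m = real a - real b"
  have sm: "0 < m" "m \<le> s" "0 < s" using ab by (auto simp: s_def m_def)
  define g where "g = mixed_fun a b f"
  define h where "h w j = mixed_grad c a b w j" for w j
  define U0 where "U0 = {w :: complex^'n. mixed_map a b w \<in> ball 0 \<epsilon>}"
  define Sm where "Sm w = (\<Sum>j\<in>UNIV. h w j * (w$j * cnj (w$j)))" for w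
  \<comment> \<open>A complex-valued formula that agrees with \<open>N\<close> on the sphere of
    radius r and is visibly in the smooth class on all of \<open>U0\<close>.\<close>
  define Nc where "Nc w = of_real (s * m / 2) * ((\<Sum>j\<in>UNIV. h w j * cnj (h w j) * (w$j * cnj (w$j)))
      - Sm w * cnj (Sm w) * of_real (1 / r\<^sup>2))" for w
  define Dn where "Dn w = Nc w + g w * cnj (g w)" for w
  define U where "U = {w\<in>U0. Dn w \<noteq> 0}"
  \<comment> \<open>\<open>kap\<close> is chosen so that \<open>dg\<close> of the Reeb direction vanishes on \<open>g = 0\<close>; adding \<open>|g|\<^sup>2\<close> to the
    denominator keeps it smooth where \<open>dg\<close> vanishes on the contact hyperplane.\<close>
  define kap where "kap w = of_real (- m / r\<^sup>2) * Sm w * inverse (Dn w)" for w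
  have mp: "milnor_point w r s m" if "norm w = r" for w :: "complex^'n"
    using that r sm by (simp add: milnor_point_def)

  \<comment> \<open>Smoothness of the data\<close>
  have sc_g: "smooth_class U' g" if "U' \<subseteq> U0" for U'
    unfolding g_def mixed_fun_def[abs_def]
    by (rule smooth_class.series[OF ps]) (use that in \<open>auto simp: U0_def mixed_map_def intro!: smooth_class_intros\<close>)
  have sc_h: "smooth_class U' (\<lambda>w. h w j)" if "U' \<subseteq> U0" for U' j
  proof -
    have "smooth_class U' (\<lambda>w. series_diff c j (mixed_map a b w))"
      unfolding mixed_map_def[abs_def]
      by (rule smooth_class.series[OF power_series_diff[OF ps]])
        (use that in \<open>auto simp: U0_def mixed_map_def intro!: smooth_class_intros\<close>)
    then show ?thesis unfolding h_def mixed_grad_def by (intro smooth_class_intros)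
  qed
  have sc_Sm: "smooth_class U' Sm" if "U' \<subseteq> U0" for U'
    unfolding Sm_def[abs_def] by (intro smooth_class_intros sc_h that)
  have sc_Nc: "smooth_class U' Nc" if "U' \<subseteq> U0" for U'
    unfolding Nc_def[abs_def] by (intro smooth_class_intros sc_h sc_Sm that)
  have sc_Dn: "smooth_class U' Dn" if "U' \<subseteq> U0" for U'
    unfolding Dn_def[abs_def] by (intro smooth_class_intros sc_g sc_Nc that)
  have UU0: "U \<subseteq> U0" unfolding U_def by auto
  have sc_kap: "smooth_class U kap"
    unfolding kap_def[abs_def] by (intro smooth_class_intros sc_Sm sc_Dn UU0) (auto simp: U_def)
  have openU0: "open U0"
  proof -
    have "continuous_on UNIV (mixed_map a b :: complex^'n \<Rightarrow> complex^'n)"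
      unfolding mixed_map_def[abs_def] by (intro continuous_intros)
    from open_vimage[OF open_ball this] show ?thesis unfolding U0_def vimage_def .
  qed
  have openU: "open U"
  proof -
    have "open (U0 \<inter> Dn -` (- {0}))"
      by (rule continuous_open_preimage[OF smooth_class_continuous_on[OF sc_Dn[OF order_refl]] openU0]) auto
    moreover have "U = U0 \<inter> Dn -` (- {0})" unfolding U_def by auto
    ultimately show ?thesis by simp
  qed

  \<comment> \<open>Values on the sphere\<close>
  let ?N = "\<lambda>w. milnor_point.N w (h w) r s m" and ?hm = "\<lambda>w. milnor_point.hmean w (h w) r"
  have wcw: "w$j * cnj (w$j) = of_real ((cmod (w$j))\<^sup>2)" for w :: "complex^'n" and j
    by (simp only: complex_norm_square)
  have hm_eq: "?hm w = Sm w * of_real (1 / r\<^sup>2)" if "norm w = r" for w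
    unfolding milnor_point.hmean_def[OF mp[OF that]] Sm_def wcw by simp
  have Nc_eq: "Nc w = of_real (?N w)" if w: "norm w = r" for w
  proof -
    have "Nc w = of_real (s * m / 2 * ((\<Sum>j\<in>UNIV. (cmod (h w j))\<^sup>2 * (cmod (w$j))\<^sup>2) - (cmod (Sm w))\<^sup>2 / r\<^sup>2))"
      unfolding Nc_def by (simp only: of_real_mult of_real_diff of_real_divide of_real_sum complex_norm_square) simp
    also have "Sm w = (\<Sum>j\<in>UNIV. h w j * of_real ((cmod (w$j))\<^sup>2))" unfolding Sm_def wcw ..
    finally show ?thesis
      unfolding milnor_point.N_def[OF mp[OF w]] milnor_point.var_eq[OF mp[OF w]] .
  qed
  have N0: "?N w \<ge> 0" if "norm w = r" for w
    using milnor_point.N_nonneg[OF mp[OF that]] .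
  \<comment> \<open>If N = 0, all \<open>h w j\<close> with \<open>w$j \<noteq> 0\<close> equal the
    mean, so \<open>H\<close> applies with \<nu> = hmean.\<close>
  have H': "g w \<noteq> 0 \<and> Re (?hm w / g w) > 0" if w: "norm w = r" "?N w = 0" for w
    unfolding g_def by (rule H[OF w(1)]) (use milnor_point.N_eq_0D[OF mp[OF w(1)] w(2)] in \<open>simp add: h_def\<close>)
  have Npos: "?N w + (cmod (g w))\<^sup>2 > 0" if w: "norm w = r" for w
    using N0[OF w] H'[OF w] by (cases "?N w = 0") (auto simp: add_pos_nonneg)
  have Dn_eq: "Dn w = of_real (?N w + (cmod (g w))\<^sup>2)" if "norm w = r" for w
    unfolding Dn_def Nc_eq[OF that] by (simp only: of_real_add complex_norm_square)
  have SU: "sphere 0 r \<subseteq> U"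
  proof
    fix w :: "complex^'n" assume "w \<in> sphere 0 r"
    then have w: "norm w = r" by simp
    have "Dn w \<noteq> 0" unfolding Dn_eq[OF w] using Npos[OF w] by (simp only: of_real_eq_0_iff)
    then show "w \<in> U" using inb[OF w] by (simp add: U_def U0_def)
  qed
  have SU0: "sphere 0 r \<subseteq> U0" using SU UU0 by blast
  have kap_eq: "kap w = - of_real m * ?hm w / of_real (?N w + (cmod (g w))\<^sup>2)" if w: "norm w = r" for w
    unfolding kap_def hm_eq[OF w] Dn_eq[OF w] by (simp add: divide_inverse)

  \<comment> \<open>The constant C\<close>
  obtain kap' where kap': "\<And>w. w \<in> U \<Longrightarrow> (kap has_derivative kap' w) (at w)" "\<And>v. smooth_class U (\<lambda>w. kap' w v)"
    using smooth_class_has_derivative[OF sc_kap] by blast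
  \<comment> \<open>The derivative of \<open>kap\<close> is never computed; a bound on the compact
    sphere is enough.\<close>
  have "compact ((\<lambda>w. \<Sum>v\<in>Basis. cmod (kap' w v)) ` sphere 0 r)"
    by (intro compact_continuous_image continuous_on_sum continuous_on_norm compact_sphere
        continuous_on_subset[OF smooth_class_continuous_on[OF kap'(2)] SU])
  then have "bounded ((\<lambda>w. \<Sum>v\<in>Basis. cmod (kap' w v)) ` sphere 0 r)" by (rule compact_imp_bounded)
  then obtain Ck where "\<forall>x\<in>(\<lambda>w. \<Sum>v\<in>Basis. cmod (kap' w v)) ` sphere 0 r. norm x \<le> Ck"
    unfolding bounded_iff by blast
  then have Ck: "(\<Sum>v\<in>Basis. cmod (kap' w v)) \<le> Ck" if "norm w = r" for w
    using that by (auto dest!: bspec[where x = w] simp: abs_le_iff)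
  \<comment> \<open>q is the share of hmean and \<open>kap\<close> in Im (dg(Y) / g) / r^2. K
    collects the constants of the error: the bound in \<open>reeb_direction\<close>,
    \<open>norm d \<le> cmod (g w) * Ck\<close>, and the ratio between \<open>sqrt var\<close> and
    \<open>sqrt N\<close>.\<close>
  define q where "q w = m * Re (?hm w * cnj (g w)) / (?N w + (cmod (g w))\<^sup>2)" for w
  define K where "K = 2 * s * Ck * sqrt (2 / (s * m))"
  have cont_N: "continuous_on (sphere 0 r) ?N"
  proof -
    have "continuous_on (sphere 0 r) (\<lambda>w. Re (Nc w))"
      by (intro continuous_intros smooth_class_continuous_on sc_Nc SU0)
    then show ?thesis by (rule continuous_on_eq) (simp add: Nc_eq)
  qed
  have cont_g: "continuous_on (sphere 0 r) g" by (intro smooth_class_continuous_on sc_g SU0)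
  have cont_q: "continuous_on (sphere 0 r) q"
  proof -
    have "continuous_on (sphere 0 r) (\<lambda>w. m * Re (Sm w * of_real (1 / r\<^sup>2) * cnj (g w)) / (?N w + (cmod (g w))\<^sup>2))"
      by (intro continuous_intros cont_N cont_g smooth_class_continuous_on sc_Sm SU0) (use Npos in force)
    then show ?thesis by (rule continuous_on_eq) (simp add: q_def hm_eq)
  qed
  have C: "\<exists>C. \<forall>w. norm w = r \<longrightarrow> 2 * C * ?N w + q w - K * sqrt (?N w) > 0"
  proof -
    have "\<exists>C. \<forall>w\<in>sphere 0 r. 2 * C * ?N w + q w - K * sqrt (?N w) > 0"
    proof (rule compact_dominating_constant[OF compact_sphere cont_N _ cont_q])
      fix w :: "complex^'n" assume "w \<in> sphere 0 r" and N: "?N w = 0"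
      then have w: "norm w = r" by simp
      have gw: "g w \<noteq> 0" "Re (?hm w / g w) > 0" using H'[OF w N] by auto
      have "Re (?hm w * cnj (g w)) = Re (?hm w / g w) * (cmod (g w))\<^sup>2"
      proof -
        have "?hm w * cnj (g w) = ?hm w / g w * of_real ((cmod (g w))\<^sup>2)"
          using gw(1) unfolding complex_norm_square by simp
        then show ?thesis by (simp only: times_complex.sel Re_complex_of_real Im_complex_of_real mult_zero_right diff_zero)
      qed
      then show "q w > 0" unfolding q_def using gw sm N by simp
    qed (use N0 in auto)
    then show ?thesis by (simp add: Ball_def)
  qed
  then obtain C where C: "\<And>w. norm w = r \<Longrightarrow> 2 * C * ?N w + q w - K * sqrt (?N w) > 0" by blast

  \<comment> \<open>The contact form\<close>
  define \<psi> where "\<psi> w = Re (kap w * cnj (g w)) + C * (cmod (g w))\<^sup>2" for w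
  define B where "B w = exp (- \<psi> w) *\<^sub>R ivec w" for w
  have smooth: "smooth_on U B"
  proof (rule smooth_class_smooth_on[OF openU])
    fix j
    have "(\<lambda>w. B w $ j) = (\<lambda>w. exp (- ((kap w * cnj (g w) + cnj (kap w) * g w) * (1/2) + of_real C * (g w * cnj (g w)))) * (\<i> * w$j))"
    proof
      fix w
      have e: "kap w * cnj (g w) + cnj (kap w) * g w = of_real (2 * Re (kap w * cnj (g w)))"
        by (simp add: complex_eq_iff)
      have eq: "complex_of_real (\<psi> w) = (kap w * cnj (g w) + cnj (kap w) * g w) * (1/2) + of_real C * (g w * cnj (g w))"
        unfolding e \<psi>_def complex_norm_square[symmetric] by simp
      show "B w $ j = exp (- ((kap w * cnj (g w) + cnj (kap w) * g w) * (1/2) + of_real C * (g w * cnj (g w)))) * (\<i> * w$j)"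
        unfolding eq[symmetric] of_real_minus[symmetric] exp_of_real B_def ivec_def
          vector_scaleR_component vec_lambda_beta
        by (rule scaleR_conv_of_real)
    qed
    moreover have "smooth_class U (\<lambda>w. exp (- ((kap w * cnj (g w) + cnj (kap w) * g w) * (1/2) + of_real C * (g w * cnj (g w)))) * (\<i> * w$j))"
      by (intro smooth_class_intros sc_kap sc_g UU0)
    ultimately show "smooth_class U (\<lambda>w. B w $ j)" by simp
  qed

  let ?L = "\<lambda>w. milnor_point.L w (h w) s m"
  have dg: "(g has_derivative ?L w) (at w)" if w: "norm w = r" for w
  proof -
    have "?L w = (\<lambda>v. \<Sum>j\<in>UNIV. mixed_grad c a b w j *
     Complex ((real a + real b) * Re (cnj (w$j) * v$j)) ((real a - real b) * Im (cnj (w$j) * v$j)))"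
      unfolding milnor_point.L_def[OF mp[OF w], abs_def] unfolding h_def s_def m_def ..
    then show ?thesis using mixed_fun_has_derivative[OF ps inb[OF w] ab] by (simp add: g_def)
  qed
  have fg: "frechet_derivative g (at w) = ?L w" if "norm w = r" for w
    using frechet_derivative_at[OF dg[OF that]] by simp

  \<comment> \<open>The Reeb direction at a point of the sphere\<close>
  have pt: "\<exists>D Y. contact_point w r s m D Y (exp (- \<psi> w)) \<and>
      (\<forall>u v. dbeta B w u v = exp (- \<psi> w) * (2 * (ivec u \<bullet> v) - D u * (ivec w \<bullet> v) + D v * (ivec w \<bullet> u))) \<and>
      (g w = 0 \<longrightarrow> ?L w Y = 0) \<and> (g w \<noteq> 0 \<longrightarrow> Im (?L w Y / g w) > 0)" if w: "norm w = r" for w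
  proof -
    interpret P: milnor_point w "h w" r s m by (rule mp[OF w])
    have wU: "w \<in> U" using SU w by auto
    \<comment> \<open>d\<psi> is Re (cnj \<mu> dg) plus the remainder Re (cnj g d kap); the term 2 C
      g comes from C |g|^2.\<close>
    define \<mu> where "\<mu> = kap w + of_real (2 * C) * g w"
    define D where "D v = Re (cnj \<mu> * P.L v) + Re (cnj (g w) * kap' w v)" for v
    have linkap: "linear (kap' w)" using kap'(1)[OF wU] by (rule has_derivative_linear)
    have linD: "linear D"
      by (rule linearI) (simp_all add: D_def linear_add[OF P.linear_L] linear_scale[OF P.linear_L]
        linear_add[OF linkap] linear_scale[OF linkap] algebra_simps)
    have D\<psi>: "(\<psi> has_derivative D) (at w)"
    proof -
      have \<psi>: "\<psi> = (\<lambda>w. Re (kap w * cnj (g w) + of_real C * (g w * cnj (g w))))"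
        by (rule ext) (simp add: \<psi>_def complex_norm_square[symmetric] flip: of_real_mult of_real_power)
      have "((\<lambda>w. Re (kap w * cnj (g w) + of_real C * (g w * cnj (g w)))) has_derivative
         (\<lambda>v. Re ((kap w * cnj (P.L v) + kap' w v * cnj (g w)) + of_real C * (g w * cnj (P.L v) + P.L v * cnj (g w))))) (at w)"
        by (intro bounded_linear.has_derivative[OF bounded_linear_Re] has_derivative_add has_derivative_mult
           has_derivative_mult_right bounded_linear.has_derivative[OF bounded_linear_cnj] dg[OF w] kap'(1)[OF wU])
      moreover have "Re ((kap w * cnj (P.L v) + kap' w v * cnj (g w)) + of_real C * (g w * cnj (P.L v) + P.L v * cnj (g w))) = D v" for v
        unfolding D_def \<mu>_def by (simp add: algebra_simps)
      ultimately show ?thesis unfolding \<psi> by simp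
    qed
    have DB: "(B has_derivative (\<lambda>v. exp (- \<psi> w) *\<^sub>R ivec v + (- (exp (- \<psi> w) * D v)) *\<^sub>R ivec w)) (at w)"
    proof -
      have bi: "bounded_linear (ivec :: complex^'n \<Rightarrow> complex^'n)"
        using linear_ivec linear_conv_bounded_linear by blast
      have "((\<lambda>w. exp (- \<psi> w)) has_derivative (\<lambda>v. - (exp (- \<psi> w) * D v))) (at w)"
        by (rule derivative_eq_intros D\<psi> refl)+ (simp add: fun_eq_iff)
      from has_derivative_scaleR[OF this bounded_linear_imp_has_derivative[OF bi]]
      show ?thesis unfolding B_def[abs_def] .
    qed
    have fB: "frechet_derivative B (at w) = (\<lambda>v. exp (- \<psi> w) *\<^sub>R ivec v + (- (exp (- \<psi> w) * D v)) *\<^sub>R ivec w)"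
      using frechet_derivative_at[OF DB] by simp
    have dB: "dbeta B w u v = exp (- \<psi> w) * (2 * (ivec u \<bullet> v) - D u * (ivec w \<bullet> v) + D v * (ivec w \<bullet> u))" for u v
      unfolding dbeta_def fB using inner_ivec_skew[of v u]
      by (simp add: inner_add_left inner_commute[of v "ivec u"] algebra_simps)
    \<comment> \<open>The gradient of the remainder. Its factor cnj g makes it vanish on the binding
      and keeps the error bounded after division by g.\<close>
    define d where "d = (\<Sum>v\<in>Basis. Re (cnj (g w) * kap' w v) *\<^sub>R v)"
    have lin2: "linear (\<lambda>v. Re (cnj (g w) * kap' w v))"
      by (rule linearI) (simp_all add: linear_add[OF linkap] linear_scale[OF linkap] algebra_simps)
    have dv: "Re (cnj (g w) * kap' w v) = d \<bullet> v" for v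
    proof -
      have "Re (cnj (g w) * kap' w v) = Re (cnj (g w) * kap' w (\<Sum>b\<in>Basis. (v \<bullet> b) *\<^sub>R b))"
        by (simp only: euclidean_representation)
      also have "\<dots> = (\<Sum>b\<in>Basis. (v \<bullet> b) *\<^sub>R Re (cnj (g w) * kap' w b))"
        using linear_sum[OF lin2, of "\<lambda>b. (v \<bullet> b) *\<^sub>R b" Basis] linear_scale[OF lin2] by (simp only:)
      also have "\<dots> = d \<bullet> v" unfolding d_def inner_sum_left by (simp add: inner_commute mult.commute)
      finally show ?thesis .
    qed
    have nd: "norm d \<le> cmod (g w) * Ck"
    proof -
      have "norm d \<le> (\<Sum>v\<in>Basis. cmod (g w) * cmod (kap' w v))"
        unfolding d_def
      proof (rule sum_norm_le)
        fix v :: "complex^'n" assume "v \<in> Basis"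
        then have "norm (Re (cnj (g w) * kap' w v) *\<^sub>R v) = \<bar>Re (cnj (g w) * kap' w v)\<bar>" by simp
        also have "\<dots> \<le> cmod (cnj (g w) * kap' w v)" by (rule abs_Re_le_cmod)
        finally show "norm (Re (cnj (g w) * kap' w v) *\<^sub>R v) \<le> cmod (g w) * cmod (kap' w v)" by (simp add: norm_mult)
      qed
      also have "\<dots> \<le> cmod (g w) * Ck" unfolding sum_distrib_left[symmetric] by (intro mult_left_mono Ck w) simp
      finally show ?thesis .
    qed
    obtain Y where Y: "w \<bullet> Y = 0" "ivec w \<bullet> Y = r\<^sup>2" "\<And>v. v \<in> P.\<xi> \<Longrightarrow> 2 * (ivec Y \<bullet> v) = - r\<^sup>2 * D v"
      and LY: "cmod (P.L Y - \<i> * of_real (r\<^sup>2) * (of_real m * P.hmean + \<mu> * of_real P.N)) \<le> r\<^sup>2 * (s * sqrt P.var * (2 * norm d))"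
      using P.reeb_direction[of D \<mu> d] D_def dv by metis
    have cp: "contact_point w r s m D Y (exp (- \<psi> w))"
      by (intro contact_point.intro contact_point_axioms.intro mp[OF w] linD) (use Y in auto)
    define \<Delta> where "\<Delta> = P.N + (cmod (g w))\<^sup>2"
    have \<Delta>: "\<Delta> > 0" using Npos[OF w] by (simp add: \<Delta>_def)
    \<comment> \<open>By the choice of \<open>kap\<close>, m hmean + \<open>kap\<close> N = m hmean
      |g|^2 / \<Delta>, so the leading part of \<open>L Y\<close> is divisible by g.\<close>
    have main: "of_real m * P.hmean + \<mu> * of_real P.N =
        g w * (of_real m * P.hmean * cnj (g w) / of_real \<Delta> + of_real (2 * C * P.N))"
    proof -
      have k: "kap w = - of_real m * P.hmean / of_real \<Delta>" using kap_eq[OF w] by (simp add: \<Delta>_def)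
      have "of_real m * P.hmean + kap w * of_real P.N = of_real m * P.hmean * (of_real (\<Delta> - P.N)) / of_real \<Delta>"
        unfolding k using \<Delta> by (simp add: field_simps)
      also have "complex_of_real (\<Delta> - P.N) = g w * cnj (g w)"
        unfolding \<Delta>_def complex_norm_square[symmetric] by simp
      finally show ?thesis unfolding \<mu>_def by (simp add: algebra_simps)
    qed
    have "P.L Y = 0" if "g w = 0"
    proof -
      have "d = 0" using nd that by simp
      then show ?thesis using LY main that by simp
    qed
    moreover have "Im (P.L Y / g w) > 0" if gw: "g w \<noteq> 0"
    proof -
      define T where "T = of_real m * P.hmean * cnj (g w) / of_real \<Delta> + of_real (2 * C * P.N)"
      define X where "X = P.L Y - \<i> * of_real (r\<^sup>2) * (g w * T)"
      have X: "cmod X \<le> r\<^sup>2 * (s * sqrt P.var * (2 * norm d))"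
        using LY unfolding main X_def T_def .
      have "P.L Y / g w = \<i> * of_real (r\<^sup>2) * T + X / g w"
        unfolding X_def using gw by (simp add: field_simps)
      then have I: "Im (P.L Y / g w) = r\<^sup>2 * Re T + Im (X / g w)"
        by (simp only: plus_complex.sel) simp
      have ReT: "Re T = q w + 2 * C * P.N"
      proof -
        have "of_real m * P.hmean * cnj (g w) / of_real \<Delta> = of_real (m / \<Delta>) * (P.hmean * cnj (g w))" by simp
        then show ?thesis unfolding T_def q_def \<Delta>_def[symmetric]
          by (simp only: plus_complex.sel Re_complex_of_real times_complex.sel(1)[of "of_real _"] Im_complex_of_real) simp
      qed
      have sv: "sqrt P.var = sqrt (2 / (s * m)) * sqrt P.N"
        unfolding P.N_def real_sqrt_mult[symmetric] using sm by simp
      have "\<bar>Im (X / g w)\<bar> \<le> cmod X / cmod (g w)" using abs_Im_le_cmod[of "X / g w"] by (simp add: norm_divide)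
      also have "\<dots> \<le> r\<^sup>2 * (s * sqrt P.var * (2 * (cmod (g w) * Ck))) / cmod (g w)"
      proof (intro divide_right_mono order_trans[OF X] mult_left_mono)
        show "norm d \<le> cmod (g w) * Ck" by (rule nd)
      qed (use sm P.var_nonneg in auto)
      also have "\<dots> = r\<^sup>2 * (K * sqrt P.N)" unfolding sv K_def using gw by simp
      finally have "Im (P.L Y / g w) \<ge> r\<^sup>2 * (q w + 2 * C * P.N) - r\<^sup>2 * (K * sqrt P.N)"
        unfolding I ReT by linarith
      moreover have "r\<^sup>2 * (q w + 2 * C * P.N) - r\<^sup>2 * (K * sqrt P.N) = r\<^sup>2 * (2 * C * P.N + q w - K * sqrt P.N)"
        by (simp add: algebra_simps)
      moreover have "\<dots> > 0" using C[OF w] r by simp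
      ultimately show ?thesis by linarith
    qed
    ultimately show ?thesis using cp dB by blast
  qed

  \<comment> \<open>The open book conditions at a point\<close>
  have point: "(g w = 0 \<longrightarrow> frechet_derivative g (at w) ` TS w = UNIV \<and> contact_at (TK g w) (CARD('n) - 2) B w \<and>
       (\<forall>u x e. u \<in> TS w \<and> x \<in> TS w \<and> frechet_derivative g (at w) x = 1 \<and> frechet_derivative g (at w) u = \<i> \<and>
          (\<forall>i. e i \<in> TK g w) \<longrightarrow>
          wedge (CARD('n) - 1) B w (\<lambda>i. if i = 0 then u else if i = 1 then - x else e (i - 2)) * wedge (CARD('n) - 2) B w e \<ge> 0)) \<and>
      (g w \<noteq> 0 \<longrightarrow> (\<exists>v\<in>TS w. dtheta g w v \<noteq> 0) \<and>
        (\<forall>u\<in>TP g w. (\<forall>v\<in>TP g w. dbeta B w u v = 0) \<longrightarrow> u = 0) \<and>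
        (\<forall>R. R \<in> TS w \<and> beta B w R = 1 \<and> (\<forall>v\<in>TS w. dbeta B w R v = 0) \<longrightarrow> dtheta g w R > 0)) \<and>
      contact_at (TS w) (CARD('n) - 1) B w" if w: "norm w = r" for w
  proof -
    obtain D Y where cp: "contact_point w r s m D Y (exp (- \<psi> w))"
      and dB: "\<And>u v. dbeta B w u v = exp (- \<psi> w) * (2 * (ivec u \<bullet> v) - D u * (ivec w \<bullet> v) + D v * (ivec w \<bullet> u))"
      and LY: "g w = 0 \<Longrightarrow> ?L w Y = 0" "g w \<noteq> 0 \<Longrightarrow> Im (?L w Y / g w) > 0"
      using pt[OF w] by blast
    interpret Q: contact_point w "h w" r s m D Y "exp (- \<psi> w)" by (rule cp)
    have Om: "dbeta B w = Q.Om" by (intro ext) (simp add: dB Q.Om_def)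
    have bt: "beta B w = Q.bt" by (intro ext) (simp add: beta_def B_def Q.bt_def)
    have TK: "TK g w = Q.TKL" unfolding TK_def Q.TKL_def fg[OF w] ..
    have contactS: "contact_at (TS w) (CARD('n) - 1) B w"
      unfolding contact_at_def wedge_eq_wdg Om bt by (rule Q.contact_sphere)
    have K: "frechet_derivative g (at w) ` TS w = UNIV \<and> contact_at (TK g w) (CARD('n) - 2) B w \<and>
       (\<forall>u x e. u \<in> TS w \<and> x \<in> TS w \<and> frechet_derivative g (at w) x = 1 \<and> frechet_derivative g (at w) u = \<i> \<and>
          (\<forall>i. e i \<in> TK g w) \<longrightarrow>
          wedge (CARD('n) - 1) B w (\<lambda>i. if i = 0 then u else if i = 1 then - x else e (i - 2)) * wedge (CARD('n) - 2) B w e \<ge> 0)"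
      if gw: "g w = 0"
    proof (intro conjI allI impI)
      \<comment> \<open>N + |g|^2 is positive by the condition, so N itself is positive on the
        binding; this is its regularity.\<close>
      have Np: "Q.N > 0" using Npos[OF w] gw by simp
      show "frechet_derivative g (at w) ` TS w = UNIV"
        unfolding fg[OF w] using Q.L_surjective[OF Np] Q.\<xi>_TS by (metis UNIV_eq_I image_eqI)
      show "contact_at (TK g w) (CARD('n) - 2) B w"
        unfolding contact_at_def wedge_eq_wdg Om bt TK by (rule Q.contact_binding[OF n LY(1)[OF gw]])
      fix u x and e :: "nat \<Rightarrow> complex^'n"
      assume "u \<in> TS w \<and> x \<in> TS w \<and> frechet_derivative g (at w) x = 1 \<and> frechet_derivative g (at w) u = \<i> \<and> (\<forall>i. e i \<in> TK g w)"
      then show "0 \<le> wedge (CARD('n) - 1) B w (\<lambda>i. if i = 0 then u else if i = 1 then - x else e (i - 2)) * wedge (CARD('n) - 2) B w e"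
        unfolding wedge_eq_wdg Om bt TK fg[OF w]
        by (intro Q.binding_orientation[OF n LY(1)[OF gw] Np]) auto
    qed
    have page: "(\<exists>v\<in>TS w. dtheta g w v \<noteq> 0) \<and>
        (\<forall>u\<in>TP g w. (\<forall>v\<in>TP g w. dbeta B w u v = 0) \<longrightarrow> u = 0) \<and>
        (\<forall>R. R \<in> TS w \<and> beta B w R = 1 \<and> (\<forall>v\<in>TS w. dbeta B w R v = 0) \<longrightarrow> dtheta g w R > 0)"
      if gw: "g w \<noteq> 0"
    proof -
      define \<theta> where "\<theta> v = dtheta g w v" for v
      have \<theta>: "\<theta> v = Im (Q.L v / g w)" for v unfolding \<theta>_def dtheta_def fg[OF w] ..
      have lin: "linear \<theta>"
      proof (rule linearI)
        have \<theta>': "\<theta> v = Im (inverse (g w) * Q.L v)" for v unfolding \<theta> by (simp add: divide_inverse mult.commute)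
        show "\<theta> (x + y) = \<theta> x + \<theta> y" for x y
          unfolding \<theta>' linear_add[OF Q.linear_L] distrib_left by simp
        show "\<theta> (t *\<^sub>R x) = t *\<^sub>R \<theta> x" for t x
          unfolding \<theta>' linear_scale[OF Q.linear_L] mult_scaleR_right by simp
      qed
      have pos: "\<theta> Y > 0" using LY(2)[OF gw] \<theta> by simp
      have TP: "TP g w = {v. v \<in> TS w \<and> \<theta> v = 0}" unfolding TP_def TS_def \<theta>_def by simp
      \<comment> \<open>Transversality of the Reeb direction already shows that the angle map is a
        submersion.\<close>
      have "\<exists>v\<in>TS w. \<theta> v \<noteq> 0" using pos Q.Y_TS by (intro bexI[of _ Y]) auto
      moreover have "u = 0" if "u \<in> TP g w" "\<forall>v\<in>TP g w. Q.Om u v = 0" for u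
        using Q.page_symplectic[OF lin, of u] pos that unfolding TP by auto
      moreover have "\<theta> R > 0" if "R \<in> TS w" "Q.bt R = 1" "\<forall>v\<in>TS w. Q.Om R v = 0" for R
        using Q.reeb_positive[OF lin pos, of R] that by blast
      ultimately show ?thesis unfolding Om bt \<theta>_def[symmetric] by blast
    qed
    show ?thesis using contactS K page by blast
  qed
  have dif: "g differentiable (at w)" if "norm w = r" for w
    using dg[OF that] unfolding differentiable_def by blast
  note pK = point[THEN conjunct1, THEN HOL.mp] and pS = point[THEN conjunct2, THEN conjunct1, THEN HOL.mp]
  show ?thesis
    unfolding carries_contact_def Let_def g_def[symmetric]
  proof (intro conjI exI[of _ B] exI[of _ U] openU SU smooth)
    show "\<forall>x\<in>sphere 0 r. g differentiable (at x)" using dif by simp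
    show "\<forall>x\<in>{x \<in> sphere 0 r. g x = 0}. frechet_derivative g (at x) ` TS x = UNIV"
      by (rule ballI, rule pK[THEN conjunct1]) auto
    show "\<forall>x\<in>sphere 0 r - {x \<in> sphere 0 r. g x = 0}. \<exists>v\<in>TS x. dtheta g x v \<noteq> 0"
      by (rule ballI, rule pS[THEN conjunct1]) auto
    show "\<forall>x\<in>sphere 0 r. contact_at (TS x) (CARD('n) - 1) B x"
      using point by simp
    show "\<forall>x\<in>{x \<in> sphere 0 r. g x = 0}. contact_at (TK g x) (CARD('n) - 2) B x"
      by (rule ballI, rule pK[THEN conjunct2, THEN conjunct1]) auto
    show "\<forall>x\<in>sphere 0 r - {x \<in> sphere 0 r. g x = 0}. \<forall>u\<in>TP g x. (\<forall>v\<in>TP g x. dbeta B x u v = 0) \<longrightarrow> u = 0"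
      by (rule ballI, rule pS[THEN conjunct2, THEN conjunct1]) auto
    show "\<forall>x\<in>sphere 0 r - {x \<in> sphere 0 r. g x = 0}. \<forall>R. R \<in> TS x \<and> beta B x R = 1 \<and> (\<forall>v\<in>TS x. dbeta B x R v = 0) \<longrightarrow> 0 < dtheta g x R"
      by (rule ballI, rule pS[THEN conjunct2, THEN conjunct2]) auto
    show "\<forall>x\<in>{x \<in> sphere 0 r. g x = 0}. \<forall>u w e. u \<in> TS x \<and> w \<in> TS x \<and> frechet_derivative g (at x) w = 1 \<and>
        frechet_derivative g (at x) u = \<i> \<and> (\<forall>i. e i \<in> TK g x) \<longrightarrow>
        0 \<le> wedge (CARD('n) - 1) B x (\<lambda>i. if i = 0 then u else if i = 1 then - w else e (i - 2)) * wedge (CARD('n) - 2) B x e"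
      by (rule ballI, rule pK[THEN conjunct2, THEN conjunct2]) auto
  qed
qed

section \<open>Newton faces and asymptotics near the origin\<close>

lemma finite_range_subseq:
  fixes F :: "nat \<Rightarrow> 'a"
  assumes "finite (range F)"
  shows "\<exists>(r :: nat \<Rightarrow> nat) y. strict_mono r \<and> (\<forall>k. F (r k) = y)"
proof -
  obtain k0 where "infinite {k. F k = F k0}"
    using pigeonhole_infinite[OF infinite_UNIV_nat assms] by auto
  then obtain r :: "nat \<Rightarrow> nat" where r: "strict_mono r" "\<And>k. r k \<in> {k. F k = F k0}"
    using infinite_enumerate by blast
  then show ?thesis by blast
qed

lemma finite_family_convergent_subseq:
  fixes X :: "'i \<Rightarrow> nat \<Rightarrow> 'a::heine_borel"
  assumes "finite A" "\<And>i. i \<in> A \<Longrightarrow> bounded (range (X i))"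
  shows "\<exists>r::nat \<Rightarrow> nat. strict_mono r \<and> (\<forall>i\<in>A. convergent (X i \<circ> r))"
  using assms
proof (induction A)
  case empty
  show ?case using strict_mono_id by blast
next
  case (insert a A)
  then obtain r where r: "strict_mono r" "\<And>i. i \<in> A \<Longrightarrow> convergent (X i \<circ> r)"
    by (metis insertCI)
  have "bounded (range (X a \<circ> r))"
    using insert.prems[OF insertI1] bounded_subset[of "range (X a)" "range (X a \<circ> r)"] by auto
  then obtain l r' where r': "strict_mono r'" "((X a \<circ> r) \<circ> r') \<longlonglongrightarrow> l"
    using bounded_imp_convergent_subsequence by blast
  have "convergent (X i \<circ> (r \<circ> r'))" if "i \<in> insert a A" for i
    using that r' convergent_subseq_convergent[OF r(2) r'(1), of i]
    by (auto simp: o_assoc convergent_def)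
  then show ?case using strict_mono_o[OF r(1) r'(1)] by blast
qed

text \<open>Simultaneous Dirichlet approximation of y by p / q with error below 1 / (qN), N
  exceeding the sum of the \<open>m j\<close>. Then every functional g in the box changes by less
  than 1: integrality preserves the value 0, and values from 2 on stay positive because q \<ge> 1.
  Thus a real weight can be made integral without changing its face.\<close>

lemma integer_weights:
  fixes y :: "real^'n::finite" and m :: "'n \<Rightarrow> nat"
  shows "\<exists>p :: 'n \<Rightarrow> int. (\<forall>j. y$j \<ge> 2 \<longrightarrow> p j > 0) \<and>
    (\<forall>g :: 'n \<Rightarrow> int. (\<forall>j. \<bar>g j\<bar> \<le> int (m j)) \<longrightarrow>
      ((\<Sum>j\<in>UNIV. g j * y$j) = 0 \<longrightarrow> (\<Sum>j\<in>UNIV. g j * p j) = 0) \<and>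
      ((\<Sum>j\<in>UNIV. g j * y$j) \<ge> 2 \<longrightarrow> (\<Sum>j\<in>UNIV. g j * p j) > 0))"
proof -
  define N where "N = (\<Sum>j\<in>UNIV. m j) + 1"
  obtain h :: "'n \<Rightarrow> nat" where h: "bij_betw h UNIV {0..<CARD('n)}"
    using ex_bij_betw_finite_nat[of "UNIV :: 'n set"] by auto
  define hi where "hi = inv_into UNIV h"
  have hi: "hi (h j) = j" for j
    using h unfolding hi_def bij_betw_def by (simp add: inv_into_f_f)
  have hlt: "h j < CARD('n)" for j using h unfolding bij_betw_def by auto
  obtain q p' where q: "0 < q" and p': "\<And>i. i < CARD('n) \<Longrightarrow> \<bar>of_int q * y$(hi i) - of_int (p' i)\<bar> < 1 / N"
  proof (rule Dirichlet_approx_simult[where N = N and n = "CARD('n)" and \<theta> = "\<lambda>i. y$(hi i)"])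
    show "0 < N" by (simp add: N_def)
  qed blast
  define p where "p j = p' (h j)" for j
  have p: "\<bar>of_int q * y$j - of_int (p j)\<bar> < 1 / N" for j
    using p'[OF hlt, of j] by (simp add: p_def hi)
  have N1: "1 / real N \<le> 1" unfolding N_def by (subst divide_le_eq_1_pos) linarith+
  have err: "\<bar>of_int q * (\<Sum>j\<in>UNIV. g j * y$j) - real_of_int (\<Sum>j\<in>UNIV. g j * p j)\<bar> < 1"
    if g: "\<And>j. \<bar>g j\<bar> \<le> int (m j)" for g :: "'n \<Rightarrow> int"
  proof -
    have "of_int q * (\<Sum>j\<in>UNIV. g j * y$j) - real_of_int (\<Sum>j\<in>UNIV. g j * p j)
       = (\<Sum>j\<in>UNIV. g j * (of_int q * y$j - of_int (p j)))"
      by (simp add: sum_distrib_left sum_subtractf algebra_simps)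
    also have "\<bar>\<dots>\<bar> \<le> (\<Sum>j\<in>UNIV. real (m j) * (1 / N))"
    proof (rule order_trans[OF sum_abs], rule sum_mono)
      fix j
      have "real_of_int \<bar>g j\<bar> \<le> real_of_int (int (m j))" using g[of j] by (simp only: of_int_le_iff)
      then have "\<bar>real_of_int (g j)\<bar> \<le> real (m j)" by simp
      then show "\<bar>g j * (of_int q * y$j - of_int (p j))\<bar> \<le> real (m j) * (1 / N)"
        unfolding abs_mult using p[of j] by (intro mult_mono) auto
    qed
    also have "\<dots> = real (\<Sum>j\<in>UNIV. m j) / N" by (simp add: sum_divide_distrib)
    also have "\<dots> < 1" unfolding N_def by (subst divide_less_eq_1_pos) linarith+
    finally show ?thesis .
  qed
  show ?thesis
  proof (intro exI[of _ p] conjI allI impI)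
    fix j assume y: "y$j \<ge> 2"
    have "real_of_int q * y$j \<ge> 1 * 2" using q y by (intro mult_mono) auto
    then have "real_of_int (p j) > 0" using p[of j] N1 by linarith
    then show "p j > 0" by simp
  next
    fix g :: "'n \<Rightarrow> int" assume "\<forall>j. \<bar>g j\<bar> \<le> int (m j)" and "(\<Sum>j\<in>UNIV. g j * y$j) = 0"
    then have "\<bar>real_of_int (\<Sum>j\<in>UNIV. g j * p j)\<bar> < 1" using err[of g] by simp
    then show "(\<Sum>j\<in>UNIV. g j * p j) = 0" by linarith
  next
    fix g :: "'n \<Rightarrow> int" assume g: "\<forall>j. \<bar>g j\<bar> \<le> int (m j)" and ge: "(\<Sum>j\<in>UNIV. g j * y$j) \<ge> 2"
    have "real_of_int q * (\<Sum>j\<in>UNIV. g j * y$j) \<ge> 1 * 2" using q ge by (intro mult_mono) auto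
    then have "real_of_int (\<Sum>j\<in>UNIV. g j * p j) > 0" using err[of g] g by force
    then show "(\<Sum>j\<in>UNIV. g j * p j) > 0" by (simp only: of_int_0_less_iff)
  qed
qed

text \<open>Decompose along span G and its orthogonal complement. The map T is injective on span G,
  hence bounded below there, and it sees only the pairings with G.\<close>

lemma orthogonal_splitting_bounded:
  fixes x :: "nat \<Rightarrow> 'a::euclidean_space"
  assumes "finite G" and bnd: "\<And>g. g \<in> G \<Longrightarrow> bounded (range (\<lambda>k. x k \<bullet> g))"
  shows "\<exists>y q. (\<forall>k. x k = y k + q k) \<and> (\<forall>k. \<forall>g\<in>G. y k \<bullet> g = 0) \<and> bounded (range q)"
proof -
  have "\<exists>q y. q \<in> span G \<and> (\<forall>g\<in>G. y \<bullet> g = 0) \<and> x k = y + q" for k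
    using orthogonal_subspace_decomp_exists[of G "x k"] unfolding orthogonal_def
    by (metis add.commute span_base)
  then obtain q y where q: "\<And>k. q k \<in> span G" and y: "\<And>k g. g \<in> G \<Longrightarrow> y k \<bullet> g = 0"
      and x: "\<And>k. x k = y k + q k"
    by metis
  define T where "T v = (\<Sum>g\<in>G. (v \<bullet> g) *\<^sub>R g)" for v
  have lin: "bounded_linear T" unfolding T_def
    by (intro bounded_linear_sum bounded_linear_scaleR_left[THEN bounded_linear_compose] bounded_linear_inner_left)
  have inj: "v = 0" if v: "v \<in> span G" "T v = 0" for v
  proof -
    have "(\<Sum>g\<in>G. (v \<bullet> g)\<^sup>2) = T v \<bullet> v"
      by (simp add: T_def inner_sum_left power2_eq_square inner_commute[of v])
    then have "\<forall>g\<in>G. v \<bullet> g = 0"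
      using v assms(1) by (simp add: sum_nonneg_eq_0_iff)
    then have "orthogonal v g" if "g \<in> G" for g using that by (simp add: orthogonal_def)
    then have "orthogonal v v" using orthogonal_to_span[OF v(1)] by blast
    then show ?thesis by (simp add: orthogonal_def)
  qed
  obtain e where e: "e > 0" "\<And>v. v \<in> span G \<Longrightarrow> norm (T v) \<ge> e * norm v"
    using injective_imp_isometric[of "span G" T] lin inj closed_subspace[OF subspace_span] by blast
  have "\<exists>C. \<forall>k. \<bar>x k \<bullet> g\<bar> \<le> C" if "g \<in> G" for g
    using bnd[OF that] unfolding bounded_iff by auto
  then obtain C where C: "\<And>g k. g \<in> G \<Longrightarrow> \<bar>x k \<bullet> g\<bar> \<le> C g" by metis
  have "norm (q k) \<le> (\<Sum>g\<in>G. C g * norm g) / e" for k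
  proof -
    have "T (q k) = (\<Sum>g\<in>G. (x k \<bullet> g) *\<^sub>R g)"
      unfolding T_def by (intro sum.cong refl) (simp add: x inner_add_left y)
    then have "norm (T (q k)) \<le> (\<Sum>g\<in>G. C g * norm g)"
      using C by (auto intro!: sum_norm_le mult_right_mono)
    then show ?thesis using e(1) e(2)[OF q, of k] by (simp add: field_simps)
  qed
  then have "bounded (range q)" unfolding bounded_iff by auto
  then show ?thesis using x y by blast
qed

lemma finite_exponent_box: "finite {\<alpha> :: 'n::finite \<Rightarrow> nat. \<forall>j. \<alpha> j \<le> m j}"
proof -
  have "{\<alpha> :: 'n \<Rightarrow> nat. \<forall>j. \<alpha> j \<le> m j} \<subseteq> PiE UNIV (\<lambda>j. {..m j})" by auto
  then show ?thesis by (rule finite_subset) (intro finite_PiE; simp)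
qed

text \<open>A monomial outside the box \<open>\<alpha> \<le> m\<close> is \<open>O(\<bar>z\<bar>)\<close> times some \<open>z\<^sub>j\<^bsup>m j\<^esup>\<close>.\<close>
lemma power_series_tail:
  fixes b :: "('n::finite \<Rightarrow> nat) \<Rightarrow> complex" and m :: "'n \<Rightarrow> nat"
  assumes \<epsilon>: "\<epsilon> > 0" and ps: "\<And>z. z \<in> ball 0 \<epsilon> \<Longrightarrow> ((\<lambda>\<alpha>. b \<alpha> * monom \<alpha> z) has_sum F z) UNIV"
  shows "\<exists>C d. d > 0 \<and> (\<forall>z. norm z < d \<longrightarrow>
     norm (F z - (\<Sum>\<alpha>\<in>{\<alpha>. \<forall>j. \<alpha> j \<le> m j}. b \<alpha> * monom \<alpha> z)) \<le> C * norm z * (\<Sum>j\<in>UNIV. norm (z$j) ^ m j))"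
proof -
  \<comment> \<open>Chosen so that the point with all coordinates d has norm at most \<epsilon> / 2
    and the series converges absolutely there.\<close>
  define d where "d = \<epsilon> / (2 * real CARD('n))"
  have d: "d > 0" using \<epsilon> by (simp add: d_def)
  have d\<epsilon>: "d < \<epsilon>"
  proof -
    have "1 * 1 < 2 * real CARD('n)"
      using zero_less_card_finite[where 'a='n] by linarith
    then show ?thesis using \<epsilon> unfolding d_def by (simp add: divide_less_eq)
  qed
  define y :: "complex^'n" where "y = (\<chi> j. of_real d)"
  have "norm y \<le> (\<Sum>j\<in>(UNIV::'n set). norm (y$j))" 
    unfolding norm_vec_def by (rule L2_set_le_sum) simp
  also have "\<dots> = \<epsilon> / 2" using d by (simp add: y_def) (simp add: d_def)
  finally have y: "y \<in> ball 0 \<epsilon>" using \<epsilon> by simp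
  define Box where "Box = {\<alpha> :: 'n \<Rightarrow> nat. \<forall>j. \<alpha> j \<le> m j}"
  have finB: "finite Box" unfolding Box_def by (rule finite_exponent_box)
  define D where "D = (\<Sum>j\<in>UNIV. 1 / d ^ (m j + 1))"
  have D0: "0 \<le> D" unfolding D_def using d by (auto intro: sum_nonneg)
  have abs_sum: "(\<lambda>\<alpha>. norm (b \<alpha> * monom \<alpha> y)) summable_on UNIV"
    using has_sum_imp_summable[OF ps[OF y]] by (subst (asm) summable_on_iff_abs_summable_on_complex)
  define S where "S = (\<Sum>\<^sub>\<infinity>\<alpha>\<in>-Box. norm (b \<alpha> * monom \<alpha> y))"
  have mono: "norm (monom \<alpha> z) \<le> (D * norm z * (\<Sum>j\<in>UNIV. norm (z$j) ^ m j)) * norm (monom \<alpha> y)"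
    if z: "norm z < d" and \<alpha>: "\<alpha> \<notin> Box" for z \<alpha>
  proof -
    obtain j where j: "\<alpha> j > m j" using \<alpha> unfolding Box_def by (auto simp: not_le)
    define k where "k = \<alpha> j - m j - 1"
    have \<alpha>j: "\<alpha> j = m j + (k + 1)" using j by (simp add: k_def)
    have zi: "norm (z$i) \<le> norm z" for i by (rule Finite_Cartesian_Product.norm_nth_le)
    have zd: "norm (z$i) \<le> d" for i using zi[of i] z by linarith
    have "norm (monom \<alpha> z) = norm (z$j) ^ \<alpha> j * (\<Prod>i\<in>UNIV - {j}. norm (z$i) ^ \<alpha> i)"
      unfolding norm_monom by (rule prod.remove) auto
    also have "\<dots> \<le> (norm (z$j) ^ m j * (norm z * d ^ k)) * (\<Prod>i\<in>UNIV - {j}. d ^ \<alpha> i)"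
    proof (rule mult_mono)
      have "norm (z$j) ^ k \<le> d ^ k" by (intro power_mono zd) simp
      then have "norm (z$j) ^ (k + 1) \<le> norm z * d ^ k"
        using zi[of j] by (simp add: mult_mono)
      then show "norm (z$j) ^ \<alpha> j \<le> norm (z$j) ^ m j * (norm z * d ^ k)"
        unfolding \<alpha>j power_add[of _ "m j"] by (intro mult_left_mono) auto
      show "(\<Prod>i\<in>UNIV - {j}. norm (z$i) ^ \<alpha> i) \<le> (\<Prod>i\<in>UNIV - {j}. d ^ \<alpha> i)"
        by (intro prod_mono conjI power_mono zd) auto
    qed (use d in \<open>auto intro!: prod_nonneg\<close>)
    also have "\<dots> = norm (z$j) ^ m j * norm z * (1 / d ^ (m j + 1)) * (d ^ \<alpha> j * (\<Prod>i\<in>UNIV - {j}. d ^ \<alpha> i))"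
      unfolding \<alpha>j using d by (simp add: power_add field_simps)
    also have "d ^ \<alpha> j * (\<Prod>i\<in>UNIV - {j}. d ^ \<alpha> i) = norm (monom \<alpha> y)"
      unfolding norm_monom y_def using d by (simp add: prod.remove[of UNIV j])
    also have "norm (z$j) ^ m j * norm z * (1 / d ^ (m j + 1)) * norm (monom \<alpha> y)
        \<le> (\<Sum>j\<in>UNIV. norm (z$j) ^ m j) * norm z * D * norm (monom \<alpha> y)"
    proof (intro mult_mono)
      show "norm (z$j) ^ m j \<le> (\<Sum>j\<in>UNIV. norm (z$j) ^ m j)"
        by (rule member_le_sum) auto
      show "1 / d ^ (m j + 1) \<le> D" unfolding D_def
        by (rule member_le_sum) (use d in auto)
    qed (use d D0 in \<open>auto intro!: sum_nonneg mult_nonneg_nonneg\<close>)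
    finally show ?thesis by (simp add: mult_ac)
  qed
  have "norm (F z - (\<Sum>\<alpha>\<in>Box. b \<alpha> * monom \<alpha> z)) \<le> (D * S) * norm z * (\<Sum>j\<in>UNIV. norm (z$j) ^ m j)"
    if z: "norm z < d" for z
  proof -
    let ?K = "D * norm z * (\<Sum>j\<in>UNIV. norm (z$j) ^ m j)"
    have zb: "z \<in> ball 0 \<epsilon>" using z d\<epsilon> by simp
    have "((\<lambda>\<alpha>. b \<alpha> * monom \<alpha> z) has_sum (F z - (\<Sum>\<alpha>\<in>Box. b \<alpha> * monom \<alpha> z))) (UNIV - Box)"
      by (intro has_sum_Diff ps zb has_sum_finite finB) auto
    then have hs: "((\<lambda>\<alpha>. b \<alpha> * monom \<alpha> z) has_sum (F z - (\<Sum>\<alpha>\<in>Box. b \<alpha> * monom \<alpha> z))) (- Box)"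
      by (simp add: Compl_eq_Diff_UNIV)
    have sB: "(\<lambda>\<alpha>. ?K * norm (b \<alpha> * monom \<alpha> y)) summable_on (- Box)"
      by (intro summable_on_cmult_right summable_on_subset_banach[OF abs_sum]) auto
    have "norm (F z - (\<Sum>\<alpha>\<in>Box. b \<alpha> * monom \<alpha> z)) = norm (\<Sum>\<^sub>\<infinity>\<alpha>\<in>-Box. b \<alpha> * monom \<alpha> z)"
      using infsumI[OF hs] by simp
    also have "\<dots> \<le> (\<Sum>\<^sub>\<infinity>\<alpha>\<in>-Box. ?K * norm (b \<alpha> * monom \<alpha> y))"
    proof (rule norm_infsum_le[OF has_sum_infsum has_sum_infsum])
      show "(\<lambda>\<alpha>. b \<alpha> * monom \<alpha> z) summable_on (- Box)" using hs has_sum_imp_summable by blast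
      show "(\<lambda>\<alpha>. ?K * norm (b \<alpha> * monom \<alpha> y)) summable_on (- Box)" by (rule sB)
      fix \<alpha> assume "\<alpha> \<in> - Box"
      then have "norm (b \<alpha>) * norm (monom \<alpha> z) \<le> norm (b \<alpha>) * (?K * norm (monom \<alpha> y))"
        using mono[OF z] by (intro mult_left_mono) auto
      then show "norm (b \<alpha> * monom \<alpha> z) \<le> ?K * norm (b \<alpha> * monom \<alpha> y)"
        by (simp add: norm_mult mult_ac)
    qed
    also have "\<dots> = ?K * S" unfolding S_def by (rule infsum_cmult_right')
    finally show ?thesis by (simp add: mult_ac)
  qed
  then show ?thesis using d unfolding Box_def by blast
qed

text \<open>This replaces the curve selection lemma: a sequence tending to \<open>0\<close> inside the torus
  \<open>{z. z\<^sub>j \<noteq> 0 \<longleftrightarrow> j \<in> I}\<close> is, after passing to a subsequence, a convergent sequence \<open>u k\<close>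
  acted on by one-parameter weights \<open>y k\<close>, and the monomials not negligible along it are those of one
  face \<open>\<Delta>\<close> of the Newton polyhedron, cut out by a positive integer weight \<open>P\<close>.\<close>
lemma newton_face_asymptotics:
  fixes c :: "('n::finite \<Rightarrow> nat) \<Rightarrow> complex" and z :: "nat \<Rightarrow> complex^'n" and m :: "'n \<Rightarrow> nat"
  assumes c0: "c (\<lambda>_. 0) = 0"
    and m: "\<And>j. m j > 0" "\<And>j. c (\<lambda>i. if i = j then m j else 0) \<noteq> 0"
    and z0: "z \<longlonglongrightarrow> 0" and znz: "\<And>k. z k \<noteq> 0"
  shows "\<exists>(r :: nat \<Rightarrow> nat) (P :: 'n \<Rightarrow> nat) \<Delta> Y u. strict_mono r \<and> (\<forall>j. P j > 0) \<and>
    \<Delta> = {\<alpha>. c \<alpha> \<noteq> 0 \<and> wdeg P \<alpha> = min_deg c P} \<and> finite \<Delta> \<and> min_deg c P > 0 \<and> (\<forall>j. u$j \<noteq> 0) \<and>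
    (\<forall>b F C d. (\<forall>\<alpha>. c \<alpha> = 0 \<longrightarrow> b \<alpha> = 0) \<longrightarrow> d > 0 \<longrightarrow>
       (\<forall>z. norm z < d \<longrightarrow> norm (F z - (\<Sum>\<alpha>\<in>{\<alpha>. \<forall>j. \<alpha> j \<le> m j}. b \<alpha> * monom \<alpha> z))
           \<le> C * norm z * (\<Sum>j\<in>UNIV. norm (z$j) ^ m j)) \<longrightarrow>
       (\<lambda>k. of_real (exp (Y k)) * F (z (r k))) \<longlonglongrightarrow> (\<Sum>\<alpha>\<in>\<Delta>. b \<alpha> * monom \<alpha> u))"
proof -

  \<comment> \<open>A dominant monomial along a subsequence\<close>
  define Box where "Box = {\<alpha> :: 'n \<Rightarrow> nat. \<forall>j. \<alpha> j \<le> m j}"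
  have finB: "finite Box" unfolding Box_def by (rule finite_exponent_box)
  define pure where "pure j = (\<lambda>i. if i = j then m j else 0)" for j
  \<comment> \<open>The finitely many monomials of f in the box that do not vanish on the torus of
    support I; the pure powers of the coordinates in I are among them.\<close>
  define A where "A I = {\<alpha>\<in>Box. c \<alpha> \<noteq> 0 \<and> (\<forall>j. j \<notin> I \<longrightarrow> \<alpha> j = 0)}" for I
  have finA: "finite (A I)" for I unfolding A_def using finB by simp
  have pureA: "pure j \<in> A I" if "j \<in> I" for j I
    using that m(2)[of j] unfolding A_def Box_def pure_def by auto
  define supp where "supp k = {j. z k $ j \<noteq> 0}" for k
  have supp_ne: "supp k \<noteq> {}" for k using znz[of k] unfolding supp_def by (auto simp: vec_eq_iff)
  define amax where "amax k = (SOME \<alpha>. \<alpha> \<in> A (supp k) \<and> (\<forall>\<beta>\<in>A (supp k). norm (monom \<beta> (z k)) \<le> norm (monom \<alpha> (z k))))" for k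
  have amax: "amax k \<in> A (supp k)" "\<And>\<beta>. \<beta> \<in> A (supp k) \<Longrightarrow> norm (monom \<beta> (z k)) \<le> norm (monom (amax k) (z k))" for k
  proof -
    obtain j where "j \<in> supp k" using supp_ne by blast
    then have "A (supp k) \<noteq> {}" using pureA by blast
    then have "Max ((\<lambda>\<alpha>. norm (monom \<alpha> (z k))) ` A (supp k)) \<in> (\<lambda>\<alpha>. norm (monom \<alpha> (z k))) ` A (supp k)"
      using finA by (intro Max_in) auto
    then obtain \<alpha> where \<alpha>: "\<alpha> \<in> A (supp k)"
      "norm (monom \<alpha> (z k)) = Max ((\<lambda>\<alpha>. norm (monom \<alpha> (z k))) ` A (supp k))" by force
    then have "\<exists>\<alpha>. \<alpha> \<in> A (supp k) \<and> (\<forall>\<beta>\<in>A (supp k). norm (monom \<beta> (z k)) \<le> norm (monom \<alpha> (z k)))"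
      using finA[of "supp k"] by (intro exI[of _ \<alpha>]) simp
    from someI_ex[OF this]
    show "amax k \<in> A (supp k)" "\<And>\<beta>. \<beta> \<in> A (supp k) \<Longrightarrow> norm (monom \<beta> (z k)) \<le> norm (monom (amax k) (z k))"
      unfolding amax_def by blast+
  qed
  \<comment> \<open>Finitely many supports and maximal exponents are possible, so both can be made
    constant along a subsequence.\<close>
  have "finite (range (\<lambda>k. (supp k, amax k)))"
  proof (rule finite_subset)
    show "range (\<lambda>k. (supp k, amax k)) \<subseteq> UNIV \<times> Box" using amax(1) unfolding A_def by auto
  qed (use finB in simp)
  then obtain r1 :: "nat \<Rightarrow> nat" and p0 where r1: "strict_mono r1" "\<And>k. (supp (r1 k), amax (r1 k)) = p0"
    using finite_range_subseq[of "\<lambda>k. (supp k, amax k)"] by blast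
  define I where "I = fst p0"
  define \<alpha>0 where "\<alpha>0 = snd p0"
  have supp1: "supp (r1 k) = I" and amax1: "amax (r1 k) = \<alpha>0" for k
    using r1(2)[of k] unfolding I_def \<alpha>0_def by auto
  have \<alpha>0A: "\<alpha>0 \<in> A I" using amax(1)[of "r1 0"] supp1 amax1 by simp
  have mono_nz: "monom \<alpha> (z (r1 k)) \<noteq> 0" if "\<alpha> \<in> A I" for \<alpha> k
  proof -
    have "(z (r1 k) $ j) ^ \<alpha> j \<noteq> 0" for j
      using that supp1[of k] unfolding A_def supp_def by (cases "j \<in> I") auto
    then show ?thesis unfolding monom_def by simp
  qed
  define ratio where "ratio \<alpha> k = norm (monom \<alpha> (z (r1 k))) / norm (monom \<alpha>0 (z (r1 k)))" for \<alpha> k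
  have ratio01: "0 < ratio \<alpha> k \<and> ratio \<alpha> k \<le> 1" if "\<alpha> \<in> A I" for \<alpha> k
    using amax(2)[of \<alpha> "r1 k"] supp1 amax1 mono_nz[OF that, of k] mono_nz[OF \<alpha>0A, of k] that
    by (simp add: ratio_def)
  have "bounded (range (ratio \<alpha>))" if "\<alpha> \<in> A I" for \<alpha>
    unfolding bounded_iff using ratio01[OF that] by (intro exI[of _ 1]) (auto simp: less_imp_le)
  then obtain r2 where r2: "strict_mono r2" "\<And>\<alpha>. \<alpha> \<in> A I \<Longrightarrow> convergent (ratio \<alpha> \<circ> r2)"
    using finite_family_convergent_subseq[OF finA, of I ratio] by blast
  define t where "t \<alpha> = lim (ratio \<alpha> \<circ> r2)" for \<alpha>
  have t: "(ratio \<alpha> \<circ> r2) \<longlonglongrightarrow> t \<alpha>" if "\<alpha> \<in> A I" for \<alpha>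
    using r2(2)[OF that] unfolding t_def convergent_LIMSEQ_iff .
  have t0: "t \<alpha> \<ge> 0" if "\<alpha> \<in> A I" for \<alpha>
    using ratio01[OF that] by (intro LIMSEQ_le_const[OF t[OF that]]) (auto simp: less_imp_le)
  \<comment> \<open>The monomials of the same order as the dominant one.\<close>
  define \<Delta> where "\<Delta> = {\<alpha>\<in>A I. t \<alpha> > 0}"
  have finD: "finite \<Delta>" unfolding \<Delta>_def using finA by simp
  have "t \<alpha>0 = 1"
  proof -
    have "ratio \<alpha>0 \<circ> r2 = (\<lambda>_. 1)" using mono_nz[OF \<alpha>0A] by (auto simp: ratio_def)
    then show ?thesis unfolding t_def by simp
  qed
  then have \<alpha>0D: "\<alpha>0 \<in> \<Delta>" using \<alpha>0A unfolding \<Delta>_def by simp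

  \<comment> \<open>Logarithmic coordinates and the torus action\<close>
  define s where "s k = r1 (r2 k)" for k
  have s: "strict_mono s" using r1(1) r2(1) unfolding s_def strict_mono_def by simp
  define Z where "Z k = z (s k)" for k
  have Z0: "Z \<longlonglongrightarrow> 0" using LIMSEQ_subseq_LIMSEQ[OF z0 s] by (simp add: Z_def[abs_def] o_def)
  have ZI: "Z k $ j \<noteq> 0 \<longleftrightarrow> j \<in> I" for k j
    using supp1[of "r2 k"] unfolding supp_def Z_def s_def by auto
  have Zj0: "(\<lambda>k. Z k $ j) \<longlonglongrightarrow> 0" for j using tendsto_vec_nth[OF Z0, of j] by simp
  have ratio_eq: "ratio \<alpha> (r2 k) = norm (monom \<alpha> (Z k)) / norm (monom \<alpha>0 (Z k))" for \<alpha> k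
    by (simp add: ratio_def Z_def s_def)
  \<comment> \<open>The modulus of a monomial becomes exp of minus a linear functional of x. The
    value 0 off I is harmless, since exponents in \<open>A I\<close> vanish there.\<close>
  define x :: "nat \<Rightarrow> real^'n" where "x k = (\<chi> j. if j \<in> I then - ln (norm (Z k $ j)) else 0)" for k
  define ex :: "('n \<Rightarrow> nat) \<Rightarrow> real^'n" where "ex \<alpha> = (\<chi> j. real (\<alpha> j))" for \<alpha>
  have inner_ex: "v \<bullet> ex \<alpha> = (\<Sum>j\<in>UNIV. v$j * real (\<alpha> j))" for v \<alpha>
    by (simp add: inner_vec_def ex_def)
  have norm_mon: "norm (monom \<alpha> (Z k)) = exp (- (x k \<bullet> ex \<alpha>))" if "\<alpha> \<in> A I" for \<alpha> k
  proof -
    have "norm (Z k $ j) ^ \<alpha> j = exp (- (x k $ j * real (\<alpha> j)))" for j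
    proof (cases "j \<in> I")
      case True
      then have "norm (Z k $ j) > 0" using ZI by simp
      then have "norm (Z k $ j) ^ \<alpha> j = exp (ln (norm (Z k $ j))) ^ \<alpha> j" by simp
      also have "\<dots> = exp (real (\<alpha> j) * ln (norm (Z k $ j)))" by (rule exp_of_nat_mult[symmetric])
      finally show ?thesis using True by (simp add: x_def mult.commute)
    next
      case False
      then show ?thesis using that unfolding A_def by auto
    qed
    then show ?thesis unfolding norm_monom inner_ex by (simp add: exp_sum flip: sum_negf)
  qed
  have log_ratio: "x k \<bullet> (ex \<alpha> - ex \<alpha>0) = - ln (ratio \<alpha> (r2 k))" if "\<alpha> \<in> A I" for \<alpha> k
    unfolding ratio_eq norm_mon[OF that] norm_mon[OF \<alpha>0A]
    by (simp add: ln_div inner_diff_right)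
  \<comment> \<open>x pairs boundedly with these differences because the ratios have positive
    limits. Hence x is a weight y that is constant on \<Delta>, plus a bounded rest q.\<close>
  define G where "G = (\<lambda>\<alpha>. ex \<alpha> - ex \<alpha>0) ` \<Delta>"
  have finG: "finite G" unfolding G_def using finD by simp
  have bndG: "bounded (range (\<lambda>k. x k \<bullet> g))" if g: "g \<in> G" for g
  proof -
    obtain \<alpha> where \<alpha>: "\<alpha> \<in> A I" "t \<alpha> > 0" "g = ex \<alpha> - ex \<alpha>0" using g unfolding G_def \<Delta>_def by auto
    have "(\<lambda>k. - ln (ratio \<alpha> (r2 k))) \<longlonglongrightarrow> - ln (t \<alpha>)"
      using t[OF \<alpha>(1)] \<alpha>(2) by (intro tendsto_minus tendsto_ln) (auto simp: o_def)
    then have "(\<lambda>k. x k \<bullet> g) \<longlonglongrightarrow> - ln (t \<alpha>)" unfolding \<alpha>(3) log_ratio[OF \<alpha>(1)] .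
    then show ?thesis using convergent_imp_bounded by (auto simp: convergent_def)
  qed
  obtain y q where xyq: "\<And>k. x k = y k + q k" and yG: "\<And>k g. g \<in> G \<Longrightarrow> y k \<bullet> g = 0"
    and qb: "bounded (range q)"
    using orthogonal_splitting_bounded[OF finG bndG] by blast
  obtain Q where Q: "\<And>k. norm (q k) \<le> Q" using qb unfolding bounded_iff by auto
  have qj: "\<bar>q k $ j\<bar> \<le> Q" for k j
    using component_le_norm_cart[of "q k" j] Q[of k] by linarith
  have yD: "y k \<bullet> ex \<alpha> = y k \<bullet> ex \<alpha>0" if "\<alpha> \<in> \<Delta>" for \<alpha> k
    using yG[of "ex \<alpha> - ex \<alpha>0" k] that unfolding G_def by (simp add: inner_diff_right)
  \<comment> \<open>Z with the weight y divided out; its moduli are controlled by q alone.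
    Coordinates off I, absent from \<Delta>, are set to 1 so that the limit lies in the full torus,
    where non-degeneracy speaks.\<close>
  define u where "u k = (\<chi> j. if j \<in> I then Z k $ j * of_real (exp (y k $ j)) else 1)" for k
  have norm_u: "norm (u k $ j) = exp (- q k $ j)" if "j \<in> I" for k j
  proof -
    have "norm (Z k $ j) = exp (- x k $ j)" using that ZI by (simp add: x_def)
    then show ?thesis using that xyq[of k] by (simp add: u_def norm_mult flip: exp_add)
  qed
  have mon_u: "monom \<alpha> (Z k) = monom \<alpha> (u k) * of_real (exp (- (y k \<bullet> ex \<alpha>)))" if "\<alpha> \<in> A I" for \<alpha> k
  proof -
    have "(Z k $ j) ^ \<alpha> j = (u k $ j) ^ \<alpha> j * of_real (exp (- (y k $ j * real (\<alpha> j))))" for j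
    proof (cases "j \<in> I")
      case True
      have "exp (- (y k $ j * real (\<alpha> j))) = exp (- y k $ j) ^ \<alpha> j"
        by (simp add: mult.commute flip: exp_of_nat_mult)
      moreover have "complex_of_real (exp (y k $ j)) * of_real (exp (- y k $ j)) = 1"
        by (simp flip: of_real_mult exp_add)
      then have "complex_of_real (exp (y k $ j)) ^ \<alpha> j * of_real (exp (- y k $ j)) ^ \<alpha> j = 1"
        by (metis power_mult_distrib power_one)
      ultimately show ?thesis using True
        by (simp only: u_def vec_lambda_beta if_True power_mult_distrib mult.assoc of_real_power) simp
    next
      case False
      then show ?thesis using that unfolding A_def by auto
    qed
    then show ?thesis unfolding monom_def inner_ex
      by (simp add: prod.distrib exp_sum flip: sum_negf)
  qed
  have "bounded (range u)"
  proof -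
    have "norm (u k) \<le> (\<Sum>j\<in>(UNIV::'n set). exp Q + 1)" for k
    proof -
      have "norm (u k $ j) \<le> exp Q + 1" for j
        using norm_u[of j k] qj[of k j] by (cases "j \<in> I") (auto simp: u_def add_increasing2)
      then show ?thesis
        unfolding norm_vec_def by (intro order_trans[OF L2_set_le_sum] sum_mono) auto
    qed
    then show ?thesis unfolding bounded_iff by auto
  qed
  then obtain ul r3 where r3: "strict_mono r3" "(u \<circ> r3) \<longlonglongrightarrow> ul"
    using bounded_imp_convergent_subsequence by blast
  have uj: "(\<lambda>k. u (r3 k) $ j) \<longlonglongrightarrow> ul $ j" for j
    using tendsto_vec_nth[OF r3(2), of j] by (simp add: o_def)
  have ul_nz: "ul $ j \<noteq> 0" for j
  proof -
    have "norm (u (r3 k) $ j) \<ge> exp (- Q - 1) \<or> norm (u (r3 k) $ j) = 1" for k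
      using norm_u[of j "r3 k"] qj[of "r3 k" j] by (cases "j \<in> I") (auto simp: u_def)
    then have "norm (u (r3 k) $ j) \<ge> min (exp (- Q - 1)) 1" for k
      by (metis min.cobounded1 min.cobounded2 order_trans)
    then have "norm (ul $ j) \<ge> min (exp (- Q - 1)) 1"
      by (intro LIMSEQ_le_const[OF tendsto_norm[OF uj]]) auto
    moreover have "min (exp (- Q - 1)) 1 > 0" by simp
    ultimately show ?thesis by (metis norm_zero not_le)
  qed
  have mon_ul: "(\<lambda>k. monom \<alpha> (u (r3 k))) \<longlonglongrightarrow> monom \<alpha> ul" for \<alpha>
    unfolding monom_def by (intro tendsto_prod tendsto_power uj)

  \<comment> \<open>Growth of the weights\<close>
  have y_inf: "filterlim (\<lambda>k. y k $ j) at_top sequentially" if j: "j \<in> I" for j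
  proof -
    have "filterlim (\<lambda>k. norm (Z k $ j)) (at_right 0) sequentially"
      using tendsto_norm_zero[OF Zj0[of j]] ZI j
      by (auto simp: filterlim_at intro!: always_eventually)
    then have "filterlim (\<lambda>k. ln (norm (Z k $ j))) at_bot sequentially"
      by (rule filterlim_compose[OF ln_at_0])
    then have "filterlim (\<lambda>k. - ln (norm (Z k $ j))) at_top sequentially"
      by (simp add: filterlim_uminus_at_bot)
    then have "filterlim (\<lambda>k. - Q + - ln (norm (Z k $ j))) at_top sequentially"
      by (rule filterlim_tendsto_add_at_top[OF tendsto_const])
    then show ?thesis
    proof (rule filterlim_at_top_mono, intro always_eventually allI)
      fix k
      have "x k $ j = y k $ j + q k $ j" using xyq[of k] by simp
      then show "- Q + - ln (norm (Z k $ j)) \<le> y k $ j"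
        using qj[of k j] j by (simp add: x_def)
    qed
  qed
  have g_inf: "filterlim (\<lambda>k. y k \<bullet> (ex \<alpha> - ex \<alpha>0)) at_top sequentially" if \<alpha>: "\<alpha> \<in> A I" "\<alpha> \<notin> \<Delta>" for \<alpha>
  proof -
    have "t \<alpha> = 0" using t0[OF \<alpha>(1)] \<alpha> unfolding \<Delta>_def by force
    then have "filterlim (\<lambda>k. ratio \<alpha> (r2 k)) (at_right 0) sequentially"
      using t[OF \<alpha>(1)] ratio01[OF \<alpha>(1)]
      by (auto simp: filterlim_at o_def less_imp_neq[symmetric] intro!: always_eventually)
    then have "filterlim (\<lambda>k. ln (ratio \<alpha> (r2 k))) at_bot sequentially"
      by (rule filterlim_compose[OF ln_at_0])
    then have "filterlim (\<lambda>k. - ln (ratio \<alpha> (r2 k))) at_top sequentially"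
      by (simp add: filterlim_uminus_at_bot)
    then have "filterlim (\<lambda>k. - (Q * norm (ex \<alpha> - ex \<alpha>0)) + - ln (ratio \<alpha> (r2 k))) at_top sequentially"
      by (rule filterlim_tendsto_add_at_top[OF tendsto_const])
    then show ?thesis
    proof (rule filterlim_at_top_mono, intro always_eventually allI)
      fix k
      have "x k \<bullet> (ex \<alpha> - ex \<alpha>0) = y k \<bullet> (ex \<alpha> - ex \<alpha>0) + q k \<bullet> (ex \<alpha> - ex \<alpha>0)"
        using xyq[of k] by (simp add: inner_add_left)
      moreover have "\<bar>q k \<bullet> (ex \<alpha> - ex \<alpha>0)\<bar> \<le> Q * norm (ex \<alpha> - ex \<alpha>0)"
        using Cauchy_Schwarz_ineq2[of "q k" "ex \<alpha> - ex \<alpha>0"] mult_right_mono[OF Q[of k] norm_ge_zero[of "ex \<alpha> - ex \<alpha>0"]]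
        by linarith
      ultimately show "- (Q * norm (ex \<alpha> - ex \<alpha>0)) + - ln (ratio \<alpha> (r2 k)) \<le> y k \<bullet> (ex \<alpha> - ex \<alpha>0)"
        using log_ratio[OF \<alpha>(1), of k] by linarith
    qed
  qed

  \<comment> \<open>A positive integer weight cutting out the face\<close>
  have "\<forall>\<^sub>F k in sequentially. (\<forall>j\<in>I. y k $ j \<ge> 2) \<and> (\<forall>\<alpha>\<in>A I - \<Delta>. y k \<bullet> (ex \<alpha> - ex \<alpha>0) \<ge> 2)"
    using y_inf g_inf finA[of I]
    by (intro eventually_conj eventually_ball_finite) (auto simp: filterlim_at_top)
  then obtain k0 where k0: "\<And>j. j \<in> I \<Longrightarrow> y k0 $ j \<ge> 2" "\<And>\<alpha>. \<alpha> \<in> A I - \<Delta> \<Longrightarrow> y k0 \<bullet> (ex \<alpha> - ex \<alpha>0) \<ge> 2"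
    unfolding eventually_sequentially by blast
  obtain p :: "'n \<Rightarrow> int" where p_pos: "\<And>j. y k0 $ j \<ge> 2 \<Longrightarrow> p j > 0" and
    p_zero: "\<And>g :: 'n \<Rightarrow> int. (\<And>j. \<bar>g j\<bar> \<le> int (m j)) \<Longrightarrow> (\<Sum>j\<in>UNIV. g j * y k0 $ j) = 0 \<Longrightarrow> (\<Sum>j\<in>UNIV. g j * p j) = 0" and
    p_gt: "\<And>g :: 'n \<Rightarrow> int. (\<And>j. \<bar>g j\<bar> \<le> int (m j)) \<Longrightarrow> (\<Sum>j\<in>UNIV. g j * y k0 $ j) \<ge> 2 \<Longrightarrow> (\<Sum>j\<in>UNIV. g j * p j) > 0"
    using integer_weights[of "y k0" m] by blast
  define w0 where "w0 = (\<Sum>i\<in>I. nat (p i) * \<alpha>0 i)"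
  \<comment> \<open>Off I the weight exceeds \<open>w0\<close>, so every monomial that involves such
    a coordinate lies above the face.\<close>
  define P where "P j = (if j \<in> I then nat (p j) else 1 + w0)" for j
  have Ppos: "P j > 0" for j using p_pos[OF k0(1), of j] by (auto simp: P_def)
  have wdegA: "wdeg P \<alpha> = (\<Sum>i\<in>I. nat (p i) * \<alpha> i)" if "\<And>j. j \<notin> I \<Longrightarrow> \<alpha> j = 0" for \<alpha>
    unfolding wdeg_def P_def using that by (intro sum.mono_neutral_cong_right) auto
  have wdeg\<alpha>0: "wdeg P \<alpha>0 = w0" using wdegA[of \<alpha>0] \<alpha>0A unfolding A_def w0_def by auto
  have wdeg_diff: "int (wdeg P \<alpha>) - int w0 = (\<Sum>j\<in>UNIV. (int (\<alpha> j) - int (\<alpha>0 j)) * p j)" if "\<alpha> \<in> A I" for \<alpha>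
  proof -
    have "int (wdeg P \<beta>) = (\<Sum>j\<in>UNIV. int (\<beta> j) * p j)" if "\<beta> \<in> A I" for \<beta>
    proof -
      have "int (P j) * int (\<beta> j) = int (\<beta> j) * p j" for j
        using that p_pos[OF k0(1), of j] unfolding A_def P_def by (cases "j \<in> I") auto
      then show ?thesis unfolding wdeg_def of_nat_sum of_nat_mult by (simp only:)
    qed
    then show ?thesis using that \<alpha>0A wdeg\<alpha>0[symmetric]
      by (simp add: left_diff_distrib sum_subtractf)
  qed
  have box_diff: "\<bar>int (\<alpha> j) - int (\<alpha>0 j)\<bar> \<le> int (m j)" if "\<alpha> \<in> A I" for \<alpha> j
  proof -
    have "\<alpha> j \<le> m j" "\<alpha>0 j \<le> m j" using that \<alpha>0A unfolding A_def Box_def by auto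
    then show ?thesis by linarith
  qed
  have inner_diff: "(\<Sum>j\<in>UNIV. real_of_int (int (\<alpha> j) - int (\<alpha>0 j)) * y k0 $ j) = y k0 \<bullet> (ex \<alpha> - ex \<alpha>0)" for \<alpha>
    unfolding inner_diff_right inner_ex by (simp add: sum_subtractf algebra_simps)
  have wD: "wdeg P \<alpha> = w0" if "\<alpha> \<in> \<Delta>" for \<alpha>
  proof -
    have "\<alpha> \<in> A I" using that unfolding \<Delta>_def by simp
    have "(\<Sum>j\<in>UNIV. (int (\<alpha> j) - int (\<alpha>0 j)) * p j) = 0"
      by (rule p_zero[OF box_diff[OF \<open>\<alpha> \<in> A I\<close>]])
        (use inner_diff[of \<alpha>] yD[OF that, of k0] in \<open>simp add: inner_diff_right\<close>)
    then show ?thesis using wdeg_diff[OF \<open>\<alpha> \<in> A I\<close>] by simp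
  qed
  have wA: "wdeg P \<alpha> > w0" if "\<alpha> \<in> A I" "\<alpha> \<notin> \<Delta>" for \<alpha>
  proof -
    have "(\<Sum>j\<in>UNIV. (int (\<alpha> j) - int (\<alpha>0 j)) * p j) > 0"
      by (rule p_gt[OF box_diff[OF that(1)]]) (use inner_diff[of \<alpha>] k0(2)[of \<alpha>] that in simp)
    then show ?thesis using wdeg_diff[OF that(1)] by simp
  qed
  \<comment> \<open>A monomial of f outside \<open>A I\<close> either involves a coordinate off I,
    or exceeds the box in some j in I and is then heavier than the pure power of z_j, whose weight
    is at least \<open>w0\<close>.\<close>
  have w_other: "wdeg P \<alpha> > w0" if c\<alpha>: "c \<alpha> \<noteq> 0" and nA: "\<alpha> \<notin> A I" for \<alpha>
  proof (cases "\<forall>j. j \<notin> I \<longrightarrow> \<alpha> j = 0")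
    case False
    then obtain j where j: "j \<notin> I" "\<alpha> j > 0" by auto
    have "w0 < P j * 1" using j by (simp add: P_def)
    also have "\<dots> \<le> P j * \<alpha> j" using j by (intro mult_left_mono) auto
    also have "\<dots> \<le> wdeg P \<alpha>" unfolding wdeg_def by (rule member_le_sum) auto
    finally show ?thesis .
  next
    case True
    then obtain j where j: "\<alpha> j > m j" using c\<alpha> nA unfolding A_def Box_def by (auto simp: not_le)
    then have jI: "j \<in> I" using True by (metis not_less0)
    have "wdeg P (pure j) = P j * m j"
      unfolding wdeg_def pure_def by (simp add: if_distrib[of "(*) _"] cong: if_cong)
    moreover have "w0 \<le> wdeg P (pure j)"
      using wD[of "pure j"] wA[OF pureA[OF jI]] by (cases "pure j \<in> \<Delta>") auto
    moreover have "P j * m j < P j * \<alpha> j" using Ppos[of j] j by simp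
    moreover have "P j * \<alpha> j \<le> wdeg P \<alpha>" unfolding wdeg_def by (rule member_le_sum) auto
    ultimately show ?thesis by linarith
  qed
  have cD: "c \<alpha> \<noteq> 0" if "\<alpha> \<in> \<Delta>" for \<alpha> using that unfolding \<Delta>_def A_def by simp
  have w_ge: "wdeg P \<alpha> \<ge> w0" if "c \<alpha> \<noteq> 0" for \<alpha>
    using w_other[OF that] wA[of \<alpha>] wD[of \<alpha>] by (cases "\<alpha> \<in> A I"; cases "\<alpha> \<in> \<Delta>") (auto simp: less_imp_le)
  have mind: "min_deg c P = w0" unfolding min_deg_def
  proof (rule cInf_eq_minimum)
    show "w0 \<in> {wdeg P \<alpha> |\<alpha>. c \<alpha> \<noteq> 0}" using wdeg\<alpha>0 cD[OF \<alpha>0D] by auto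
  qed (use w_ge in auto)
  have face: "\<Delta> = {\<alpha>. c \<alpha> \<noteq> 0 \<and> wdeg P \<alpha> = min_deg c P}" unfolding mind
    using w_other wA wD cD by (auto; metis less_irrefl)
  have w0_pos: "w0 > 0"
  proof -
    have "\<alpha>0 \<noteq> (\<lambda>_. 0)" using cD[OF \<alpha>0D] c0 by auto
    then obtain j where "\<alpha>0 j > 0" by auto
    then have "0 < P j * \<alpha>0 j" using Ppos[of j] by simp
    also have "\<dots> \<le> wdeg P \<alpha>0" unfolding wdeg_def by (rule member_le_sum) auto
    finally show ?thesis using wdeg\<alpha>0 by simp
  qed

  \<comment> \<open>Limits of the rescaled series\<close>
  define Y where "Y k = y (r3 k) \<bullet> ex \<alpha>0" for k
  define W where "W k = Z (r3 k)" for k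
  have W0: "W \<longlonglongrightarrow> 0" using LIMSEQ_subseq_LIMSEQ[OF Z0 r3(1)] by (simp add: W_def[abs_def] o_def)
  have limD: "(\<lambda>k. of_real (exp (Y k)) * monom \<alpha> (W k)) \<longlonglongrightarrow> monom \<alpha> ul" if "\<alpha> \<in> \<Delta>" for \<alpha>
  proof -
    have "\<alpha> \<in> A I" using that unfolding \<Delta>_def by simp
    have "of_real (exp (Y k)) * monom \<alpha> (W k) = monom \<alpha> (u (r3 k))" for k
      unfolding W_def mon_u[OF \<open>\<alpha> \<in> A I\<close>] Y_def yD[OF that]
      by (simp add: mult.left_commute flip: of_real_mult exp_add)
    then show ?thesis using mon_ul by simp
  qed
  have bound0: "\<exists>C0. \<forall>k. exp (Y k) * norm (monom \<alpha>0 (W k)) \<le> C0"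
  proof -
    have "Bseq (\<lambda>k. of_real (exp (Y k)) * monom \<alpha>0 (W k))"
      using limD[OF \<alpha>0D] by (intro convergent_imp_Bseq) (auto simp: convergent_def)
    then show ?thesis unfolding Bseq_def by (auto simp: norm_mult)
  qed
  then obtain C0 where C0: "\<And>k. exp (Y k) * norm (monom \<alpha>0 (W k)) \<le> C0" by blast
  have limA: "(\<lambda>k. of_real (exp (Y k)) * monom \<alpha> (W k)) \<longlonglongrightarrow> 0" if \<alpha>: "\<alpha> \<in> A I" "\<alpha> \<notin> \<Delta>" for \<alpha>
  proof (rule Lim_null_comparison[OF always_eventually], rule allI)
    fix k
    have nz: "monom \<alpha>0 (W k) \<noteq> 0" using mono_nz[OF \<alpha>0A] by (simp add: W_def Z_def s_def)
    have "norm (of_real (exp (Y k)) * monom \<alpha> (W k)) = (exp (Y k) * norm (monom \<alpha>0 (W k))) * ratio \<alpha> (r2 (r3 k))"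
      using nz by (simp add: ratio_eq W_def norm_mult)
    also have "\<dots> \<le> C0 * ratio \<alpha> (r2 (r3 k))"
      using ratio01[OF \<alpha>(1), of "r2 (r3 k)"] C0[of k] by (intro mult_right_mono) auto
    finally show "norm (of_real (exp (Y k)) * monom \<alpha> (W k)) \<le> C0 * ratio \<alpha> (r2 (r3 k))" .
  next
    have "t \<alpha> = 0" using t0[OF \<alpha>(1)] \<alpha> unfolding \<Delta>_def by force
    then have "(\<lambda>k. ratio \<alpha> (r2 (r3 k))) \<longlonglongrightarrow> 0"
      using LIMSEQ_subseq_LIMSEQ[OF t[OF \<alpha>(1)] r3(1)] by (simp add: o_def)
    then show "(\<lambda>k. C0 * ratio \<alpha> (r2 (r3 k))) \<longlonglongrightarrow> 0" by (rule tendsto_mult_right_zero)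
  qed
  have conv: "(\<lambda>k. of_real (exp (Y k)) * F (W k)) \<longlonglongrightarrow> (\<Sum>\<alpha>\<in>\<Delta>. b \<alpha> * monom \<alpha> ul)"
    if b: "\<And>\<alpha>. c \<alpha> = 0 \<Longrightarrow> b \<alpha> = 0" and d: "d > 0" and
      tail: "\<And>z. norm z < d \<Longrightarrow> norm (F z - (\<Sum>\<alpha>\<in>{\<alpha>. \<forall>j. \<alpha> j \<le> m j}. b \<alpha> * monom \<alpha> z))
           \<le> C * norm z * (\<Sum>j\<in>UNIV. norm (z$j) ^ m j)" for b F C d
  proof -
    have boxsum: "(\<Sum>\<alpha>\<in>Box. b \<alpha> * monom \<alpha> (W k)) = (\<Sum>\<alpha>\<in>A I. b \<alpha> * monom \<alpha> (W k))" for k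
    proof (rule sum.mono_neutral_right[OF finB])
      show "A I \<subseteq> Box" unfolding A_def by auto
      show "\<forall>\<alpha>\<in>Box - A I. b \<alpha> * monom \<alpha> (W k) = 0"
      proof
        fix \<alpha> assume \<alpha>: "\<alpha> \<in> Box - A I"
        show "b \<alpha> * monom \<alpha> (W k) = 0"
        proof (cases "c \<alpha> = 0")
          case False
          then obtain j where "j \<notin> I" "\<alpha> j \<noteq> 0" using \<alpha> unfolding A_def by auto
          then have "(W k $ j) ^ \<alpha> j = 0" using ZI[of "r3 k" j] by (simp add: W_def)
          then have "monom \<alpha> (W k) = 0" unfolding monom_def by (intro prod_zero) auto
          then show ?thesis by simp
        qed (use b in simp)
      qed
    qed
    have main: "(\<lambda>k. \<Sum>\<alpha>\<in>A I. b \<alpha> * (of_real (exp (Y k)) * monom \<alpha> (W k))) \<longlonglongrightarrow>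
        (\<Sum>\<alpha>\<in>A I. b \<alpha> * (if \<alpha> \<in> \<Delta> then monom \<alpha> ul else 0))"
    proof (intro tendsto_sum tendsto_mult tendsto_const)
      fix \<alpha> assume "\<alpha> \<in> A I"
      then show "(\<lambda>k. of_real (exp (Y k)) * monom \<alpha> (W k)) \<longlonglongrightarrow> (if \<alpha> \<in> \<Delta> then monom \<alpha> ul else 0)"
        using limD[of \<alpha>] limA[of \<alpha>] by (cases "\<alpha> \<in> \<Delta>") auto
    qed
    have "(\<Sum>\<alpha>\<in>A I. b \<alpha> * (if \<alpha> \<in> \<Delta> then monom \<alpha> ul else 0)) = (\<Sum>\<alpha>\<in>\<Delta>. b \<alpha> * monom \<alpha> ul)"
      by (rule sum.mono_neutral_cong_right) (use finA in \<open>auto simp: \<Delta>_def\<close>)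
    with main have main': "(\<lambda>k. of_real (exp (Y k)) * (\<Sum>\<alpha>\<in>Box. b \<alpha> * monom \<alpha> (W k))) \<longlonglongrightarrow> (\<Sum>\<alpha>\<in>\<Delta>. b \<alpha> * monom \<alpha> ul)"
      by (simp add: boxsum sum_distrib_left mult_ac)
    \<comment> \<open>Pure powers lie in \<open>A I\<close>, so the dominant monomial bounds every
      |W_j|^(m j). The tail is therefore O(|W|) times the dominant monomial, which stays bounded
      after rescaling.\<close>
    have rest: "(\<lambda>k. of_real (exp (Y k)) * (F (W k) - (\<Sum>\<alpha>\<in>Box. b \<alpha> * monom \<alpha> (W k)))) \<longlonglongrightarrow> 0"
    proof (rule Lim_null_comparison)
      have "(\<lambda>k. norm (W k)) \<longlonglongrightarrow> 0" using tendsto_norm_zero[OF W0] .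
      then show "(\<lambda>k. \<bar>C\<bar> * real CARD('n) * C0 * norm (W k)) \<longlonglongrightarrow> 0" by (rule tendsto_mult_right_zero)
      have "\<forall>\<^sub>F k in sequentially. norm (W k) < d"
        using \<open>(\<lambda>k. norm (W k)) \<longlonglongrightarrow> 0\<close> d by (rule order_tendstoD)
      then show "\<forall>\<^sub>F k in sequentially. norm (of_real (exp (Y k)) * (F (W k) - (\<Sum>\<alpha>\<in>Box. b \<alpha> * monom \<alpha> (W k))))
          \<le> \<bar>C\<bar> * real CARD('n) * C0 * norm (W k)"
      proof (rule eventually_mono)
        fix k assume k: "norm (W k) < d"
        have "norm (W k $ j) ^ m j \<le> norm (monom \<alpha>0 (W k))" for j
        proof (cases "j \<in> I")
          case True
          have "norm (monom (pure j) (Z (r3 k))) \<le> norm (monom \<alpha>0 (Z (r3 k)))"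
            using amax(2)[of "pure j" "s (r3 k)"] pureA[OF True] supp1[of "r2 (r3 k)"] amax1[of "r2 (r3 k)"]
            by (simp add: Z_def s_def)
          moreover have "norm (monom (pure j) (Z (r3 k))) = norm (Z (r3 k) $ j) ^ m j"
            unfolding norm_monom pure_def by (simp add: if_distrib[of "\<lambda>e. _ ^ e"] cong: if_cong)
          ultimately show ?thesis by (simp add: W_def)
        next
          case False
          then have "W k $ j = 0" using ZI[of "r3 k" j] by (simp add: W_def)
          then show ?thesis using m(1)[of j] by (simp add: zero_power)
        qed
        then have sumle: "(\<Sum>j\<in>UNIV. norm (W k $ j) ^ m j) \<le> real CARD('n) * norm (monom \<alpha>0 (W k))"
          using sum_bounded_above[of "UNIV :: 'n set" "\<lambda>j. norm (W k $ j) ^ m j"] by simp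
        have "norm (F (W k) - (\<Sum>\<alpha>\<in>Box. b \<alpha> * monom \<alpha> (W k))) \<le> C * norm (W k) * (\<Sum>j\<in>UNIV. norm (W k $ j) ^ m j)"
          unfolding Box_def by (rule tail[OF k])
        also have "\<dots> \<le> \<bar>C\<bar> * norm (W k) * (real CARD('n) * norm (monom \<alpha>0 (W k)))"
          using sumle by (intro mult_mono) (auto intro!: sum_nonneg)
        finally have "exp (Y k) * norm (F (W k) - (\<Sum>\<alpha>\<in>Box. b \<alpha> * monom \<alpha> (W k)))
           \<le> exp (Y k) * (\<bar>C\<bar> * norm (W k) * (real CARD('n) * norm (monom \<alpha>0 (W k))))"
          by (rule mult_left_mono) simp
        also have "\<dots> = (\<bar>C\<bar> * real CARD('n) * norm (W k)) * (exp (Y k) * norm (monom \<alpha>0 (W k)))"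
          by (simp add: mult_ac)
        also have "\<dots> \<le> (\<bar>C\<bar> * real CARD('n) * norm (W k)) * C0"
          by (intro mult_left_mono C0) auto
        finally show "norm (of_real (exp (Y k)) * (F (W k) - (\<Sum>\<alpha>\<in>Box. b \<alpha> * monom \<alpha> (W k))))
          \<le> \<bar>C\<bar> * real CARD('n) * C0 * norm (W k)" by (simp add: norm_mult mult_ac)
      qed
    qed
    show ?thesis using tendsto_add[OF main' rest] by (simp add: algebra_simps)
  qed
  have s3: "strict_mono (s \<circ> r3)" using s r3(1) by (rule strict_mono_o)
  show ?thesis
  proof (intro exI[of _ "s \<circ> r3"] exI[of _ P] exI[of _ \<Delta>] exI[of _ Y] exI[of _ ul] conjI allI impI)
    show "min_deg c P > 0" using w0_pos mind by simp
    fix b :: "('n \<Rightarrow> nat) \<Rightarrow> complex" and F :: "complex^'n \<Rightarrow> complex" and C d :: real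
    assume "\<forall>\<alpha>. c \<alpha> = 0 \<longrightarrow> b \<alpha> = 0" "d > 0" "\<forall>z. norm z < d \<longrightarrow> norm (F z - (\<Sum>\<alpha>\<in>{\<alpha>. \<forall>j. \<alpha> j \<le> m j}. b \<alpha> * monom \<alpha> z))
           \<le> C * norm z * (\<Sum>j\<in>UNIV. norm (z$j) ^ m j)"
    then show "(\<lambda>k. of_real (exp (Y k)) * F (z ((s \<circ> r3) k))) \<longlonglongrightarrow> (\<Sum>\<alpha>\<in>\<Delta>. b \<alpha> * monom \<alpha> ul)"
      using conv[of b d F C] by (simp add: W_def Z_def)
  qed (use s3 Ppos face finD ul_nz in simp_all)
qed

text \<open>With \<open>t j = |w\<^sub>j|\<^sup>2\<close> the hypothesis says that the differential of the mixed function vanishes on the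
  contact hyperplane at \<open>w\<close>; the conclusion is Milnor's outward pointing multiplier.\<close>
lemma euler_ratio_positive_near_0:
  fixes c :: "('n::finite \<Rightarrow> nat) \<Rightarrow> complex"
  assumes ps: "power_series_near0 c f \<epsilon>" and f0: "f 0 = 0"
    and conv: "convenient c" and nd: "nondegenerate c"
  obtains \<delta> where "\<delta> > 0"
    "\<And>z \<nu> t. z \<noteq> 0 \<Longrightarrow> norm z < \<delta> \<Longrightarrow> (\<And>j. t j \<ge> 0) \<Longrightarrow>
       (\<And>j. z$j * series_diff c j z = \<nu> * complex_of_real (t j)) \<Longrightarrow> f z \<noteq> 0 \<and> Re (\<nu> / f z) > 0"
proof (rule ccontr)
  assume contra: "\<not> thesis"
  have \<epsilon>: "\<epsilon> > 0" using ps unfolding power_series_near0_def by simp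
  have "\<exists>z \<nu> t. z \<noteq> 0 \<and> norm z < inverse (real (Suc k)) \<and> (\<forall>j. t j \<ge> 0) \<and>
     (\<forall>j. z$j * series_diff c j z = \<nu> * complex_of_real (t j)) \<and> \<not> (f z \<noteq> 0 \<and> Re (\<nu> / f z) > 0)" for k
    using contra that[of "inverse (real (Suc k))"] by (meson inverse_positive_iff_positive of_nat_0_less_iff zero_less_Suc)
  then obtain z \<nu> t where znz: "\<And>k. z k \<noteq> 0" and znorm: "\<And>k. norm (z k) < inverse (real (Suc k))"
    and t: "\<And>k j. t k j \<ge> 0"
    and A: "\<And>k j. z k $ j * series_diff c j (z k) = \<nu> k * complex_of_real (t k j)"
    and bad: "\<And>k. \<not> (f (z k) \<noteq> 0 \<and> Re (\<nu> k / f (z k)) > 0)"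
    by metis
  have z0: "z \<longlonglongrightarrow> 0"
    by (rule Lim_null_comparison[OF _ LIMSEQ_inverse_real_of_nat])
       (use znorm in \<open>auto intro!: always_eventually less_imp_le\<close>)
  have c0: "c (\<lambda>_. 0) = 0"
  proof -
    have "((\<lambda>\<alpha>. c \<alpha> * monom \<alpha> 0) has_sum f 0) UNIV"
      using ps \<epsilon> unfolding power_series_near0_def by (auto simp: zero_vec_def)
    moreover have "((\<lambda>\<alpha>. c \<alpha> * monom \<alpha> 0) has_sum c (\<lambda>_. 0)) UNIV"
      by (rule has_sum_finite_neutralI[of "{\<lambda>_. 0}"]) (auto simp: monom_0)
    ultimately show ?thesis using f0 has_sum_unique by force
  qed
  obtain m where m: "\<And>j. m j > 0" "\<And>j. c (\<lambda>i. if i = j then m j else 0) \<noteq> 0"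
    using conv unfolding convenient_def by metis
  obtain r P \<Delta> Y u where r: "strict_mono r" and P': "\<forall>j. P j > 0"
    and \<Delta>: "\<Delta> = {\<alpha>. c \<alpha> \<noteq> 0 \<and> wdeg P \<alpha> = min_deg c P}" "finite \<Delta>" "min_deg c P > 0"
    and u': "\<forall>j. u$j \<noteq> 0"
    and lim: "\<forall>b F C d. (\<forall>\<alpha>. c \<alpha> = 0 \<longrightarrow> b \<alpha> = 0) \<longrightarrow> d > 0 \<longrightarrow>
       (\<forall>z. norm z < d \<longrightarrow> norm (F z - (\<Sum>\<alpha>\<in>{\<alpha>. \<forall>j. \<alpha> j \<le> m j}. b \<alpha> * monom \<alpha> z))
           \<le> C * norm z * (\<Sum>j\<in>UNIV. norm (z$j) ^ m j)) \<longrightarrow>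
       (\<lambda>k. of_real (exp (Y k)) * F (z (r k))) \<longlonglongrightarrow> (\<Sum>\<alpha>\<in>\<Delta>. b \<alpha> * monom \<alpha> u)"
    using newton_face_asymptotics[where c = c and m = m and z = z, OF c0 m z0 znz] by (elim exE conjE) (rule that)
  note P = P'[rule_format] and u = u'[rule_format]
  \<comment> \<open>The limits of f and of z_j \<partial>_j f after the same rescaling: f_P(u) here,
    and u_j \<partial>_j f_P(u) for \<open>a j\<close>.\<close>
  define F0 where "F0 = (\<Sum>\<alpha>\<in>\<Delta>. c \<alpha> * monom \<alpha> u)"
  define a where "a j = (\<Sum>\<alpha>\<in>\<Delta>. (of_nat (\<alpha> j) * c \<alpha>) * monom \<alpha> u)" for j
  define d where "d = min_deg c P"
  have limf: "(\<lambda>k. of_real (exp (Y k)) * f (z (r k))) \<longlonglongrightarrow> F0"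
  proof -
    obtain C d where "d > 0" "\<forall>z. norm z < d \<longrightarrow>
        norm (f z - (\<Sum>\<alpha>\<in>{\<alpha>. \<forall>j. \<alpha> j \<le> m j}. c \<alpha> * monom \<alpha> z)) \<le> C * norm z * (\<Sum>j\<in>UNIV. norm (z$j) ^ m j)"
      using power_series_tail[OF \<epsilon>, of c f m] ps unfolding power_series_near0_def by blast
    then show ?thesis using lim[rule_format, of c d f C] unfolding F0_def by auto
  qed
  have lima: "(\<lambda>k. of_real (exp (Y k)) * (\<nu> (r k) * of_real (t (r k) j))) \<longlonglongrightarrow> a j" for j
  proof -
    let ?b = "\<lambda>\<alpha>. of_nat (\<alpha> j) * c \<alpha>" and ?F = "\<lambda>z. z$j * series_diff c j z"
    obtain C d where "d > 0" "\<forall>z. norm z < d \<longrightarrow>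
        norm (?F z - (\<Sum>\<alpha>\<in>{\<alpha>. \<forall>j. \<alpha> j \<le> m j}. ?b \<alpha> * monom \<alpha> z)) \<le> C * norm z * (\<Sum>j\<in>UNIV. norm (z$j) ^ m j)"
      using power_series_tail[OF \<epsilon>, of ?b ?F m] power_series_euler_sum[OF ps, of _ j] by blast
    then have "(\<lambda>k. of_real (exp (Y k)) * ?F (z (r k))) \<longlonglongrightarrow> a j"
      using lim[rule_format, of ?b d ?F C] unfolding a_def by auto
    then show ?thesis unfolding A .
  qed
  \<comment> \<open>Summing the hypotheses with the weights P matches Euler's relation for f_P, so
    that \<nu>\<tau> rescales to d F0.\<close>
  define \<tau> where "\<tau> k = (\<Sum>j\<in>UNIV. real (P j) * t (r k) j)" for k
  have \<tau>0: "\<tau> k \<ge> 0" for k unfolding \<tau>_def using t by (auto intro!: sum_nonneg)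
  have euler: "(\<Sum>j\<in>UNIV. of_nat (P j) * a j) = of_nat d * F0"
  proof -
    have "(\<Sum>j\<in>UNIV. of_nat (P j) * a j) = (\<Sum>\<alpha>\<in>\<Delta>. \<Sum>j\<in>UNIV. of_nat (P j * \<alpha> j) * (c \<alpha> * monom \<alpha> u))"
      unfolding a_def sum_distrib_left by (subst sum.swap) (simp add: mult_ac)
    also have "\<dots> = (\<Sum>\<alpha>\<in>\<Delta>. of_nat (wdeg P \<alpha>) * (c \<alpha> * monom \<alpha> u))"
      unfolding wdeg_def by (simp add: sum_distrib_right)
    also have "\<dots> = (\<Sum>\<alpha>\<in>\<Delta>. of_nat d * (c \<alpha> * monom \<alpha> u))"
      by (intro sum.cong refl) (simp add: \<Delta>(1) d_def)
    finally show ?thesis unfolding F0_def by (simp add: sum_distrib_left)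
  qed
  have lim\<tau>: "(\<lambda>k. of_real (exp (Y k)) * (\<nu> (r k) * of_real (\<tau> k))) \<longlonglongrightarrow> of_nat d * F0"
  proof -
    have "(\<lambda>k. \<Sum>j\<in>UNIV. of_nat (P j) * (of_real (exp (Y k)) * (\<nu> (r k) * of_real (t (r k) j)))) \<longlonglongrightarrow>
        (\<Sum>j\<in>UNIV. of_nat (P j) * a j)"
      by (intro tendsto_intros lima)
    then show ?thesis unfolding euler \<tau>_def by (simp add: sum_distrib_left mult_ac)
  qed
  \<comment> \<open>If F0 = 0, then \<nu>\<tau> rescales to 0; since t \<ge> 0 and P \<ge> 1, so
    does each \<nu> t_j, and u is a critical zero of f_P in the torus. If F0 is nonzero, \<nu>\<tau>
    / f tends to d > 0, against the choice of the sequence.\<close>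
  show False
  proof (cases "F0 = 0")
    case True
    have a0: "a j = 0" for j
    proof -
      have lim0: "(\<lambda>k. norm (of_real (exp (Y k)) * (\<nu> (r k) * of_real (\<tau> k)))) \<longlonglongrightarrow> 0"
        using tendsto_norm_zero[of "\<lambda>k. of_real (exp (Y k)) * (\<nu> (r k) * of_real (\<tau> k))"] lim\<tau> True by simp
      have "norm (of_real (exp (Y k)) * (\<nu> (r k) * of_real (t (r k) j)))
          \<le> norm (of_real (exp (Y k)) * (\<nu> (r k) * of_real (\<tau> k)))" for k
      proof -
        have "1 * t (r k) j \<le> real (P j) * t (r k) j"
          using P[of j] t[of "r k" j] by (intro mult_right_mono) linarith+
        also have "\<dots> \<le> \<tau> k" unfolding \<tau>_def by (rule member_le_sum) (use t in auto)
        finally show ?thesis using t[of "r k" j] \<tau>0[of k]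
          by (simp add: norm_mult) (intro mult_left_mono; simp)
      qed
      then have "(\<lambda>k. of_real (exp (Y k)) * (\<nu> (r k) * of_real (t (r k) j))) \<longlonglongrightarrow> 0"
        by (intro Lim_null_comparison[OF always_eventually lim0] allI)
      then show ?thesis using LIMSEQ_unique[OF lima] by blast
    qed
    have face: "face_fun c P = (\<lambda>z. \<Sum>\<alpha>\<in>\<Delta>. c \<alpha> * monom \<alpha> z)"
      unfolding face_fun_def \<Delta>(1) by simp
    have "(face_fun c P has_derivative (\<lambda>v. \<Sum>\<alpha>\<in>\<Delta>. c \<alpha> * (\<Sum>j\<in>UNIV. monom_diff j \<alpha> u * v$j))) (at u)"
      unfolding face by (intro has_derivative_sum has_derivative_mult_right monom_has_derivative)
    moreover have "(\<Sum>\<alpha>\<in>\<Delta>. c \<alpha> * (\<Sum>j\<in>UNIV. monom_diff j \<alpha> u * v$j)) = 0" for v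
    proof -
      have "(\<Sum>\<alpha>\<in>\<Delta>. c \<alpha> * monom_diff j \<alpha> u) = 0" for j
      proof -
        have "u$j * (\<Sum>\<alpha>\<in>\<Delta>. c \<alpha> * monom_diff j \<alpha> u) = (\<Sum>\<alpha>\<in>\<Delta>. c \<alpha> * (u$j * monom_diff j \<alpha> u))"
          by (simp add: sum_distrib_left mult_ac)
        also have "\<dots> = a j" unfolding monom_diff_mult a_def by (simp add: mult_ac)
        finally show ?thesis using a0 u[of j] by simp
      qed
      moreover have "(\<Sum>\<alpha>\<in>\<Delta>. c \<alpha> * (\<Sum>j\<in>UNIV. monom_diff j \<alpha> u * v$j)) =
          (\<Sum>j\<in>UNIV. (\<Sum>\<alpha>\<in>\<Delta>. c \<alpha> * monom_diff j \<alpha> u) * v$j)"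
        by (simp add: sum_distrib_left sum_distrib_right mult.assoc) (rule sum.swap)
      ultimately show ?thesis by simp
    qed
    ultimately have "(face_fun c P has_derivative (\<lambda>v. 0)) (at u)" by simp
    moreover have "face_fun c P u = 0" using True unfolding face F0_def .
    ultimately show False using nd P u unfolding nondegenerate_def by blast
  next
    case False
    have "(\<lambda>k. (of_real (exp (Y k)) * (\<nu> (r k) * of_real (\<tau> k))) / (of_real (exp (Y k)) * f (z (r k)))) \<longlonglongrightarrow> of_nat d * F0 / F0"
      by (intro tendsto_divide lim\<tau> limf False)
    then have "(\<lambda>k. Re (\<nu> (r k) * of_real (\<tau> k) / f (z (r k)))) \<longlonglongrightarrow> Re (of_nat d)"
      using False by (intro tendsto_Re) simp
    then have "\<forall>\<^sub>F k in sequentially. 0 < Re (\<nu> (r k) * of_real (\<tau> k) / f (z (r k)))"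
      by (rule order_tendstoD) (use \<Delta>(3) in \<open>simp add: d_def\<close>)
    then obtain k where k: "0 < Re (\<nu> (r k) * of_real (\<tau> k) / f (z (r k)))"
      unfolding eventually_sequentially by blast
    have eq: "\<nu> (r k) * of_real (\<tau> k) / f (z (r k)) = of_real (\<tau> k) * (\<nu> (r k) / f (z (r k)))" by simp
    have "0 < \<tau> k * Re (\<nu> (r k) / f (z (r k)))"
      using k unfolding eq by (simp only: times_complex.sel Re_complex_of_real Im_complex_of_real mult_zero_left diff_zero)
    then have "Re (\<nu> (r k) / f (z (r k))) > 0" using \<tau>0[of k] by (simp add: zero_less_mult_iff)
    moreover have "f (z (r k)) \<noteq> 0" using k by auto
    ultimately show False using bad by blast
  qed
qed

section \<open>Small spheres and the weighted homogeneous case\<close>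

lemma mixed_grad_euler:
  assumes ab: "0 < b" "b < a" and \<nu>: "\<And>j. w$j \<noteq> 0 \<Longrightarrow> mixed_grad c a b w j = \<nu>"
  shows "mixed_map a b w $ j * series_diff c j (mixed_map a b w) = \<nu> * complex_of_real ((cmod (w$j))\<^sup>2)"
proof (cases "w$j = 0")
  case True
  then show ?thesis using ab by (simp add: mixed_map_def zero_power)
next
  case False
  have pa: "(w$j) ^ a = w$j * (w$j) ^ (a - 1)" using ab by (cases a) auto
  have pb: "cnj (w$j) ^ b = cnj (w$j) * cnj (w$j) ^ (b - 1)" using ab by (cases b) auto
  have "mixed_map a b w $ j * series_diff c j (mixed_map a b w) = mixed_grad c a b w j * (w$j * cnj (w$j))"
    by (simp add: mixed_grad_def) (simp add: mixed_map_def pa pb mult_ac)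
  then show ?thesis unfolding \<nu>[OF False] complex_norm_square .
qed

lemma mixed_map_eq_0_iff: "0 < a \<Longrightarrow> mixed_map a b w = 0 \<longleftrightarrow> w = 0"
  by (auto simp: mixed_map_def vec_eq_iff zero_power)

lemma mixed_map_small:
  assumes "0 < a" "e > 0"
  obtains r0 where "r0 > 0" "\<And>w :: complex^'n::finite. norm w \<le> r0 \<Longrightarrow> norm (mixed_map a b w) < e"
proof -
  have "isCont (mixed_map a b :: complex^'n \<Rightarrow> complex^'n) 0"
  proof -
    have "continuous_on UNIV (mixed_map a b :: complex^'n \<Rightarrow> complex^'n)"
      unfolding mixed_map_def[abs_def] by (intro continuous_intros)
    then show ?thesis by (simp add: continuous_on_eq_continuous_at)
  qed
  then obtain d where d: "d > 0" "\<And>w :: complex^'n. norm w < d \<Longrightarrow> norm (mixed_map a b w) < e"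
    using assms mixed_map_eq_0_iff[OF assms(1), of b "0 :: complex^'n"]
    unfolding continuous_at_eps_delta by (auto simp: dist_norm)
  show thesis by (rule that[of "d/2"]) (use d in auto)
qed

lemma finite_power_series:
  assumes "finite {\<alpha>. c \<alpha> \<noteq> 0}" "\<And>z. f z = (\<Sum>\<alpha>\<in>{\<alpha>. c \<alpha> \<noteq> 0}. c \<alpha> * monom \<alpha> z)" "R > 0"
  shows "power_series_near0 c f R"
  unfolding power_series_near0_def
proof (intro conjI ballI)
  fix z
  show "((\<lambda>\<alpha>. c \<alpha> * monom \<alpha> z) has_sum f z) UNIV"
    by (rule has_sum_finite_neutralI[of "{\<alpha>. c \<alpha> \<noteq> 0}"]) (use assms in auto)
qed (use assms in simp)

lemma sum_mult_axis: "(\<Sum>i\<in>UNIV. F i * axis j 1 $ i) = F j" for F :: "'n::finite \<Rightarrow> complex"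
  by (simp add: axis_def if_distrib[of "(*) _"] cong: if_cong)

text \<open>Both sides are the partial derivative of f. The lemma links the given expansion c with
  the polynomial one from weighted homogeneity.\<close>

lemma series_diff_unique:
  assumes "power_series_near0 c f \<epsilon>" "power_series_near0 c' f \<epsilon>'" "z \<in> ball 0 \<epsilon>" "z \<in> ball 0 \<epsilon>'"
  shows "series_diff c j z = series_diff c' j z"
proof -
  have "(\<lambda>v. \<Sum>i\<in>UNIV. series_diff c i z * v$i) = (\<lambda>v. \<Sum>i\<in>UNIV. series_diff c' i z * v$i)"
    by (rule has_derivative_unique[OF power_series_has_derivative[OF assms(1,3)] power_series_has_derivative[OF assms(2,4)]])
  from fun_cong[OF this, of "axis j 1"] show ?thesis by (simp only: sum_mult_axis)
qed

text \<open>Differentiate the homogeneity relation in t at t = 1 for Euler's relation, and in z for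
  the homogeneity of the partial derivatives.\<close>

lemma weighted_homog_diff:
  fixes p :: "'n::finite \<Rightarrow> nat" and c :: "('n \<Rightarrow> nat) \<Rightarrow> complex"
  assumes ps: "\<And>R. R > 0 \<Longrightarrow> power_series_near0 c f R"
    and hom: "\<And>(t::complex) z. f (\<chi> j. t ^ p j * z$j) = t ^ d * f z"
  shows weighted_euler: "(\<Sum>j\<in>UNIV. of_nat (p j) * (z$j * series_diff c j z)) = of_nat d * f z"
    and weighted_homog_series_diff: "t ^ p j * series_diff c j (\<chi> j. t ^ p j * z$j) = t ^ d * series_diff c j z"
proof -
  have der: "(f has_derivative (\<lambda>v. \<Sum>j\<in>UNIV. series_diff c j y * v$j)) (at y)" for y
    using power_series_has_derivative[OF ps[of "norm y + 1"], of y] norm_ge_zero[of y] by simp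
  let ?M = "\<lambda>t y. (\<chi> j. t ^ p j * y$j) :: complex^'n"
  have "((\<lambda>t. f (?M t z)) has_derivative (\<lambda>h. \<Sum>j\<in>UNIV. series_diff c j (?M 1 z) * (of_nat (p j) * h * 1 ^ (p j - 1) * z$j))) (at (1::complex))"
  proof -
    have "((\<lambda>t. ?M t z) has_derivative (\<lambda>h. \<chi> j. of_nat (p j) * h * 1 ^ (p j - 1) * z$j)) (at (1::complex))"
      by (intro has_derivative_vec_lambda has_derivative_mult_left has_derivative_power has_derivative_ident)
    from has_derivative_compose[OF this der] show ?thesis by simp
  qed
  moreover have "((\<lambda>t. f (?M t z)) has_derivative (\<lambda>h. of_nat d * h * 1 ^ (d - 1) * f z)) (at (1::complex))"
    unfolding hom by (intro has_derivative_mult_left has_derivative_power has_derivative_ident)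
  ultimately have "(\<lambda>h. \<Sum>j\<in>UNIV. series_diff c j (?M 1 z) * (of_nat (p j) * h * 1 ^ (p j - 1) * z$j)) = (\<lambda>h. of_nat d * h * 1 ^ (d - 1) * f z)"
    by (rule has_derivative_unique)
  from fun_cong[OF this, of 1] show "(\<Sum>j\<in>UNIV. of_nat (p j) * (z$j * series_diff c j z)) = of_nat d * f z"
    by (simp add: mult_ac)
  have "((\<lambda>y. f (?M t y)) has_derivative (\<lambda>v. \<Sum>j\<in>UNIV. series_diff c j (?M t z) * (t ^ p j * v$j))) (at z)"
  proof -
    have "((\<lambda>y. ?M t y) has_derivative (\<lambda>v. \<chi> j. t ^ p j * v$j)) (at z)"
      by (intro has_derivative_vec_lambda has_derivative_mult_right bounded_linear_imp_has_derivative bounded_linear_vec_nth)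
    from has_derivative_compose[OF this der] show ?thesis by simp
  qed
  moreover have "((\<lambda>y. f (?M t y)) has_derivative (\<lambda>v. t ^ d * (\<Sum>j\<in>UNIV. series_diff c j z * v$j))) (at z)"
    unfolding hom by (intro has_derivative_mult_right der)
  ultimately have "(\<lambda>v. \<Sum>j\<in>UNIV. series_diff c j (?M t z) * (t ^ p j * v$j)) = (\<lambda>v. t ^ d * (\<Sum>j\<in>UNIV. series_diff c j z * v$j))"
    by (rule has_derivative_unique)
  from fun_cong[OF this, of "axis j 1"]
  show "t ^ p j * series_diff c j (?M t z) = t ^ d * series_diff c j z"
    by (simp only: mult.assoc[symmetric] sum_mult_axis) (simp only: mult.commute)
qed

theorem mainTheorem10:
  fixes f :: "complex^'n::finite \<Rightarrow> complex"
    and c :: "('n \<Rightarrow> nat) \<Rightarrow> complex"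
    and \<epsilon> :: real
    and a b :: nat
  assumes "CARD('n) \<ge> 2"
    and "power_series_near0 c f \<epsilon>"
    and "f 0 = 0"
    and "convenient c"
    and "nondegenerate c"
    and "0 < b" and "b < a"
  shows "(\<exists>r0>0. \<forall>r. 0 < r \<and> r \<le> r0 \<longrightarrow> carries_contact (mixed_fun a b f) r) \<and>
         (weighted_homog_poly f \<longrightarrow> (\<forall>r>0. carries_contact (mixed_fun a b f) r))"
proof -
  note n = assms(1) and ps = assms(2) and ab = assms(6,7)
  have a: "0 < a" using ab by simp
  have \<epsilon>: "\<epsilon> > 0" using ps unfolding power_series_near0_def by simp
  obtain \<delta> where \<delta>: "\<delta> > 0"
    and local: "\<And>z \<nu> t. z \<noteq> 0 \<Longrightarrow> norm z < \<delta> \<Longrightarrow> (\<And>j. t j \<ge> 0) \<Longrightarrow>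
       (\<And>j. z$j * series_diff c j z = \<nu> * complex_of_real (t j)) \<Longrightarrow> f z \<noteq> 0 \<and> Re (\<nu> / f z) > 0"
    using euler_ratio_positive_near_0[OF ps assms(3-5)] by metis
  obtain r0 where r0: "r0 > 0" "\<And>w :: complex^'n. norm w \<le> r0 \<Longrightarrow> norm (mixed_map a b w) < min \<delta> \<epsilon>"
    using mixed_map_small[OF a, of "min \<delta> \<epsilon>" b] \<delta> \<epsilon> by (metis min_less_iff_conj)
  have "carries_contact (mixed_fun a b f) r" if r: "0 < r" "r \<le> r0" for r
  proof (rule carries_contactI[OF n ps r(1) ab])
    show "mixed_map a b w \<in> ball 0 \<epsilon>" if "norm w = r" for w :: "complex^'n"
      using r0(2)[of w] that r by simp
    fix w :: "complex^'n" and \<nu>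
    assume w: "norm w = r" and \<nu>: "\<And>j. w$j \<noteq> 0 \<Longrightarrow> mixed_grad c a b w j = \<nu>"
    have "w \<noteq> 0" using w r by auto
    show "mixed_fun a b f w \<noteq> 0 \<and> Re (\<nu> / mixed_fun a b f w) > 0"
      unfolding mixed_fun_eq
    proof (rule local[where t = "\<lambda>j. (cmod (w$j))\<^sup>2"])
      show "mixed_map a b w \<noteq> 0" using \<open>w \<noteq> 0\<close> a by (simp add: mixed_map_eq_0_iff)
      show "norm (mixed_map a b w) < \<delta>" using r0(2)[of w] w r by simp
      show "mixed_map a b w $ j * series_diff c j (mixed_map a b w) = \<nu> * complex_of_real ((cmod (w$j))\<^sup>2)" for j
        by (rule mixed_grad_euler[OF ab \<nu>])
    qed simp
  qed
  moreover have "carries_contact (mixed_fun a b f) r" if wh: "weighted_homog_poly f" and r: "r > 0" for r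
  proof -
    obtain c' where fin: "finite {\<alpha>. c' \<alpha> \<noteq> 0}" and f: "\<And>z. f z = (\<Sum>\<alpha>\<in>{\<alpha>. c' \<alpha> \<noteq> 0}. c' \<alpha> * monom \<alpha> z)"
      using wh unfolding weighted_homog_poly_def by blast
    obtain p d where p: "\<forall>j. p j > 0" and d: "d > (0::nat)"
      and hom': "\<forall>(t::complex) z. f (\<chi> j. t ^ p j * z$j) = t ^ d * f z"
      using wh unfolding weighted_homog_poly_def by blast
    note hom = hom'[rule_format]
    \<comment> \<open>A polynomial converges on every ball, so the image of a sphere of any radius
      is allowed.\<close>
    have ps': "power_series_near0 c' f R" if "R > 0" for R
      by (rule finite_power_series[OF fin f that])
    have "continuous_on UNIV (mixed_map a b :: complex^'n \<Rightarrow> complex^'n)"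
      unfolding mixed_map_def[abs_def] by (intro continuous_intros)
    then have "compact (mixed_map a b ` sphere (0::complex^'n) r)"
      by (intro compact_continuous_image compact_sphere) (rule continuous_on_subset, auto)
    then have "bounded (mixed_map a b ` sphere (0::complex^'n) r)" by (rule compact_imp_bounded)
    then obtain R where R: "R > 0" "mixed_map a b ` sphere (0::complex^'n) r \<subseteq> ball 0 R"
      using bounded_subset_ballD[of "mixed_map a b ` sphere (0::complex^'n) r" 0] by auto
    show ?thesis
    proof (rule carries_contactI[OF n ps'[OF R(1)] r ab])
      show "mixed_map a b w \<in> ball 0 R" if "norm w = r" for w :: "complex^'n"
        using R(2) that by (auto simp: image_subset_iff)
      fix w :: "complex^'n" and \<nu>
      assume w: "norm w = r" and \<nu>: "\<And>j. w$j \<noteq> 0 \<Longrightarrow> mixed_grad c' a b w j = \<nu>"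
      have wnz: "w \<noteq> 0" using w r by auto
      define z where "z = mixed_map a b w"
      have znz: "z \<noteq> 0" using wnz a by (simp add: z_def mixed_map_eq_0_iff)
      have A: "z$j * series_diff c' j z = \<nu> * of_real ((cmod (w$j))\<^sup>2)" for j
        unfolding z_def by (rule mixed_grad_euler[OF ab \<nu>])
      define \<tau> where "\<tau> = (\<Sum>j\<in>UNIV. real (p j) * (cmod (w$j))\<^sup>2)"
      have \<tau>: "\<tau> > 0"
      proof -
        obtain j where "w$j \<noteq> 0" using wnz by (auto simp: vec_eq_iff)
        then show ?thesis unfolding \<tau>_def by (intro sum_pos2[of _ j]) (use p in auto)
      qed
      have euler: "\<nu> * of_real \<tau> = of_nat d * f z"
        using weighted_euler[of c' f p d z, OF ps' hom] unfolding A \<tau>_def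
        by (simp add: sum_distrib_left mult_ac)
      \<comment> \<open>If f z = 0, then \<nu> = 0 and all z_j \<partial>_j f vanish at z. The
        weighted action with small t > 0 moves this to a point y near 0, where \<open>local\<close>
        with \<nu> = 0 and zero weights would give Re (0 / f y) > 0.\<close>
      have fz: "f z \<noteq> 0"
      proof
        assume fz: "f z = 0"
        then have "\<nu> = 0" using euler \<tau> by simp
        then have A0: "z$j * series_diff c' j z = 0" for j using A by simp
        have "((\<lambda>t::real. \<chi> j. of_real t ^ p j * z$j) \<longlongrightarrow> (\<chi> j. of_real 0 ^ p j * z$j)) (at_right 0)"
          by (intro vec_tendstoI) (auto intro!: tendsto_eq_intros)
        moreover have "(\<chi> j. of_real 0 ^ p j * z$j) = 0"
          using p by (simp add: vec_eq_iff zero_power)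
        ultimately have "((\<lambda>t::real. norm (\<chi> j. of_real t ^ p j * z$j)) \<longlongrightarrow> 0) (at_right 0)"
          by (intro tendsto_norm_zero) simp
        then have "\<forall>\<^sub>F t in at_right 0. norm (\<chi> j. of_real t ^ p j * z$j) < min \<delta> \<epsilon>"
          by (rule order_tendstoD) (use \<delta> \<epsilon> in simp)
        moreover have "\<forall>\<^sub>F t in at_right (0::real). 0 < t" by (rule eventually_at_right_less)
        ultimately have "\<forall>\<^sub>F t in at_right (0::real). 0 < t \<and> norm (\<chi> j. of_real t ^ p j * z$j) < min \<delta> \<epsilon>"
          by eventually_elim simp
        then obtain t where t: "0 < t" "norm (\<chi> j. of_real t ^ p j * z$j) < min \<delta> \<epsilon>"
          using eventually_happens'[of "at_right (0::real)"] by auto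
        define y where "y = (\<chi> j. complex_of_real t ^ p j * z$j)"
        have y: "norm y < \<delta>" "norm y < \<epsilon>" using t(2) by (simp_all add: y_def)
        have ynz: "y \<noteq> 0" using znz t(1) by (auto simp: y_def vec_eq_iff)
        have "y$j * series_diff c j y = 0" for j
        proof -
          have e1: "series_diff c j y = series_diff c' j y"
            by (rule series_diff_unique[OF ps ps'[of "norm y + 1"]]) (use y add_nonneg_pos[OF norm_ge_zero zero_less_one, of y] in auto)
          have e2: "y$j * series_diff c' j y = z$j * (of_real t ^ p j * series_diff c' j y)"
            by (simp add: y_def)
          have e3: "of_real t ^ p j * series_diff c' j y = of_real t ^ d * series_diff c' j z"
            unfolding y_def by (rule weighted_homog_series_diff[OF ps' hom])
          have "y$j * series_diff c j y = of_real t ^ d * (z$j * series_diff c' j z)"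
            unfolding e1 e2 e3 by (rule mult.left_commute)
          then show ?thesis using A0 by simp
        qed
        then have "Re (0 / f y) > 0" using local[OF ynz y(1), of "\<lambda>_. 0" 0] by simp
        then show False by simp
      qed
      have "\<nu> / f z = of_real (real d / \<tau>)"
        using euler fz \<tau> by (simp add: field_simps)
      then show "mixed_fun a b f w \<noteq> 0 \<and> Re (\<nu> / mixed_fun a b f w) > 0"
        using fz d \<tau> unfolding mixed_fun_eq z_def[symmetric] by simp
    qed
  qed
  ultimately show ?thesis using r0(1) by blast
qed

end
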